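(* Let $N=N_{\underline{\mu},P}=\Gamma_{\underline{\mu},P}\backslash(\mathbb{C}^{2n}\ltimes_\rho\mathbb{C}^{2m})$ be the compact complex solvmanifold of complex dimension $2n+2m$ defined in the context. Then $N$ is not geometrically-Bott-Chern-formal, i.e. $N$ does not admit any geometrically-Bott-Chern-formal Hermitian metric.
   Context: The manifolds $N_{\underline{\mu},P}$. Let $n,m\ge1$ and let $M\in SL(2m;\mathbb{Z})$ be diagonalizable over $\mathbb{R}$ with $PMP^{-1}=\mathrm{diag}(e^{\lambda},e^{-\lambda},\dots,e^{\lambda},e^{-\lambda})$ for some $\lambda\in\mathbb{R}\setminus\{0\}$ and $P\in GL(2m;\mathbb{R})$. For $w=(w_1,\dots,w_{2n})\in\mathbb{C}^{2n}$ put $\phi(w)=\lambda(w_1+\bar w_2+\dots+w_{2n-1}+\bar w_{2n})$ and let $\rho:\mathbb{C}^{2n}\to GL(2m;\mathbb{C})$, $\rho(w)=\mathrm{diag}(e^{\phi(w)},e^{-\overline{\phi(w)}},\dots,e^{\phi(w)},e^{-\overline{\phi(w)}})$. Consider the semidirect product $\mathbb{C}^{2n}\ltimes_\rho\mathbb{C}^{2m}$, with coordinates $(w_1,\dots,w_{2n},z_1,\dots,z_{2m})$. Let $\underline{\mu}=\mathrm{diag}(\mu_1,\dots,\mu_{2n})$ with $\mu_i=\frac{2k_i\pi}{\lambda}$, $k_i\in\mathbb{Z}\setminus\{0\}$, and put $\Gamma'_{\underline{\mu}}=\mathbb{Z}^{2n}\oplus\sqrt{-1}\,\underline{\mu}\,\mathbb{Z}^{2n}$,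 $\Gamma''_P=P\mathbb{Z}^{2m}\oplus\sqrt{-1}P\mathbb{Z}^{2m}$, $\Gamma_{\underline{\mu},P}=\Gamma'_{\underline{\mu}}\ltimes_\rho\Gamma''_P$, a discrete subgroup of $\mathbb{C}^{2n}\ltimes_\rho\mathbb{C}^{2m}$. The complex structure on the quotient $N_{\underline{\mu},P}$ is the one with global coframe of $(1,0)$-forms $\varphi^i=dw_i$ ($1\le i\le 2n$), $\psi^{2j+1}=e^{-\phi(w)}dz_{2j+1}$, $\psi^{2j+2}=e^{\overline{\phi(w)}}dz_{2j+2}$ ($0\le j\le m-1$). Geometrically-Bott-Chern-formal metrics. On a compact complex manifold $X$ of complex dimension $d$ with Hermitian metric $g$, let $*:\mathcal{A}^{p,q}(X)\to\mathcal{A}^{d-p,d-q}(X)$ be the $\mathbb{C}$-antilinear Hodge star operator. A $(p,q)$-form $\alpha$ is Bott--Chern harmonic if $\partial\alpha=0$, $\bar\partial\alpha=0$ and $\partial\bar\partial{*}\alpha=0$. The metric $g$ is geometrically-Bott-Chern-formal if the space of Bott--Chern harmonic forms (direct sum over all bidegrees) is closed under the wedge product. *)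

theory Defs
  imports "HOL-Analysis.Analysis"
begin

section \<open>Complex forms on quotients of a complex vector space\<close>

text \<open>
  Let V be a Euclidean space with a linear complex structure J and let T be a set of
  J-holomorphic diffeomorphisms of V forming a group that acts freely and properly
  discontinuously. Tensor fields on the complex manifold X obtained as the quotient of V by T
  correspond bijectively to T-invariant tensor fields on V (pull back along the covering
  projection), and this correspondence respects smoothness, bidegree, wedge product, the operators
  del and delbar, Hermitian metrics and Hodge stars. Forms and metrics on X are represented
  in this way throughout; the complex dimension of X is DIM(V) div 2.

  A complex-valued covector of mixed degree is a function on lists of (real) tangent vectors; its
  restriction to the lists of length k is its component of degree k.
\<close>

type_synonym 'a multicovector = "'a list \<Rightarrow> complex"
type_synonym 'a form = "'a \<Rightarrow> 'a multicovector"
type_synonym 'a metric = "'a \<Rightarrow> 'a \<Rightarrow> 'a \<Rightarrow> real"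

definition alternating_multicovectors :: "'a::real_vector multicovector set" where
  "alternating_multicovectors =
    {a. (\<forall>us vs. linear (\<lambda>v. a (us @ v # vs))) \<and> (\<forall>vs. \<not> distinct vs \<longrightarrow> a vs = 0)}"

definition shuffle_sign :: "nat \<Rightarrow> nat set \<Rightarrow> complex" where
  "shuffle_sign k S = (-1) ^ card {(i, j). i \<in> S \<and> j \<in> {..<k} - S \<and> j < i}"

definition wedge :: "'a multicovector \<Rightarrow> 'a multicovector \<Rightarrow> 'a multicovector"
    (infixr \<open>\<and>\<^sub>w\<close> 70) where
  "a \<and>\<^sub>w b = (\<lambda>vs. \<Sum>S\<in>Pow {..<length vs}.
      shuffle_sign (length vs) S * a (nths vs S) * b (nths vs (- S)))"

definition unit_covector :: "'a multicovector" where
  "unit_covector vs = (if vs = [] then 1 else 0)"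

definition covector1 :: "('a \<Rightarrow> complex) \<Rightarrow> 'a multicovector" where
  "covector1 \<theta> vs = (case vs of [v] \<Rightarrow> \<theta> v | _ \<Rightarrow> 0)"

definition wedge_list :: "('a \<Rightarrow> complex) list \<Rightarrow> 'a multicovector" where
  "wedge_list \<theta>s = foldr (\<lambda>\<theta> a. covector1 \<theta> \<and>\<^sub>w a) \<theta>s unit_covector"

definition covectors10 :: "('a::real_vector \<Rightarrow> 'a) \<Rightarrow> ('a \<Rightarrow> complex) set" where
  "covectors10 J = {\<theta>. linear \<theta> \<and> (\<forall>v. \<theta> (J v) = \<i> * \<theta> v)}"

definition covectors01 :: "('a::real_vector \<Rightarrow> 'a) \<Rightarrow> ('a \<Rightarrow> complex) set" where
  "covectors01 J = {\<theta>. linear \<theta> \<and> (\<forall>v. \<theta> (J v) = - \<i> * \<theta> v)}"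

inductive_set pq_covectors :: "('a::real_vector \<Rightarrow> 'a) \<Rightarrow> nat \<Rightarrow> nat \<Rightarrow> 'a multicovector set"
  for J p q where
  wedge: "\<lbrakk>set \<alpha>s \<subseteq> covectors10 J; length \<alpha>s = p; set \<beta>s \<subseteq> covectors01 J; length \<beta>s = q\<rbrakk>
      \<Longrightarrow> wedge_list (\<alpha>s @ \<beta>s) \<in> pq_covectors J p q"
| add: "\<lbrakk>a \<in> pq_covectors J p q; b \<in> pq_covectors J p q\<rbrakk>
      \<Longrightarrow> (\<lambda>vs. a vs + b vs) \<in> pq_covectors J p q"
| scale: "a \<in> pq_covectors J p q \<Longrightarrow> (\<lambda>vs. c * a vs) \<in> pq_covectors J p q"

fun differentiable_times :: "nat \<Rightarrow> ('a::real_normed_vector \<Rightarrow> 'b::real_normed_vector) \<Rightarrow> bool" where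
  "differentiable_times 0 f \<longleftrightarrow> continuous_on UNIV f"
| "differentiable_times (Suc k) f \<longleftrightarrow>
    (\<forall>x. f differentiable (at x)) \<and>
    (\<forall>v. differentiable_times k (\<lambda>x. frechet_derivative f (at x) v))"

definition smooth :: "('a::real_normed_vector \<Rightarrow> 'b::real_normed_vector) \<Rightarrow> bool" where
  "smooth f \<longleftrightarrow> (\<forall>k. differentiable_times k f)"

definition pullback :: "('a::real_normed_vector \<Rightarrow> 'a) \<Rightarrow> 'a form \<Rightarrow> 'a form" where
  "pullback \<tau> \<alpha> = (\<lambda>x vs. \<alpha> (\<tau> x) (map (frechet_derivative \<tau> (at x)) vs))"

definition pq_forms ::
  "('a::real_normed_vector \<Rightarrow> 'a) \<Rightarrow> ('a \<Rightarrow> 'a) set \<Rightarrow> nat \<Rightarrow> nat \<Rightarrow> 'a form set" where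
  "pq_forms J T p q =
    {\<alpha>. (\<forall>vs. smooth (\<lambda>x. \<alpha> x vs)) \<and> (\<forall>x. \<alpha> x \<in> pq_covectors J p q) \<and>
        (\<forall>\<tau>\<in>T. pullback \<tau> \<alpha> = \<alpha>)}"

text \<open>
  In holomorphic linear coordinates, del is the sum of the dz_k wedge (d/dz_k), and delbar the
  sum of the dzbar_k wedge (d/dzbar_k). Written without coordinates, the (1,0)-part of the
  differential of a function f is the map sending v to (df(v) - i df(Jv)) / 2, and its (0,1)-part
  sends v to (df(v) + i df(Jv)) / 2.
\<close>

definition del :: "('a::real_normed_vector \<Rightarrow> 'a) \<Rightarrow> 'a form \<Rightarrow> 'a form" where
  "del J \<alpha> = (\<lambda>x vs. \<Sum>i<length vs. (-1) ^ i *
      (let D = frechet_derivative (\<lambda>y. \<alpha> y (take i vs @ drop (Suc i) vs)) (at x)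
       in (D (vs ! i) - \<i> * D (J (vs ! i))) / 2))"

definition delbar :: "('a::real_normed_vector \<Rightarrow> 'a) \<Rightarrow> 'a form \<Rightarrow> 'a form" where
  "delbar J \<alpha> = (\<lambda>x vs. \<Sum>i<length vs. (-1) ^ i *
      (let D = frechet_derivative (\<lambda>y. \<alpha> y (take i vs @ drop (Suc i) vs)) (at x)
       in (D (vs ! i) + \<i> * D (J (vs ! i))) / 2))"

definition hermitian_metric ::
  "('a::real_normed_vector \<Rightarrow> 'a) \<Rightarrow> ('a \<Rightarrow> 'a) set \<Rightarrow> 'a metric \<Rightarrow> bool" where
  "hermitian_metric J T g \<longleftrightarrow>
    (\<forall>x u. linear (g x u)) \<and>
    (\<forall>x u v. g x u v = g x v u) \<and>
    (\<forall>x u. u \<noteq> 0 \<longrightarrow> g x u u > 0) \<and>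
    (\<forall>x u v. g x (J u) (J v) = g x u v) \<and>
    (\<forall>u v. smooth (\<lambda>x. g x u v)) \<and>
    (\<forall>\<tau>\<in>T. \<forall>x u v.
        g (\<tau> x) (frechet_derivative \<tau> (at x) u) (frechet_derivative \<tau> (at x) v) = g x u v)"

definition fundamental_form :: "('a \<Rightarrow> 'a) \<Rightarrow> 'a metric \<Rightarrow> 'a form" where
  "fundamental_form J g = (\<lambda>x vs. case vs of [u, v] \<Rightarrow> of_real (g x (J u) v) | _ \<Rightarrow> 0)"

definition volume_form :: "('a::euclidean_space \<Rightarrow> 'a) \<Rightarrow> 'a metric \<Rightarrow> 'a form" where
  "volume_form J g = (\<lambda>x vs.
      ((\<lambda>a. fundamental_form J g x \<and>\<^sub>w a) ^^ (DIM('a) div 2)) unit_covector vs / fact (DIM('a) div 2))"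

definition orthonormal_frame :: "'a::euclidean_space metric \<Rightarrow> 'a \<Rightarrow> 'a list \<Rightarrow> bool" where
  "orthonormal_frame g x es \<longleftrightarrow> length es = DIM('a) \<and>
    (\<forall>i<length es. \<forall>j<length es. g x (es ! i) (es ! j) = (if i = j then 1 else 0))"

text \<open>
  The Hermitian inner product induced on covectors: the wedge monomials in the dual of an
  orthonormal frame are orthonormal. It does not depend on the chosen frame.
\<close>

definition covector_inner ::
  "'a::euclidean_space metric \<Rightarrow> 'a \<Rightarrow> 'a multicovector \<Rightarrow> 'a multicovector \<Rightarrow> complex" where
  "covector_inner g x a b =
    (let es = (SOME es. orthonormal_frame g x es)
     in \<Sum>S\<in>Pow {..<DIM('a)}. a (nths es S) * cnj (b (nths es S)))"

text \<open>
  The antilinear Hodge star of b is the unique c such that, in top degree, a wedge c equals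
  the inner product of a and b times the volume form, for all a.
\<close>

definition hodge_star :: "('a::euclidean_space \<Rightarrow> 'a) \<Rightarrow> 'a metric \<Rightarrow> 'a form \<Rightarrow> 'a form" where
  "hodge_star J g \<beta> = (\<lambda>x. THE c. c \<in> alternating_multicovectors \<and>
      (\<forall>a\<in>alternating_multicovectors. \<forall>vs. length vs = DIM('a) \<longrightarrow>
        (a \<and>\<^sub>w c) vs = covector_inner g x a (\<beta> x) * volume_form J g x vs))"

definition bc_harmonic_pq :: "('a::euclidean_space \<Rightarrow> 'a) \<Rightarrow> ('a \<Rightarrow> 'a) set \<Rightarrow> 'a metric \<Rightarrow>
    nat \<Rightarrow> nat \<Rightarrow> 'a form set" where
  "bc_harmonic_pq J T g p q =
    {\<alpha> \<in> pq_forms J T p q.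
      (\<forall>x vs. del J \<alpha> x vs = 0) \<and>
      (\<forall>x vs. delbar J \<alpha> x vs = 0) \<and>
      (\<forall>x vs. del J (delbar J (hodge_star J g \<alpha>)) x vs = 0)}"

definition bc_harmonic_forms ::
  "('a::euclidean_space \<Rightarrow> 'a) \<Rightarrow> ('a \<Rightarrow> 'a) set \<Rightarrow> 'a metric \<Rightarrow> 'a form set" where
  "bc_harmonic_forms J T g =
    {\<lambda>x vs. \<Sum>p\<le>DIM('a) div 2. \<Sum>q\<le>DIM('a) div 2. \<eta> p q x vs | \<eta>.
      \<forall>p q. \<eta> p q \<in> bc_harmonic_pq J T g p q}"

definition geometrically_BC_formal ::
  "('a::euclidean_space \<Rightarrow> 'a) \<Rightarrow> ('a \<Rightarrow> 'a) set \<Rightarrow> 'a metric \<Rightarrow> bool" where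
  "geometrically_BC_formal J T g \<longleftrightarrow>
    (\<forall>\<alpha>\<in>bc_harmonic_forms J T g. \<forall>\<beta>\<in>bc_harmonic_forms J T g.
      (\<lambda>x. \<alpha> x \<and>\<^sub>w \<beta> x) \<in> bc_harmonic_forms J T g)"

section \<open>The solvmanifolds\<close>

text \<open>
  Coordinates come in pairs: the 2n coordinates w are indexed by 'n \<times> bool, where (j, False) and
  (j, True) are the j-th odd and even index; similarly for the 2m coordinates z. The parameter
  l is the real number lambda.
\<close>

type_synonym ('n, 'm) cover = "(complex ^ ('n \<times> bool)) \<times> (complex ^ ('m \<times> bool))"

definition phi :: "real \<Rightarrow> complex ^ ('n::finite \<times> bool) \<Rightarrow> complex" where
  "phi l w = of_real l * (\<Sum>j\<in>UNIV. w $ (j, False) + cnj (w $ (j, True)))"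

definition rho :: "real \<Rightarrow> complex ^ ('n::finite \<times> bool) \<Rightarrow>
    complex ^ ('m::finite \<times> bool) ^ ('m \<times> bool)" where
  "rho l w = (\<chi> i j. if i = j then (if snd i then exp (- cnj (phi l w)) else exp (phi l w)) else 0)"

definition semidirect_mult ::
  "real \<Rightarrow> ('n::finite, 'm::finite) cover \<Rightarrow> ('n, 'm) cover \<Rightarrow> ('n, 'm) cover" where
  "semidirect_mult l a x = (fst a + fst x, snd a + rho l (fst a) *v snd x)"

definition mu :: "real \<Rightarrow> int ^ 'i \<Rightarrow> real ^ 'i" where
  "mu l k = (\<chi> i. 2 * of_int (k $ i) * pi / l)"

definition lattice_w :: "real \<Rightarrow> int ^ ('n::finite \<times> bool) \<Rightarrow> (complex ^ ('n \<times> bool)) set" where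
  "lattice_w l k = {\<chi> i. of_int (a $ i) + \<i> * of_real (mu l k $ i) * of_int (b $ i) | a b. True}"

definition lattice_z ::
  "real ^ ('m::finite \<times> bool) ^ ('m \<times> bool) \<Rightarrow> (complex ^ ('m \<times> bool)) set" where
  "lattice_z P = {\<chi> i. of_real ((P *v (\<chi> j. of_int (a $ j))) $ i)
      + \<i> * of_real ((P *v (\<chi> j. of_int (b $ j))) $ i) | a b :: int ^ ('m \<times> bool). True}"

definition Gamma :: "real \<Rightarrow> int ^ ('n::finite \<times> bool) \<Rightarrow>
    real ^ ('m::finite \<times> bool) ^ ('m \<times> bool) \<Rightarrow> ('n, 'm) cover set" where
  "Gamma l k P = lattice_w l k \<times> lattice_z P"

text \<open>Gamma acts by left translations; N is the quotient of the cover by these maps.\<close>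

definition deck_N :: "real \<Rightarrow> int ^ ('n::finite \<times> bool) \<Rightarrow>
    real ^ ('m::finite \<times> bool) ^ ('m \<times> bool) \<Rightarrow> (('n, 'm) cover \<Rightarrow> ('n, 'm) cover) set" where
  "deck_N l k P = semidirect_mult l ` Gamma l k P"

definition J_N :: "('n::finite, 'm::finite) cover \<Rightarrow> ('n, 'm) cover" where
  "J_N v = (\<i> *s fst v, \<i> *s snd v)"

text \<open>
  The coframe defining the complex structure of N, as forms on the tangent spaces (identified with
  the vector space itself). The lemma below shows that J_N is the only endomorphism of the tangent
  spaces for which all members of the coframe are of type (1,0).
\<close>

definition coframe_phi :: "'n::finite \<times> bool \<Rightarrow> ('n, 'm::finite) cover \<Rightarrow> ('n, 'm) cover \<Rightarrow> complex" where
  "coframe_phi i x v = fst v $ i"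

definition coframe_psi :: "real \<Rightarrow> 'm::finite \<times> bool \<Rightarrow>
    ('n::finite, 'm) cover \<Rightarrow> ('n, 'm) cover \<Rightarrow> complex" where
  "coframe_psi l i x v =
    (if snd i then exp (cnj (phi l (fst x))) else exp (- phi l (fst x))) * snd v $ i"

lemma J_N_unique:
  fixes x v v' :: "('n::finite, 'm::finite) cover"
  shows "v' = J_N v \<longleftrightarrow>
    (\<forall>i. coframe_phi i x v' = \<i> * coframe_phi i x v) \<and>
    (\<forall>i. coframe_psi l i x v' = \<i> * coframe_psi l i x v)"
proof -
  have "coframe_psi l i x v' = \<i> * coframe_psi l i x v \<longleftrightarrow> snd v' $ i = \<i> * snd v $ i" for i
    by (simp add: coframe_psi_def)
  then show ?thesis
    by (simp add: J_N_def coframe_phi_def prod_eq_iff vec_eq_iff)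
qed

definition hyperbolic_diag :: "real \<Rightarrow> real ^ ('m::finite \<times> bool) ^ ('m \<times> bool)" where
  "hyperbolic_diag l = (\<chi> i j. if i = j then exp (if snd i then - l else l) else 0)"

end

theory Submission
  imports Defs
begin

text \<open>
  Let d = 2n + 2m, and let h be lambda times the sum of the coordinates w_i. Since h and phi have the
  same real multipliers on the lattice, the wedge product exp(h) A of all coordinate differentials
  except one odd dz_i is a closed invariant (d-1,0)-form \<alpha>. The star of a (p,0)-form is
  killed by delbar and that of a (0,q)-form by del, so \<alpha> and its conjugate \<beta> are
  Bott-Chern harmonic for every Hermitian metric. If the metric were formal, then the (1,1)-form
  \<Omega> = *(\<alpha> \<and> \<beta>) would satisfy del delbar \<Omega> = 0.

  Up to a constant, the coefficient F of \<Omega> in the omitted direction Z is positive, and the deck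
  transformations translating the direction X of some w_j scale F exponentially. Evaluate
  del delbar \<Omega> = 0 on X, JX, Z, JZ and average over large boxes in the directions
  JX, Z, JZ: the coefficients of \<Omega> are bounded there by cocompactness of the lattice, so only the
  second X-derivative of F survives. The averages of F would thus be affine along X,
  contradicting the exponential growth.
\<close>

section \<open>Alternating covectors and the wedge product\<close>

text \<open>The metric is invariant under the lattice only, not under the whole group, so F is no
  explicit exponential and is known just through its rescaling by deck transformations. Symmetrizing
  the metric is no way out: the star depends on it nonlinearly, and formality need not survive. The
  equation del delbar \<Omega> = 0 is linear in \<Omega>, and it is this equation that gets
  averaged.

  Deck transformations that move along X also rescale Z and JZ. Hence the coefficients of \<Omega>
  are not periodic in that direction, and their bounds are available only over a bounded range of X.
  The boxes therefore keep a fixed size along X and grow only along JX, Z and JZ, where the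
  translations used have no holonomy; affinity is refuted by a single second difference of fixed
  step.

  The choice of h has a simple cause: phi contains the conjugates of half of the w_i, so exp(phi) A
  would not be closed. The choice of A is a matter of weights: the multipliers of all coordinates
  have product 1, and omitting one odd dz_i leaves the factor that exp(h) compensates.\<close>

lemma alternating_linear:
  "a \<in> alternating_multicovectors \<Longrightarrow> linear (\<lambda>v. a (us @ v # vs))"
  by (simp add: alternating_multicovectors_def)

lemma alternating_not_distinct:
  "a \<in> alternating_multicovectors \<Longrightarrow> \<not> distinct vs \<Longrightarrow> a vs = 0"
  by (simp add: alternating_multicovectors_def)

lemma alternating_add:
  "a \<in> alternating_multicovectors \<Longrightarrow> a (us @ (v + w) # vs) = a (us @ v # vs) + a (us @ w # vs)"
  using linear_add[OF alternating_linear] .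

lemma alternating_scaleR:
  "a \<in> alternating_multicovectors \<Longrightarrow> a (us @ (r *\<^sub>R v) # vs) = r *\<^sub>R a (us @ v # vs)"
  using linear_scale[OF alternating_linear] .

lemma swap_neg_if_linear:
  fixes a :: "'a::real_vector multicovector"
  assumes lin: "\<And>us vs. linear (\<lambda>v. a (us @ v # vs))"
    and adj: "\<And>us v vs. a (us @ v # v # vs) = 0"
  shows "a (us @ v # w # vs) = - a (us @ w # v # vs)"
proof -
  have 1: "a (us @ (v + w) # y # vs) = a (us @ v # y # vs) + a (us @ w # y # vs)" for y
    using linear_add[OF lin[of us "y # vs"]] .
  have 2: "a (us @ y # (v + w) # vs) = a (us @ y # v # vs) + a (us @ y # w # vs)" for y
    using linear_add[OF lin[of "us @ [y]" vs]] by simp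
  have "0 = a (us @ (v + w) # (v + w) # vs)" by (simp add: adj)
  also have "\<dots> = a (us @ v # w # vs) + a (us @ w # v # vs)"
    unfolding 1 2 by (simp add: adj)
  finally show ?thesis by (metis add_eq_0_iff2)
qed

text \<open>Polarization gives the sign rule for neighbouring swaps, and swaps carry one of two
  equal arguments towards the other until they are adjacent. Recursive arguments about lists can
  then restrict themselves to adjacent entries.\<close>

lemma alternatingI:
  fixes a :: "'a::real_vector multicovector"
  assumes lin: "\<And>us vs. linear (\<lambda>v. a (us @ v # vs))"
    and adj: "\<And>us v vs. a (us @ v # v # vs) = 0"
  shows "a \<in> alternating_multicovectors"
proof -
  have "a (us @ v # ys @ v # zs) = 0" for us v ys zs
  proof (induction ys arbitrary: us)
    case Nil
    then show ?case by (simp add: adj)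
  next
    case (Cons y ys)
    have "a (us @ v # y # ys @ v # zs) = - a (us @ y # v # ys @ v # zs)"
      by (rule swap_neg_if_linear[OF lin adj])
    also have "a (us @ y # v # ys @ v # zs) = 0"
      using Cons.IH[of "us @ [y]"] by simp
    finally show ?case by simp
  qed
  then have "a vs = 0" if "\<not> distinct vs" for vs
    using not_distinct_decomp[OF that] by auto
  with lin show ?thesis
    by (simp add: alternating_multicovectors_def)
qed

lemma alternating_swap:
  assumes "a \<in> alternating_multicovectors"
  shows "a (us @ v # w # vs) = - a (us @ w # v # vs)"
  by (rule swap_neg_if_linear[OF alternating_linear[OF assms]])
    (simp add: alternating_not_distinct[OF assms])

lemma alternating_swap_hd:
  "a \<in> alternating_multicovectors \<Longrightarrow> a (v # w # vs) = - a (w # v # vs)"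
  using alternating_swap[of a "[]" v w vs] by simp

lemma zero_alternating: "(\<lambda>vs. 0) \<in> alternating_multicovectors"
  by (simp add: alternating_multicovectors_def linear_zero)

lemma add_alternating:
  "a \<in> alternating_multicovectors \<Longrightarrow> b \<in> alternating_multicovectors \<Longrightarrow>
    (\<lambda>vs. a vs + b vs) \<in> alternating_multicovectors"
  by (simp add: alternating_multicovectors_def linear_compose_add)

text \<open>The hypothesis on \<open>f\<close> says that its value depends on the length of the list
  alone. This covers scalars, the sign \<open>(-1) ^ length vs\<close> and the projection to one
  degree.\<close>

lemma mult_alternating:
  fixes a :: "'a::real_vector multicovector"
  assumes "a \<in> alternating_multicovectors"
    and "\<And>us v w vs. f (us @ v # vs) = f (us @ w # vs)"
  shows "(\<lambda>vs. f vs * a vs) \<in> alternating_multicovectors"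
proof -
  have "linear (\<lambda>v. f (us @ v # vs) * a (us @ v # vs))" for us vs
  proof -
    have eq: "(\<lambda>v. f (us @ v # vs) * a (us @ v # vs)) = (\<lambda>v. f (us @ 0 # vs) * a (us @ v # vs))"
      by (intro ext arg_cong2[where f = times] refl assms(2))
    have "linear ((*) (f (us @ 0 # vs)) \<circ> (\<lambda>v. a (us @ v # vs)))"
      by (rule linear_compose[OF alternating_linear[OF assms(1)] linear_times])
    then show ?thesis unfolding eq o_def .
  qed
  then show ?thesis
    using assms(1) by (simp add: alternating_multicovectors_def)
qed

lemma scale_alternating:
  "a \<in> alternating_multicovectors \<Longrightarrow> (\<lambda>vs. c * a vs) \<in> alternating_multicovectors"
  by (rule mult_alternating) simp_all

lemma sum_alternating:
  "(\<And>i. i \<in> I \<Longrightarrow> a i \<in> alternating_multicovectors) \<Longrightarrow>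
    (\<lambda>vs. \<Sum>i\<in>I. a i vs) \<in> alternating_multicovectors"
  by (induction I rule: infinite_finite_induct) (simp_all add: zero_alternating add_alternating)

section \<open>Interior products and the grade involution\<close>

text \<open>The interior product. A covector is determined by its contractions and its value at
  \<open>[]\<close>, and most inductions over argument lists below rest on this recursion.\<close>

definition contract :: "'a \<Rightarrow> 'a multicovector \<Rightarrow> 'a multicovector" where
  "contract v a = (\<lambda>vs. a (v # vs))"

text \<open>The sign operator that makes contraction an antiderivation of the wedge product.\<close>

definition grade_involution :: "'a multicovector \<Rightarrow> 'a multicovector" where
  "grade_involution a = (\<lambda>vs. (-1) ^ length vs * a vs)"

lemma contract_alternating:
  assumes "a \<in> alternating_multicovectors"
  shows "contract v a \<in> alternating_multicovectors"
proof -
  have "linear (\<lambda>w. a (v # us @ w # vs))" for us vs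
    using alternating_linear[OF assms, of "v # us" vs] by simp
  then show ?thesis
    using assms by (auto simp: alternating_multicovectors_def contract_def)
qed

lemma alternating_move:
  "a \<in> alternating_multicovectors \<Longrightarrow> a (us @ v # vs) = (-1) ^ length us * a (v # us @ vs)"
proof (induction us arbitrary: a)
  case (Cons u us)
  then have "contract u a (us @ v # vs) = (-1) ^ length us * contract u a (v # us @ vs)"
    by (intro Cons.IH contract_alternating)
  then show ?case
    using alternating_swap_hd[OF Cons.prems, of u v "us @ vs"] by (simp add: contract_def)
qed simp

lemma grade_involution_alternating:
  "a \<in> alternating_multicovectors \<Longrightarrow> grade_involution a \<in> alternating_multicovectors"
  unfolding grade_involution_def by (rule mult_alternating) simp_all

lemma contract_grade_involution:
  "contract v (grade_involution a) = (\<lambda>vs. - grade_involution (contract v a) vs)"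
  by (simp add: contract_def grade_involution_def)

lemma contract_twice: "a \<in> alternating_multicovectors \<Longrightarrow> contract v (contract v a) = (\<lambda>vs. 0)"
  by (simp add: contract_def alternating_not_distinct)

lemma contract_swap: "a \<in> alternating_multicovectors \<Longrightarrow>
    contract v (contract w a) = (\<lambda>vs. - contract w (contract v a) vs)"
  unfolding contract_def by (intro ext alternating_swap_hd)

section \<open>The Leibniz rule and the algebra of the wedge product\<close>

lemma wedge_Nil: "(a \<and>\<^sub>w b) [] = a [] * b []"
  by (simp add: wedge_def shuffle_sign_def)

lemma Pow_lessThan_Suc:
  "Pow {..<Suc n} = (\<lambda>S. insert 0 (Suc ` S)) ` Pow {..<n} \<union> (`) Suc ` Pow {..<n}"
  unfolding lessThan_Suc_eq_insert_0 Pow_insert image_Pow_surj[OF refl, symmetric]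
  by (auto simp: image_image)

lemma shuffle_sign_insert_0:
  "shuffle_sign (Suc n) (insert 0 (Suc ` S)) = shuffle_sign n S"
proof -
  have "{(i, j). i \<in> insert 0 (Suc ` S) \<and> j \<in> {..<Suc n} - insert 0 (Suc ` S) \<and> j < i}
    = map_prod Suc Suc ` {(i, j). i \<in> S \<and> j \<in> {..<n} - S \<and> j < i}"
    by (auto simp: image_iff lessThan_Suc_eq_insert_0)
  then show ?thesis
    unfolding shuffle_sign_def by (simp add: card_image prod.inj_map inj_on_def)
qed

text \<open>The new position 0 lies outside the shifted set and in front of all its elements, so it
  adds one inversion for each of them.\<close>

lemma shuffle_sign_Suc_image:
  assumes "S \<subseteq> {..<n}"
  shows "shuffle_sign (Suc n) (Suc ` S) = (-1) ^ card S * shuffle_sign n S"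
proof -
  let ?A = "{(i, j). i \<in> S \<and> j \<in> {..<n} - S \<and> j < i}"
  have fin: "finite S" using assms finite_subset by blast
  have finA: "finite ?A"
    by (rule finite_subset[of _ "S \<times> {..<n}"]) (use fin in auto)
  have "{(i, j). i \<in> Suc ` S \<and> j \<in> {..<Suc n} - Suc ` S \<and> j < i}
    = map_prod Suc Suc ` ?A \<union> (\<lambda>i. (Suc i, 0)) ` S"
    by (auto simp: image_iff lessThan_Suc_eq_insert_0)
  moreover have "card (map_prod Suc Suc ` ?A \<union> (\<lambda>i. (Suc i, 0)) ` S) = card ?A + card S"
    using fin finA by (subst card_Un_disjoint) (auto simp: card_image inj_on_def)
  ultimately show ?thesis
    unfolding shuffle_sign_def by (simp add: power_add)
qed

lemma length_nths_subset: "S \<subseteq> {..<length vs} \<Longrightarrow> length (nths vs S) = card S"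
  by (simp add: length_nths) (metis (no_types, lifting) Collect_cong Collect_mem_eq lessThan_iff subsetD)

text \<open>Subsets containing position 0 hand \<open>v\<close> to \<open>a\<close>, the others hand
  it to \<open>b\<close>. In the second case \<open>a\<close> receives \<open>card S\<close>
  arguments, so the extra sign \<open>(-1) ^ card S\<close> is precisely its grade involution. From
  here on this rule mostly replaces the sum over subsets.\<close>

lemma wedge_Cons:
  "(a \<and>\<^sub>w b) (v # vs) = (contract v a \<and>\<^sub>w b) vs + (grade_involution a \<and>\<^sub>w contract v b) vs"
proof -
  let ?n = "length vs"
  let ?f = "\<lambda>S. shuffle_sign (Suc ?n) S * a (nths (v # vs) S) * b (nths (v # vs) (- S))"
  have inj: "inj_on (\<lambda>S. insert 0 (Suc ` S)) (Pow {..<?n})" "inj_on ((`) Suc) (Pow {..<?n})"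
    by (auto simp: inj_on_def)
  have sets: "{j. j = 0 \<or> j = 0} = {0::nat}" "{j. Suc j \<notin> Suc ` S} = - S"
    "{j. Suc j \<in> Suc ` S} = S" "{j. Suc j \<in> - Suc ` S} = - S" for S :: "nat set"
    by auto
  have "(a \<and>\<^sub>w b) (v # vs) = sum ?f ((\<lambda>S. insert 0 (Suc ` S)) ` Pow {..<?n})
      + sum ?f ((`) Suc ` Pow {..<?n})"
    unfolding wedge_def length_Cons Pow_lessThan_Suc by (intro sum.union_disjoint) auto
  also have "sum ?f ((\<lambda>S. insert 0 (Suc ` S)) ` Pow {..<?n}) = (contract v a \<and>\<^sub>w b) vs"
    by (subst sum.reindex[OF inj(1)])
      (simp add: wedge_def shuffle_sign_insert_0 nths_Cons contract_def sets o_def)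
  also have "sum ?f ((`) Suc ` Pow {..<?n}) = (grade_involution a \<and>\<^sub>w contract v b) vs"
    unfolding sum.reindex[OF inj(2)] wedge_def o_def
    by (intro sum.cong refl)
      (simp add: shuffle_sign_Suc_image nths_Cons contract_def grade_involution_def
        sets length_nths_subset)
  finally show ?thesis .
qed

lemma wedge_zero_left [simp]: "((\<lambda>vs. 0) \<and>\<^sub>w b) vs = 0"
  by (simp add: wedge_def)

lemma wedge_zero_right [simp]: "(a \<and>\<^sub>w (\<lambda>vs. 0)) vs = 0"
  by (simp add: wedge_def)

lemma wedge_add_left: "((\<lambda>vs. a vs + a' vs) \<and>\<^sub>w b) vs = (a \<and>\<^sub>w b) vs + (a' \<and>\<^sub>w b) vs"
  by (simp add: wedge_def algebra_simps sum.distrib)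

lemma wedge_add_right: "(a \<and>\<^sub>w (\<lambda>vs. b vs + b' vs)) vs = (a \<and>\<^sub>w b) vs + (a \<and>\<^sub>w b') vs"
  by (simp add: wedge_def algebra_simps sum.distrib)

lemma wedge_scale_left: "((\<lambda>vs. c * a vs) \<and>\<^sub>w b) vs = c * (a \<and>\<^sub>w b) vs"
  by (simp add: wedge_def sum_distrib_left mult.assoc mult.left_commute)

lemma wedge_scale_right: "(a \<and>\<^sub>w (\<lambda>vs. c * b vs)) vs = c * (a \<and>\<^sub>w b) vs"
  by (simp add: wedge_def sum_distrib_left mult.assoc mult.left_commute)

lemma wedge_minus_left: "((\<lambda>vs. - a vs) \<and>\<^sub>w b) vs = - (a \<and>\<^sub>w b) vs"
  using wedge_scale_left[of "-1"] by simp

lemma wedge_minus_right: "(a \<and>\<^sub>w (\<lambda>vs. - b vs)) vs = - (a \<and>\<^sub>w b) vs"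
  using wedge_scale_right[of _ "-1"] by simp

lemma wedge_sum_left: "((\<lambda>vs. \<Sum>i\<in>I. a i vs) \<and>\<^sub>w b) vs = (\<Sum>i\<in>I. (a i \<and>\<^sub>w b) vs)"
  by (induction I rule: infinite_finite_induct) (simp_all add: wedge_add_left)

lemma wedge_sum_right: "(a \<and>\<^sub>w (\<lambda>vs. \<Sum>i\<in>I. b i vs)) vs = (\<Sum>i\<in>I. (a \<and>\<^sub>w b i) vs)"
  by (induction I rule: infinite_finite_induct) (simp_all add: wedge_add_right)

lemma grade_involution_wedge:
  "grade_involution (a \<and>\<^sub>w b) = (grade_involution a \<and>\<^sub>w grade_involution b)"
proof
  fix vs
  show "grade_involution (a \<and>\<^sub>w b) vs = (grade_involution a \<and>\<^sub>w grade_involution b) vs"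
  proof (induction vs arbitrary: a b)
    case Nil
    then show ?case by (simp add: grade_involution_def wedge_Nil)
  next
    case (Cons v vs)
    have "grade_involution (a \<and>\<^sub>w b) (v # vs) =
       - grade_involution (contract v a \<and>\<^sub>w b) vs - grade_involution (grade_involution a \<and>\<^sub>w contract v b) vs"
      by (simp add: grade_involution_def wedge_Cons algebra_simps)
    then show ?case
      by (simp add: Cons.IH wedge_Cons contract_grade_involution wedge_minus_left wedge_minus_right)
  qed
qed

lemma contract_wedge: "contract v (a \<and>\<^sub>w b) =
    (\<lambda>vs. (contract v a \<and>\<^sub>w b) vs + (grade_involution a \<and>\<^sub>w contract v b) vs)"
  by (simp add: contract_def[of v "a \<and>\<^sub>w b"] wedge_Cons)

text \<open>By the Leibniz rule both sides obey the same recursion in the argument list, so no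
  shuffles have to be composed.\<close>

lemma wedge_assoc: "(a \<and>\<^sub>w b) \<and>\<^sub>w c = a \<and>\<^sub>w (b \<and>\<^sub>w c)"
proof
  fix vs
  show "((a \<and>\<^sub>w b) \<and>\<^sub>w c) vs = (a \<and>\<^sub>w (b \<and>\<^sub>w c)) vs"
  proof (induction vs arbitrary: a b c)
    case Nil
    then show ?case by (simp add: wedge_Nil)
  next
    case (Cons v vs)
    then show ?case
      by (simp add: wedge_Cons[of _ _ v] contract_wedge wedge_add_left wedge_add_right
          grade_involution_wedge)
  qed
qed

lemma wedge_alternating:
  fixes a b :: "'a::real_vector multicovector"
  assumes "a \<in> alternating_multicovectors" "b \<in> alternating_multicovectors"
  shows "a \<and>\<^sub>w b \<in> alternating_multicovectors"
proof (rule alternatingI)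
  show "linear (\<lambda>v. (a \<and>\<^sub>w b) (us @ v # vs))" for us vs
    using assms
  proof (induction us arbitrary: a b)
    case Nil
    have 1: "contract (v + w) c = (\<lambda>vs. contract v c vs + contract w c vs)"
      "contract (r *\<^sub>R v) c = (\<lambda>vs. of_real r * contract v c vs)"
      if "c \<in> alternating_multicovectors" for v w r and c :: "'a multicovector"
      using alternating_add[OF that, of "[]"] alternating_scaleR[OF that, of "[]"]
      by (auto simp: contract_def scaleR_conv_of_real)
    show ?case
      by (rule linearI)
        (simp_all add: wedge_Cons 1 Nil wedge_add_left wedge_add_right wedge_scale_left
          wedge_scale_right scaleR_conv_of_real algebra_simps)
  next
    case (Cons u us)
    then show ?case
      by (simp add: wedge_Cons linear_compose_add contract_alternating grade_involution_alternating)
  qed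
  show "(a \<and>\<^sub>w b) (us @ v # v # vs) = 0" for us v vs
    using assms
  proof (induction us arbitrary: a b)
    case Nil
    \<comment> \<open>The two mixed terms, in which one \<open>v\<close> goes to each factor, cancel
      because contraction anticommutes with the grade involution.\<close>
    then show ?case
      by (simp add: wedge_Cons contract_twice contract_grade_involution wedge_minus_left)
  next
    case (Cons u us)
    then show ?case
      by (simp add: wedge_Cons contract_alternating grade_involution_alternating)
  qed
qed

section \<open>Covectors of degree one and wedge monomials\<close>

lemma unit_covector_alternating: "unit_covector \<in> alternating_multicovectors"
  by (auto simp: alternating_multicovectors_def unit_covector_def linear_zero)

lemma covector1_alternating:
  assumes "linear \<theta>"
  shows "covector1 \<theta> \<in> alternating_multicovectors"
proof -
  have "(\<lambda>v. covector1 \<theta> (us @ v # vs)) = (if us = [] \<and> vs = [] then \<theta> else (\<lambda>v. 0))" for us vs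
    by (auto simp: covector1_def fun_eq_iff split: list.split)
      (auto simp: append_eq_Cons_conv)
  moreover have "covector1 \<theta> vs = 0" if "\<not> distinct vs" for vs
    using that by (auto simp: covector1_def split: list.split)
  ultimately show ?thesis
    using assms by (auto simp: alternating_multicovectors_def linear_zero)
qed

lemma contract_covector1: "contract v (covector1 \<theta>) = (\<lambda>vs. \<theta> v * unit_covector vs)"
  by (auto simp: contract_def covector1_def unit_covector_def fun_eq_iff split: list.split)

lemma grade_involution_covector1: "grade_involution (covector1 \<theta>) = (\<lambda>vs. - covector1 \<theta> vs)"
  by (auto simp: grade_involution_def covector1_def fun_eq_iff split: list.split)

lemma contract_unit_covector: "contract v unit_covector = (\<lambda>vs. 0)"
  by (auto simp: contract_def unit_covector_def)

lemma grade_involution_unit_covector: "grade_involution unit_covector = unit_covector"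
  by (auto simp: grade_involution_def unit_covector_def)

lemma unit_wedge: "unit_covector \<and>\<^sub>w b = b"
proof
  fix vs
  show "(unit_covector \<and>\<^sub>w b) vs = b vs"
    by (induction vs arbitrary: b)
      (simp_all add: wedge_Nil wedge_Cons contract_unit_covector grade_involution_unit_covector,
        simp_all add: unit_covector_def contract_def)
qed

lemma covector1_wedge_Nil: "(covector1 \<theta> \<and>\<^sub>w b) [] = 0"
  by (simp add: wedge_Nil covector1_def)

lemma covector1_wedge_Cons:
  "(covector1 \<theta> \<and>\<^sub>w b) (v # vs) = \<theta> v * b vs - (covector1 \<theta> \<and>\<^sub>w contract v b) vs"
  by (simp add: wedge_Cons contract_covector1 grade_involution_covector1 wedge_scale_left
      wedge_minus_left unit_wedge)

lemma contract_covector1_wedge: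
  "contract v (covector1 \<theta> \<and>\<^sub>w b) = (\<lambda>vs. \<theta> v * b vs - (covector1 \<theta> \<and>\<^sub>w contract v b) vs)"
  by (simp add: contract_def[of v "covector1 \<theta> \<and>\<^sub>w b"] covector1_wedge_Cons)

lemma wedge_diff_right: "(a \<and>\<^sub>w (\<lambda>vs. b vs - b' vs)) vs = (a \<and>\<^sub>w b) vs - (a \<and>\<^sub>w b') vs"
  using wedge_add_right[of a b "\<lambda>vs. - b' vs"] by (simp add: wedge_minus_right)

lemma covector1_wedge_anticommute:
  "(covector1 \<theta> \<and>\<^sub>w covector1 \<eta> \<and>\<^sub>w b) vs = - (covector1 \<eta> \<and>\<^sub>w covector1 \<theta> \<and>\<^sub>w b) vs"
proof (induction vs arbitrary: b)
  case (Cons v vs)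
  have "(covector1 \<theta> \<and>\<^sub>w covector1 \<eta> \<and>\<^sub>w contract v b) vs =
      - (covector1 \<eta> \<and>\<^sub>w covector1 \<theta> \<and>\<^sub>w contract v b) vs"
    by (rule Cons.IH)
  then show ?case
    by (simp add: covector1_wedge_Cons[of _ _ v] contract_covector1_wedge wedge_diff_right
        wedge_scale_right)
qed (simp add: covector1_wedge_Nil)

lemma covector1_wedge_twice: "(covector1 \<theta> \<and>\<^sub>w covector1 \<theta> \<and>\<^sub>w b) vs = 0"
  using covector1_wedge_anticommute[of \<theta> \<theta> b vs] by simp

lemma wedge_list_Nil [simp]: "wedge_list [] = unit_covector"
  by (simp add: wedge_list_def)

lemma wedge_list_Cons [simp]: "wedge_list (\<theta> # \<theta>s) = covector1 \<theta> \<and>\<^sub>w wedge_list \<theta>s"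
  by (simp add: wedge_list_def)

lemma wedge_list_alternating:
  "(\<And>\<theta>. \<theta> \<in> set \<theta>s \<Longrightarrow> linear \<theta>) \<Longrightarrow> wedge_list \<theta>s \<in> alternating_multicovectors"
  by (induction \<theta>s) (simp_all add: unit_covector_alternating covector1_alternating wedge_alternating)

lemma covector1_wedge_wedge_list:
  "\<theta> \<in> set \<theta>s \<Longrightarrow> (covector1 \<theta> \<and>\<^sub>w wedge_list \<theta>s) vs = 0"
proof (induction \<theta>s arbitrary: vs)
  case (Cons \<eta> \<theta>s)
  have *: "(covector1 \<theta> \<and>\<^sub>w wedge_list \<theta>s) = (\<lambda>vs. 0)" if "\<theta> \<noteq> \<eta>"
    using that Cons by auto
  show ?case
  proof (cases "\<theta> = \<eta>")
    case True
    then show ?thesis by (simp add: covector1_wedge_twice)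
  next
    case False
    then show ?thesis
      by (simp add: covector1_wedge_anticommute[of \<theta> \<eta>] *)
  qed
qed simp

lemma covector1_wedge_eq_0:
  "(\<And>v. v \<in> set vs \<Longrightarrow> \<theta> v = 0) \<Longrightarrow> (covector1 \<theta> \<and>\<^sub>w b) vs = 0"
  by (induction vs arbitrary: b) (simp_all add: covector1_wedge_Nil covector1_wedge_Cons)

lemma contract_wedge_list_eq_0:
  "(\<And>\<theta>. \<theta> \<in> set \<theta>s \<Longrightarrow> \<theta> v = 0) \<Longrightarrow> contract v (wedge_list \<theta>s) = (\<lambda>vs. 0)"
proof (induction \<theta>s)
  case (Cons \<eta> \<theta>s)
  then have "contract v (wedge_list \<theta>s) = (\<lambda>vs. 0)" "\<eta> v = 0"
    by simp_all
  then show ?case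
    by (simp add: contract_covector1_wedge)
qed (simp add: contract_unit_covector)

lemma wedge_list_eq_0_if_length:
  "length vs \<noteq> length \<theta>s \<Longrightarrow> wedge_list \<theta>s vs = 0"
proof (induction \<theta>s arbitrary: vs)
  case Nil
  then show ?case by (simp add: unit_covector_def)
next
  case (Cons \<theta> \<theta>s)
  have "(covector1 \<theta> \<and>\<^sub>w b) vs = 0"
    if "\<And>us. length us \<noteq> n \<Longrightarrow> b us = 0" "length vs \<noteq> Suc n" for n b
    using that
  proof (induction vs arbitrary: b n)
    case (Cons v vs)
    show ?case
    proof (cases n)
      case 0
      then have "contract v b = (\<lambda>vs. 0)" using Cons.prems by (auto simp: contract_def)
      then show ?thesis using Cons.prems 0 by (simp add: covector1_wedge_Cons)
    next
      case (Suc m)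
      then have "(covector1 \<theta> \<and>\<^sub>w contract v b) vs = 0"
        using Cons.prems by (intro Cons.IH[of m]) (auto simp: contract_def)
      then show ?thesis using Cons.prems by (simp add: covector1_wedge_Cons)
    qed
  qed (simp add: covector1_wedge_Nil)
  from this[of "length \<theta>s" "wedge_list \<theta>s"] show ?case
    using Cons by simp
qed

section \<open>Alternating covectors and sublists of a basis\<close>

text \<open>Induction on the spanning list: multilinearity splits each argument into a multiple of
  \<open>e\<close> and a vector in the span of the rest, and an \<open>e\<close> can be moved to the
  front, where it becomes a contraction.\<close>

lemma alternating_eq_0_span:
  assumes "a \<in> alternating_multicovectors" "\<And>S. S \<subseteq> {..<length E} \<Longrightarrow> a (nths E S) = 0"
    "set vs \<subseteq> span (set E)"
  shows "a vs = 0"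
  using assms
proof (induction E arbitrary: a vs)
  case Nil
  show ?case
  proof (cases vs)
    case Nil
    then show ?thesis using Nil.prems(2)[of "{}"] by simp
  next
    case (Cons v vs')
    then have "v = 0" using Nil.prems(3) by simp
    then show ?thesis
      using alternating_scaleR[OF Nil.prems(1), of "[]" 0 0 vs'] Cons by simp
  qed
next
  case (Cons e E)
  note alt = Cons.prems(1)
  have sets: "{j. Suc j \<in> Suc ` S} = S" for S by auto
  have i: "a vs = 0" if "set vs \<subseteq> span (set E)" for vs
  proof (rule Cons.IH[OF alt _ that])
    fix S assume "S \<subseteq> {..<length E}"
    then have "a (nths (e # E) (Suc ` S)) = 0"
      by (intro Cons.prems(2)) auto
    then show "a (nths E S) = 0" by (simp add: nths_Cons sets)
  qed
  have ii: "contract e a vs = 0" if "set vs \<subseteq> span (set E)" for vs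
  proof (rule Cons.IH[OF contract_alternating[OF alt] _ that])
    fix S assume "S \<subseteq> {..<length E}"
    then have "a (nths (e # E) (insert 0 (Suc ` S))) = 0"
      by (intro Cons.prems(2)) auto
    then show "contract e a (nths E S) = 0" by (simp add: nths_Cons sets contract_def)
  qed
  \<comment> \<open>The entries \<open>us\<close> are already reduced to the span of
    \<open>E\<close>, while \<open>vs\<close> is still pending. Two claims are carried because an
    \<open>e\<close> split off from a pending entry moves to the front; once it stands there, a
    second \<open>e\<close> makes the value vanish.\<close>
  have "a (us @ vs) = 0 \<and> a (e # us @ vs) = 0"
    if "set us \<subseteq> span (set E)" "set vs \<subseteq> span (insert e (set E))" for us vs
    using that
  proof (induction vs arbitrary: us)
    case Nil
    then show ?case using i ii[unfolded contract_def] by simp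
  next
    case (Cons v vs)
    obtain t where t: "v - t *\<^sub>R e \<in> span (set E)"
      using Cons.prems(2) by (auto simp: span_breakdown_eq)
    define v' where "v' = v - t *\<^sub>R e"
    have v: "v = v' + t *\<^sub>R e" by (simp add: v'_def)
    have 1: "a ((us @ [v']) @ vs) = 0" "a (e # (us @ [v']) @ vs) = 0"
      using Cons.IH[of "us @ [v']"] Cons.prems t by (auto simp: v'_def)
    have 2: "a (us @ e # vs) = 0"
      using alternating_move[OF alt, of us e vs] Cons.IH[of us] Cons.prems by simp
    have 3: "a ((e # us) @ e # vs) = 0"
      by (rule alternating_not_distinct[OF alt]) simp
    have "a (us @ v # vs) = 0"
      unfolding v alternating_add[OF alt] alternating_scaleR[OF alt] using 1 2 by simp
    moreover have "a ((e # us) @ v # vs) = 0"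
      unfolding v alternating_add[OF alt] alternating_scaleR[OF alt] using 1 3 by simp
    ultimately show ?case by simp
  qed
  from this[of "[]" vs] show ?case using Cons.prems(3) by simp
qed

lemma alternating_eqI:
  assumes "a \<in> alternating_multicovectors" "b \<in> alternating_multicovectors"
    and "span (set E) = UNIV"
    and eq: "\<And>S. S \<subseteq> {..<length E} \<Longrightarrow> a (nths E S) = b (nths E S)"
  shows "a = b"
proof
  fix vs
  have "(\<lambda>vs. a vs + (-1) * b vs) vs = 0"
  proof (rule alternating_eq_0_span)
    show "(\<lambda>vs. a vs + (-1) * b vs) \<in> alternating_multicovectors"
      by (rule add_alternating[OF assms(1) scale_alternating[OF assms(2)]])
    show "a (nths E S) + (-1) * b (nths E S) = 0" if "S \<subseteq> {..<length E}" for S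
      using eq[OF that] by simp
    show "set vs \<subseteq> span (set E)" using assms(3) by simp
  qed
  then show "a vs = b vs" by simp
qed

text \<open>The first covector kills all later basis vectors and the first basis vector is killed by
  all later covectors, so index 0 has to lie in both sets or in neither.\<close>

lemma wedge_list_dual:
  assumes "length E = length \<theta>s"
    and "\<And>i j. i < length E \<Longrightarrow> j < length E \<Longrightarrow> (\<theta>s ! i) (E ! j) = (if i = j then 1 else 0)"
    and "S \<subseteq> {..<length E}" "T \<subseteq> {..<length E}"
  shows "wedge_list (nths \<theta>s S) (nths E T) = (if S = T then 1 else 0)"
  using assms
proof (induction E \<theta>s arbitrary: S T rule: list_induct2)
  case Nil
  then show ?case by (simp add: unit_covector_def)
next
  case (Cons e E \<theta> \<theta>s)
  define S' T' where "S' = {j. Suc j \<in> S}" and "T' = {j. Suc j \<in> T}"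
  have IH: "wedge_list (nths \<theta>s S') (nths E T') = (if S' = T' then 1 else 0)"
  proof (rule Cons.IH)
    show "(\<theta>s ! i) (E ! j) = (if i = j then 1 else 0)" if "i < length E" "j < length E" for i j
      using Cons.prems(1)[of "Suc i" "Suc j"] that by simp
  qed (use Cons.prems in \<open>auto simp: S'_def T'_def\<close>)
  have ST: "S = T \<longleftrightarrow> (0 \<in> S \<longleftrightarrow> 0 \<in> T) \<and> S' = T'"
  proof
    assume eq: "(0 \<in> S \<longleftrightarrow> 0 \<in> T) \<and> S' = T'"
    have "j \<in> S \<longleftrightarrow> j \<in> T" for j
      using eq by (cases j) (auto simp: S'_def T'_def set_eq_iff)
    then show "S = T" by blast
  qed (simp add: S'_def T'_def)
  have e: "\<theta> e = 1" using Cons.prems(1)[of 0 0] by simp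
  have kill1: "\<theta> v = 0" if v: "v \<in> set (nths E T')" for v
  proof -
    obtain j where "j < length E" "v = E ! j" using v by (auto simp: set_nths)
    then show ?thesis using Cons.prems(1)[of 0 "Suc j"] by simp
  qed
  have kill2: "\<eta> e = 0" if \<eta>: "\<eta> \<in> set (nths \<theta>s S')" for \<eta>
  proof -
    obtain j where "j < length \<theta>s" "\<eta> = \<theta>s ! j" using \<eta> by (auto simp: set_nths)
    then show ?thesis using Cons.prems(1)[of "Suc j" 0] Cons.hyps by simp
  qed
  have z: "contract e (wedge_list (nths \<theta>s S')) = (\<lambda>vs. 0)"
    using kill2 by (rule contract_wedge_list_eq_0)
  have z': "wedge_list (nths \<theta>s S') (e # vs) = 0" for vs
    using fun_cong[OF z] by (simp add: contract_def)
  have nths: "nths (\<theta> # \<theta>s) S = (if 0 \<in> S then [\<theta>] else []) @ nths \<theta>s S'"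
    "nths (e # E) T = (if 0 \<in> T then [e] else []) @ nths E T'"
    by (simp_all add: nths_Cons S'_def T'_def)
  show ?case
    using IH z' by (auto simp: nths ST covector1_wedge_Cons e z covector1_wedge_eq_0[OF kill1])
qed

lemma dual_covectors_exist:
  fixes E :: "'a::euclidean_space list"
  assumes "distinct E" "independent (set E)"
  obtains \<theta>s :: "('a \<Rightarrow> complex) list" where "length \<theta>s = length E" "\<And>\<theta>. \<theta> \<in> set \<theta>s \<Longrightarrow> linear \<theta>"
    "\<And>i j. i < length E \<Longrightarrow> j < length E \<Longrightarrow> (\<theta>s ! i) (E ! j) = (if i = j then 1 else 0)"
proof -
  have "\<exists>\<theta>::'a \<Rightarrow> complex. linear \<theta> \<and> (\<forall>e\<in>set E. \<theta> e = (if e = e' then 1 else 0))" for e'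
    by (rule linear_independent_extend[OF assms(2)])
  then obtain \<theta> :: "'a \<Rightarrow> 'a \<Rightarrow> complex" where \<theta>: "\<And>e'. linear (\<theta> e')"
    "\<And>e e'. e \<in> set E \<Longrightarrow> \<theta> e' e = (if e = e' then 1 else 0)" by metis
  show thesis
    by (rule that[of "map \<theta> E"])
      (use \<theta> assms(1) in \<open>auto simp: nth_eq_iff_index_eq\<close>)
qed

text \<open>Combine the monomials in the dual covectors with the prescribed values as coefficients.
  This constructs the Hodge star as well as the test covectors against which it is measured.\<close>

lemma alternating_extend:
  fixes E :: "'a::euclidean_space list" and f :: "nat set \<Rightarrow> complex"
  assumes "distinct E" "independent (set E)"
  obtains c where "c \<in> alternating_multicovectors"
    "\<And>S. S \<subseteq> {..<length E} \<Longrightarrow> c (nths E S) = f S"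
proof -
  obtain \<theta>s :: "('a \<Rightarrow> complex) list" where \<theta>s: "length E = length \<theta>s"
    "\<And>\<theta>. \<theta> \<in> set \<theta>s \<Longrightarrow> linear \<theta>"
    "\<And>i j. i < length E \<Longrightarrow> j < length E \<Longrightarrow> (\<theta>s ! i) (E ! j) = (if i = j then 1 else 0)"
    using dual_covectors_exist[OF assms] by metis
  define c where "c = (\<lambda>vs. \<Sum>S\<in>Pow {..<length E}. f S * wedge_list (nths \<theta>s S) vs)"
  show thesis
  proof
    show "c \<in> alternating_multicovectors"
      unfolding c_def
      by (intro sum_alternating scale_alternating wedge_list_alternating)
        (auto dest: in_set_nthsD \<theta>s(2))
    show "c (nths E T) = f T" if "T \<subseteq> {..<length E}" for T
    proof -
      have "c (nths E T) = (\<Sum>S\<in>Pow {..<length E}. if S = T then f S else 0)"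
        unfolding c_def using that
        by (intro sum.cong refl) (simp add: wedge_list_dual[OF \<theta>s(1,3)])
      then show ?thesis using that by (simp add: sum.delta)
    qed
  qed
qed

section \<open>Smooth functions and Hermitian structures\<close>

lemma differentiable_times_Suc_imp: "differentiable_times (Suc k) f \<Longrightarrow> differentiable_times k f"
proof (induction k arbitrary: f)
  case 0
  then show ?case
    by (auto intro!: continuous_at_imp_continuous_on differentiable_imp_continuous_within)
next
  case (Suc k)
  then show ?case
    by (metis differentiable_times.simps(2))
qed

lemma frechet_derivativeI: "(f has_derivative f') (at x) \<Longrightarrow> frechet_derivative f (at x) = f'"
  using frechet_derivative_at by metis

lemma has_frechet_derivative:
  "f differentiable (at x) \<Longrightarrow> (f has_derivative frechet_derivative f (at x)) (at x)"
  by (simp add: frechet_derivative_works)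

lemma differentiable_times_SucI:
  assumes "\<And>x. (f has_derivative f' x) (at x)" "\<And>v. differentiable_times k (\<lambda>x. f' x v)"
  shows "differentiable_times (Suc k) f"
  using assms by (auto simp: frechet_derivativeI[OF assms(1)] differentiable_def)

lemma smooth_differentiable: "smooth f \<Longrightarrow> f differentiable (at x)"
  unfolding smooth_def by (metis differentiable_times.simps(2))

lemma smooth_has_derivative:
  "smooth f \<Longrightarrow> (f has_derivative frechet_derivative f (at x)) (at x)"
  by (intro has_frechet_derivative smooth_differentiable)

lemma smooth_frechet_derivative: "smooth f \<Longrightarrow> smooth (\<lambda>x. frechet_derivative f (at x) v)"
  unfolding smooth_def by (metis differentiable_times.simps(2))

lemma smooth_continuous: "smooth f \<Longrightarrow> continuous_on UNIV f"
  unfolding smooth_def by (metis differentiable_times.simps(1))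

lemma differentiable_times_const: "differentiable_times k (\<lambda>x. c)"
proof (induction k arbitrary: c)
  case (Suc k)
  show ?case
    by (rule differentiable_times_SucI[OF has_derivative_const]) (rule Suc)
qed simp

lemma smooth_const: "smooth (\<lambda>x. c)"
  by (simp add: smooth_def differentiable_times_const)

lemma differentiable_times_bounded_linear:
  assumes "bounded_linear h"
  shows "differentiable_times k f \<Longrightarrow> differentiable_times k (\<lambda>x. h (f x))"
proof (induction k arbitrary: f)
  case 0
  then show ?case
    using bounded_linear.continuous_on[OF assms] by auto
next
  case (Suc k)
  show ?case
  proof (rule differentiable_times_SucI)
    show "((\<lambda>x. h (f x)) has_derivative (\<lambda>v. h (frechet_derivative f (at x) v))) (at x)" for x
      using Suc.prems
      by (auto intro!: bounded_linear.has_derivative[OF assms] has_frechet_derivative)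
  qed (use Suc in auto)
qed

lemma smooth_bounded_linear: "bounded_linear h \<Longrightarrow> smooth f \<Longrightarrow> smooth (\<lambda>x. h (f x))"
  by (simp add: smooth_def differentiable_times_bounded_linear)

lemma differentiable_times_add:
  "differentiable_times k f \<Longrightarrow> differentiable_times k g \<Longrightarrow> differentiable_times k (\<lambda>x. f x + g x)"
proof (induction k arbitrary: f g)
  case 0
  then show ?case by (auto intro: continuous_on_add)
next
  case (Suc k)
  show ?case
  proof (rule differentiable_times_SucI)
    show "((\<lambda>x. f x + g x) has_derivative
        (\<lambda>v. frechet_derivative f (at x) v + frechet_derivative g (at x) v)) (at x)" for x
      using Suc.prems by (auto intro!: has_derivative_add has_frechet_derivative)
  qed (use Suc in auto)
qed

lemma smooth_add: "smooth f \<Longrightarrow> smooth g \<Longrightarrow> smooth (\<lambda>x. f x + g x)"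
  by (simp add: smooth_def differentiable_times_add)

lemma smooth_sum: "(\<And>i. i \<in> I \<Longrightarrow> smooth (f i)) \<Longrightarrow> smooth (\<lambda>x. \<Sum>i\<in>I. f i x)"
  by (induction I rule: infinite_finite_induct) (simp_all add: smooth_const smooth_add)

lemma differentiable_times_bilinear:
  assumes "bounded_bilinear h"
  shows "differentiable_times k f \<Longrightarrow> differentiable_times k g \<Longrightarrow>
    differentiable_times k (\<lambda>x. h (f x) (g x))"
proof (induction k arbitrary: f g)
  case 0
  then show ?case
    by (auto intro: bounded_bilinear.continuous_on[OF assms])
next
  case (Suc k)
  have 1: "differentiable_times k f" "differentiable_times k g"
    using Suc.prems by (auto intro: differentiable_times_Suc_imp)
  show ?case
  proof (rule differentiable_times_SucI)
    show "((\<lambda>x. h (f x) (g x)) has_derivative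
        (\<lambda>v. h (f x) (frechet_derivative g (at x) v) + h (frechet_derivative f (at x) v) (g x))) (at x)" for x
      using Suc.prems by (auto intro!: bounded_bilinear.FDERIV[OF assms] has_frechet_derivative)
  qed (use Suc 1 in \<open>auto intro!: differentiable_times_add\<close>)
qed

lemma smooth_bilinear:
  "bounded_bilinear h \<Longrightarrow> smooth f \<Longrightarrow> smooth g \<Longrightarrow> smooth (\<lambda>x. h (f x) (g x))"
  by (simp add: smooth_def differentiable_times_bilinear)

lemmas smooth_mult = smooth_bilinear[OF bounded_bilinear_mult]
lemmas smooth_scaleR = smooth_bilinear[OF bounded_bilinear_scaleR]
lemmas smooth_inner = smooth_bilinear[OF bounded_bilinear_inner]

lemma smooth_minus: "smooth f \<Longrightarrow> smooth (\<lambda>x. - f x)"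
  by (rule smooth_bounded_linear[OF bounded_linear_minus[OF bounded_linear_ident]])

lemma smooth_diff: "smooth f \<Longrightarrow> smooth g \<Longrightarrow> smooth (\<lambda>x. f x - g x)"
  using smooth_add[OF _ smooth_minus] by fastforce

text \<open>Serves the normalization of vectors by an inverse square root. The exponent has to vary
  in the induction, since each derivative lowers it by one.\<close>

lemma differentiable_times_powr:
  fixes f :: "'a::real_normed_vector \<Rightarrow> real"
  assumes "\<And>x. f x > 0"
  shows "differentiable_times k f \<Longrightarrow> differentiable_times k (\<lambda>x. f x powr r)"
proof (induction k arbitrary: r)
  case 0
  then show ?case
    using assms by (auto intro!: continuous_intros simp: less_imp_neq[symmetric])
next
  case (Suc k)
  have 1: "differentiable_times k f"
    using Suc.prems by (rule differentiable_times_Suc_imp)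
  show ?case
  proof (rule differentiable_times_SucI)
    show "((\<lambda>x. f x powr r) has_derivative
        (\<lambda>v. f x powr (r - 1) * (r * frechet_derivative f (at x) v))) (at x)" for x
    proof -
      have "(f has_derivative frechet_derivative f (at x)) (at x)"
        using Suc.prems by (auto intro!: has_frechet_derivative)
      then have "((\<lambda>x. f x powr r) has_derivative
        (\<lambda>v. f x powr r * (0 * ln (f x) + frechet_derivative f (at x) v * r / f x))) (at x)"
        using assms by (intro has_derivative_powr) auto
      then show ?thesis
        using assms[of x] by (simp add: powr_diff field_simps)
    qed
    show "differentiable_times k (\<lambda>x. f x powr (r - 1) * (r * frechet_derivative f (at x) v))" for v
      using Suc 1
      by (intro differentiable_times_bilinear[OF bounded_bilinear_mult] differentiable_times_const) auto
  qed
qed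

lemma smooth_powr:
  fixes f :: "'a::real_normed_vector \<Rightarrow> real"
  shows "(\<And>x. f x > 0) \<Longrightarrow> smooth f \<Longrightarrow> smooth (\<lambda>x. f x powr r)"
  by (simp add: smooth_def differentiable_times_powr)

lemma smooth_exp_linear:
  fixes h :: "'a::real_normed_vector \<Rightarrow> complex"
  assumes "bounded_linear h"
  shows "smooth (\<lambda>x. exp (h x))"
proof -
  \<comment> \<open>The factor \<open>c\<close> keeps the shape stable under differentiation: the
    derivative along \<open>v\<close> only turns \<open>c\<close> into
    \<open>h v * c\<close>.\<close>
  have "differentiable_times k (\<lambda>x. exp (h x) * c)" for k c
  proof (induction k arbitrary: c)
    case 0
    then show ?case by (auto intro!: continuous_intros bounded_linear.continuous_on[OF assms])
  next
    case (Suc k)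
    show ?case
    proof (rule differentiable_times_SucI)
      show "((\<lambda>x. exp (h x) * c) has_derivative (\<lambda>v. exp (h x) * (h v * c))) (at x)" for x
      proof -
        have "((\<lambda>x. exp (h x)) has_derivative (\<lambda>v. exp (h x) * h v)) (at x)"
          using DERIV_exp[of "h x"] unfolding has_field_derivative_def
          by (rule has_derivative_compose[OF bounded_linear_imp_has_derivative[OF assms]])
        from has_derivative_mult_left[OF this, of c] show ?thesis
          by (simp add: mult.assoc)
      qed
    qed (rule Suc)
  qed
  from this[where c = 1] show ?thesis by (simp add: smooth_def)
qed

lemma frechet_derivative_sum:
  "(\<And>i. i \<in> I \<Longrightarrow> f i differentiable (at x)) \<Longrightarrow>
    frechet_derivative (\<lambda>x. \<Sum>i\<in>I. f i x) (at x) = (\<lambda>v. \<Sum>i\<in>I. frechet_derivative (f i) (at x) v)"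
  by (intro frechet_derivativeI has_derivative_sum has_frechet_derivative)

lemma smooth_linear_frechet_derivative: "smooth f \<Longrightarrow> linear (frechet_derivative f (at x))"
  by (intro linear_frechet_derivative smooth_differentiable)

section \<open>Hermitian metrics and smooth orthonormal frames\<close>

lemma eq_span_insert_scale:
  fixes b :: "'a::real_vector"
  assumes "t \<noteq> 0" "s \<in> span S"
  shows "span (insert (t *\<^sub>R (b - s)) S) = span (insert b S)"
proof (rule span_eq[THEN iffD2], intro conjI)
  have "s \<in> span (insert b S)" using assms(2) span_mono[of S "insert b S"] by auto
  then have "t *\<^sub>R (b - s) \<in> span (insert b S)"
    by (intro span_mul span_diff) (auto intro: span_base)
  then show "insert (t *\<^sub>R (b - s)) S \<subseteq> span (insert b S)"
    by (auto intro: span_base)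
  let ?T = "insert (t *\<^sub>R (b - s)) S"
  have "s \<in> span ?T" using assms(2) span_mono[of S ?T] by auto
  moreover have "(1 / t) *\<^sub>R (t *\<^sub>R (b - s)) \<in> span ?T"
    by (intro span_mul span_base) auto
  ultimately have "(1 / t) *\<^sub>R (t *\<^sub>R (b - s)) + s \<in> span ?T" by (intro span_add)
  then have "b \<in> span ?T" using assms(1) by simp
  then show "insert b S \<subseteq> span ?T" by (auto intro: span_base)
qed

text \<open>Invariance under deck transformations is left out: volume form, star and arguments about
  type only involve a smoothly varying, \<open>J\<close>-compatible metric on the cover.\<close>

locale hermitian_structure =
  fixes J :: "'a::euclidean_space \<Rightarrow> 'a" and g :: "'a metric"
  assumes linear_J: "linear J" and J_J: "J (J v) = - v"
    and metric_linear: "linear (g x u)"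
    and metric_sym: "g x u v = g x v u"
    and metric_pos: "u \<noteq> 0 \<Longrightarrow> g x u u > 0"
    and metric_J: "g x (J u) (J v) = g x u v"
    and metric_smooth: "smooth (\<lambda>x. g x u v)"
begin

lemma metric_linear_left: "linear (\<lambda>u. g x u v)"
  using metric_linear[of x v] metric_sym[of x _ v] by simp

lemmas metric_right = linear_add[OF metric_linear] linear_diff[OF metric_linear]
  linear_scale[OF metric_linear] linear_sum[OF metric_linear] linear_0[OF metric_linear]
  linear_neg[OF metric_linear]

lemmas metric_left = linear_add[OF metric_linear_left] linear_diff[OF metric_linear_left]
  linear_scale[OF metric_linear_left] linear_sum[OF metric_linear_left]
  linear_0[OF metric_linear_left] linear_neg[OF metric_linear_left]

lemma metric_skew_J: "g x (J u) v = - g x u (J v)"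
  using metric_J[of x "J u" v] by (simp add: J_J metric_left)

lemma metric_J_self: "g x (J u) u = 0" "g x u (J u) = 0"
  using metric_skew_J[of x u u] metric_sym[of x u "J u"] by simp_all

text \<open>Expansion in the standard basis reduces moving arguments to the constant vectors for
  which smoothness is assumed.\<close>

lemma smooth_metric:
  assumes "smooth u" "smooth v"
  shows "smooth (\<lambda>x. g x (u x) (v x))"
proof -
  have "g x (u x) (v x) = (\<Sum>b\<in>Basis. (u x \<bullet> b) * (\<Sum>c\<in>Basis. (v x \<bullet> c) * g x b c))" for x
  proof -
    have "g x (u x) (v x) = g x (\<Sum>b\<in>Basis. (u x \<bullet> b) *\<^sub>R b) (v x)"
      by (simp add: euclidean_representation)
    also have "\<dots> = (\<Sum>b\<in>Basis. (u x \<bullet> b) * g x b (\<Sum>c\<in>Basis. (v x \<bullet> c) *\<^sub>R c))"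
      unfolding metric_left(4) metric_left(3) by (simp add: euclidean_representation)
    also have "\<dots> = (\<Sum>b\<in>Basis. (u x \<bullet> b) * (\<Sum>c\<in>Basis. (v x \<bullet> c) * g x b c))"
      by (simp only: metric_right(4) metric_right(3) real_scaleR_def)
    finally show ?thesis .
  qed
  then show ?thesis
    by (simp only:) (intro smooth_sum smooth_mult smooth_inner assms smooth_const metric_smooth)
qed

text \<open>Gram-Schmidt at every point at once, starting from constant fields. The span is part of
  the claim because it shows that the next vector, minus its projection, vanishes nowhere, which
  makes its normalization smooth.\<close>

lemma smooth_orthonormal_fields:
  assumes "distinct bs" "independent (set bs)"
  shows "\<exists>F. length F = length bs \<and> (\<forall>f\<in>set F. smooth f) \<and>
    (\<forall>x. (\<forall>i<length F. \<forall>j<length F. g x ((F ! i) x) ((F ! j) x) = (if i = j then 1 else 0)) \<and>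
      span ((\<lambda>f. f x) ` set F) = span (set bs))"
  using assms
proof (induction bs)
  case (Cons b bs)
  then obtain F where F: "length F = length bs" "\<And>f. f \<in> set F \<Longrightarrow> smooth f"
    "\<And>x i j. i < length F \<Longrightarrow> j < length F \<Longrightarrow> g x ((F ! i) x) ((F ! j) x) = (if i = j then 1 else 0)"
    "\<And>x. span ((\<lambda>f. f x) ` set F) = span (set bs)"
    by (auto simp: independent_insert)
  define s where "s = (\<lambda>x. \<Sum>i<length F. g x b ((F ! i) x) *\<^sub>R (F ! i) x)"
  define u where "u = (\<lambda>x. b - s x)"
  \<comment> \<open>The inverse norm of \<open>u x\<close>, written as a power so that
    \<open>smooth_powr\<close> applies.\<close>
  define t where "t = (\<lambda>x. g x (u x) (u x) powr (-1/2))"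
  define f where "f = (\<lambda>x. t x *\<^sub>R u x)"
  have s_span: "s x \<in> span ((\<lambda>f. f x) ` set F)" for x
    unfolding s_def by (intro span_sum span_mul span_base) auto
  have "b \<notin> span (set bs)"
    using Cons.prems by (auto simp: independent_insert)
  then have "u x \<noteq> 0" for x
    using s_span[of x] F(4)[of x] by (auto simp: u_def)
  then have pos: "g x (u x) (u x) > 0" for x by (rule metric_pos)
  then have tpos: "t x > 0" for x by (simp add: t_def less_imp_neq[symmetric])
  have tt: "t x * t x * g x (u x) (u x) = 1" for x
  proof -
    have "t x * t x = g x (u x) (u x) powr (-1)"
      unfolding t_def by (simp flip: powr_add)
    then show ?thesis using pos[of x] by (simp add: powr_minus)
  qed
  have smooth_s: "smooth s"
    unfolding s_def using F(2)
    by (intro smooth_sum smooth_scaleR smooth_metric smooth_const) auto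
  have smooth_u: "smooth u"
    unfolding u_def by (intro smooth_diff smooth_const smooth_s)
  have smooth_f: "smooth f"
    unfolding f_def t_def by (intro smooth_scaleR smooth_powr smooth_metric smooth_u pos)
  have orth: "g x (u x) ((F ! j) x) = 0" if "j < length F" for x j
  proof -
    have "g x (s x) ((F ! j) x) = (\<Sum>i<length F. if i = j then g x b ((F ! i) x) else 0)"
      unfolding s_def metric_left(4) metric_left(3) using F(3) that by (intro sum.cong) auto
    then show ?thesis using that by (simp add: u_def metric_left(2) sum.delta)
  qed
  have fF: "g x (f x) ((F ! j) x) = 0" "g x ((F ! j) x) (f x) = 0" if "j < length F" for x j
    using orth[OF that, of x] metric_sym[of x "(F ! j) x" "f x"] by (simp_all add: f_def metric_left(3))
  have ff: "g x (f x) (f x) = 1" for x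
    using tt[of x] by (simp add: f_def metric_left(3) metric_right(3) mult.assoc)
  have span: "span ((\<lambda>h. h x) ` set (f # F)) = span (set (b # bs))" for x
  proof -
    have "span ((\<lambda>h. h x) ` set (f # F)) = span (insert b ((\<lambda>h. h x) ` set F))"
      using eq_span_insert_scale[OF _ s_span[of x], of "t x" b] tpos[of x] by (simp add: f_def u_def)
    also have "\<dots> = span (set (b # bs))"
      unfolding span_insert[of b] F(4) list.set ..
    finally show ?thesis .
  qed
  have "g x (((f # F) ! i) x) (((f # F) ! j) x) = (if i = j then 1 else 0)"
    if "i < length (f # F)" "j < length (f # F)" for x i j
    using that F(3) fF ff by (cases i; cases j) auto
  then show ?case
    using F(1,2) smooth_f span by (intro exI[of _ "f # F"]) auto
qed simp

lemma smooth_orthonormal_frame: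
  obtains F where "length F = DIM('a)" "\<And>f. f \<in> set F \<Longrightarrow> smooth f"
    "\<And>x. orthonormal_frame g x (map (\<lambda>f. f x) F)"
proof -
  obtain bs :: "'a list" where bs: "set bs = Basis" "distinct bs"
    using finite_distinct_list[OF finite_Basis] by blast
  then have "length bs = DIM('a)" using distinct_card by metis
  then show thesis
    using smooth_orthonormal_fields[OF bs(2)] bs independent_Basis that
    unfolding orthonormal_frame_def by fastforce
qed

end

section \<open>The inner product of covectors\<close>

text \<open>\<open>covector_inner\<close> with an explicit list of vectors in place of the chosen
  frame: this permits induction on the list and comparison of two frames.\<close>

definition frame_inner :: "'a list \<Rightarrow> 'a multicovector \<Rightarrow> 'a multicovector \<Rightarrow> complex" where
  "frame_inner L a b = (\<Sum>S\<in>Pow {..<length L}. a (nths L S) * cnj (b (nths L S)))"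

lemma frame_inner_Nil: "frame_inner [] a b = a [] * cnj (b [])"
  by (simp add: frame_inner_def)

lemma frame_inner_Cons:
  "frame_inner (e # L) a b = frame_inner L a b + frame_inner L (contract e a) (contract e b)"
proof -
  let ?n = "length L"
  let ?f = "\<lambda>S. a (nths (e # L) S) * cnj (b (nths (e # L) S))"
  have inj: "inj_on (\<lambda>S. insert 0 (Suc ` S)) (Pow {..<?n})" "inj_on ((`) Suc) (Pow {..<?n})"
    by (auto simp: inj_on_def)
  have sets: "{j. Suc j \<in> Suc ` S} = S" for S :: "nat set"
    by auto
  have "frame_inner (e # L) a b = sum ?f ((\<lambda>S. insert 0 (Suc ` S)) ` Pow {..<?n})
      + sum ?f ((`) Suc ` Pow {..<?n})"
    unfolding frame_inner_def length_Cons Pow_lessThan_Suc by (intro sum.union_disjoint) auto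
  also have "sum ?f ((\<lambda>S. insert 0 (Suc ` S)) ` Pow {..<?n}) = frame_inner L (contract e a) (contract e b)"
    by (subst sum.reindex[OF inj(1)]) (simp add: frame_inner_def nths_Cons contract_def sets o_def)
  also have "sum ?f ((`) Suc ` Pow {..<?n}) = frame_inner L a b"
    by (subst sum.reindex[OF inj(2)]) (simp add: frame_inner_def nths_Cons sets o_def)
  finally show ?thesis by simp
qed

lemma frame_inner_add_left:
  "frame_inner L (\<lambda>vs. a vs + a' vs) b = frame_inner L a b + frame_inner L a' b"
  by (simp add: frame_inner_def algebra_simps sum.distrib)

lemma frame_inner_add_right:
  "frame_inner L a (\<lambda>vs. b vs + b' vs) = frame_inner L a b + frame_inner L a b'"
  by (simp add: frame_inner_def algebra_simps sum.distrib)

lemma frame_inner_scale_left: "frame_inner L (\<lambda>vs. c * a vs) b = c * frame_inner L a b"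
  by (simp add: frame_inner_def sum_distrib_left mult.assoc)

lemma frame_inner_scale_right: "frame_inner L a (\<lambda>vs. c * b vs) = cnj c * frame_inner L a b"
  by (simp add: frame_inner_def sum_distrib_left mult.left_commute)

lemma frame_inner_zero_left: "frame_inner L (\<lambda>vs. 0) b = 0"
  by (simp add: frame_inner_def)

lemma frame_inner_zero_right: "frame_inner L a (\<lambda>vs. 0) = 0"
  by (simp add: frame_inner_def)

lemma frame_inner_minus_left: "frame_inner L (\<lambda>vs. - a vs) b = - frame_inner L a b"
  using frame_inner_scale_left[of L "-1" a b] by simp

lemma frame_inner_minus_right: "frame_inner L a (\<lambda>vs. - b vs) = - frame_inner L a b"
  using frame_inner_scale_right[of L a "-1" b] by simp

lemma frame_inner_diff_left:
  "frame_inner L (\<lambda>vs. a vs - a' vs) b = frame_inner L a b - frame_inner L a' b"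
  using frame_inner_add_left[of L a "\<lambda>vs. - a' vs" b] by (simp add: frame_inner_minus_left)

lemma frame_inner_sum_left:
  "frame_inner L (\<lambda>vs. \<Sum>i\<in>I. a i vs) b = (\<Sum>i\<in>I. frame_inner L (a i) b)"
  by (induction I rule: infinite_finite_induct) (simp_all add: frame_inner_zero_left frame_inner_add_left)

lemma frame_inner_sum_right:
  "frame_inner L a (\<lambda>vs. \<Sum>i\<in>I. b i vs) = (\<Sum>i\<in>I. frame_inner L a (b i))"
  by (induction I rule: infinite_finite_induct) (simp_all add: frame_inner_zero_right frame_inner_add_right)

section \<open>The degree operator and homogeneous components\<close>

definition number_operator :: "'a multicovector \<Rightarrow> 'a multicovector" where
  "number_operator a = (\<lambda>vs. of_nat (length vs) * a vs)"

lemma contract_number_operator: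
  "contract e (number_operator a) = (\<lambda>vs. number_operator (contract e a) vs + contract e a vs)"
  by (simp add: contract_def number_operator_def algebra_simps)

text \<open>
  This reduces statements about the inner product to bilinear traces, by induction on the degree.
\<close>

lemma frame_inner_number_operator:
  assumes "a \<in> alternating_multicovectors" "b \<in> alternating_multicovectors"
  shows "frame_inner L (number_operator a) b =
    (\<Sum>e\<leftarrow>L. frame_inner L (contract e a) (contract e b))"
  using assms
proof (induction L arbitrary: a b)
  case Nil
  then show ?case by (simp add: frame_inner_Nil number_operator_def)
next
  case (Cons f L)
  note alt = Cons.prems
  have IH1: "frame_inner L (number_operator a) b =
    (\<Sum>e\<leftarrow>L. frame_inner L (contract e a) (contract e b))"
    by (rule Cons.IH[OF alt])
  have IH2: "frame_inner L (number_operator (contract f a)) (contract f b) =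
    (\<Sum>e\<leftarrow>L. frame_inner L (contract f (contract e a)) (contract f (contract e b)))"
  proof -
    have "frame_inner L (contract e (contract f a)) (contract e (contract f b)) =
        frame_inner L (contract f (contract e a)) (contract f (contract e b))" for e
      unfolding contract_swap[OF alt(1), of e f] contract_swap[OF alt(2), of e f]
        frame_inner_minus_left frame_inner_minus_right by simp
    then show ?thesis
      using Cons.IH[OF alt[THEN contract_alternating]] by simp
  qed
  have zero: "contract f (contract f a) = (\<lambda>vs. 0)" by (rule contract_twice[OF alt(1)])
  show ?case
    unfolding frame_inner_Cons contract_number_operator frame_inner_add_left IH1 IH2
    by (simp add: sum_list_addf frame_inner_Cons zero frame_inner_zero_left)
qed

definition homogeneous :: "nat \<Rightarrow> 'a multicovector \<Rightarrow> bool" where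
  "homogeneous k a \<longleftrightarrow> (\<forall>vs. length vs \<noteq> k \<longrightarrow> a vs = 0)"

lemma contract_homogeneous_Suc: "homogeneous (Suc k) a \<Longrightarrow> homogeneous k (contract v a)"
  by (simp add: homogeneous_def contract_def)

lemma contract_homogeneous_0: "homogeneous 0 a \<Longrightarrow> contract v a = (\<lambda>vs. 0)"
  by (simp add: homogeneous_def contract_def)

lemma frame_inner_homogeneous_0: "homogeneous 0 a \<Longrightarrow> frame_inner L a b = a [] * cnj (b [])"
  by (induction L) (simp_all add: frame_inner_Nil frame_inner_Cons contract_homogeneous_0
      frame_inner_zero_left)

lemma number_operator_homogeneous: "homogeneous k a \<Longrightarrow> number_operator a = (\<lambda>vs. of_nat k * a vs)"
  by (fastforce simp: homogeneous_def number_operator_def)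

definition degree_part :: "nat \<Rightarrow> 'a multicovector \<Rightarrow> 'a multicovector" where
  "degree_part k a = (\<lambda>vs. (if length vs = k then 1 else 0) * a vs)"

lemma degree_part_homogeneous: "homogeneous k (degree_part k a)"
  by (simp add: homogeneous_def degree_part_def)

lemma degree_part_alternating:
  "a \<in> alternating_multicovectors \<Longrightarrow> degree_part k a \<in> alternating_multicovectors"
  unfolding degree_part_def by (rule mult_alternating) simp_all

lemma frame_inner_degree_parts: "frame_inner L a b = (\<Sum>k\<le>length L. frame_inner L (degree_part k a) b)"
proof -
  have "a (nths L S) = (\<Sum>k\<le>length L. degree_part k a (nths L S))" for S
  proof -
    have "length (nths L S) \<le> length L" by (simp add: length_nths) (metis (no_types, lifting)
        card_mono card_lessThan finite_lessThan lessThan_iff mem_Collect_eq subsetI)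
    then show ?thesis by (simp add: degree_part_def flip: sum_distrib_right)
  qed
  then show ?thesis
    unfolding frame_inner_sum_left[symmetric] by (simp add: frame_inner_def)
qed

section \<open>Independence of the orthonormal frame\<close>

context hermitian_structure
begin

lemma orthonormal_frame_distinct: "orthonormal_frame g x es \<Longrightarrow> distinct es"
  unfolding orthonormal_frame_def distinct_conv_nth by (metis zero_neq_one)

lemma orthonormal_frame_set:
  assumes "orthonormal_frame g x es" "e \<in> set es" "e' \<in> set es"
  shows "g x e e' = (if e = e' then 1 else 0)"
proof -
  obtain i j where "i < length es" "j < length es" "e = es ! i" "e' = es ! j"
    using assms(2,3) by (metis in_set_conv_nth)
  then show ?thesis
    using assms(1) orthonormal_frame_distinct[OF assms(1)]
    by (simp add: orthonormal_frame_def nth_eq_iff_index_eq)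
qed

lemma orthonormal_frame_independent:
  assumes "orthonormal_frame g x es"
  shows "independent (set es)"
proof (rule independent_if_scalars_zero)
  fix f e assume sum: "(\<Sum>e\<in>set es. f e *\<^sub>R e) = 0" and e: "e \<in> set es"
  have "0 = g x (\<Sum>e\<in>set es. f e *\<^sub>R e) e" by (simp add: sum metric_left)
  also have "\<dots> = (\<Sum>e'\<in>set es. if e' = e then f e' else 0)"
    unfolding metric_left(4) metric_left(3)
    by (intro sum.cong refl) (simp add: orthonormal_frame_set[OF assms _ e])
  finally show "f e = 0" using e by (simp add: sum.delta)
qed simp

lemma orthonormal_frame_span:
  assumes "orthonormal_frame g x es"
  shows "span (set es) = UNIV"
proof -
  have "card (set es) = DIM('a)"
    using assms distinct_card[OF orthonormal_frame_distinct[OF assms]]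
    by (simp add: orthonormal_frame_def)
  then have "UNIV \<subseteq> span (set es)"
    by (intro card_ge_dim_independent orthonormal_frame_independent[OF assms]) auto
  then show ?thesis by auto
qed

lemma orthonormal_frame_expansion:
  assumes "orthonormal_frame g x es"
  shows "v = (\<Sum>e\<in>set es. g x v e *\<^sub>R e)"
proof -
  define w where "w = v - (\<Sum>e\<in>set es. g x v e *\<^sub>R e)"
  have w: "g x w e = 0" if "e \<in> set es" for e
  proof -
    have "g x (\<Sum>e\<in>set es. g x v e *\<^sub>R e) e = (\<Sum>e'\<in>set es. if e' = e then g x v e' else 0)"
      unfolding metric_left(4) metric_left(3)
      by (intro sum.cong refl) (simp add: orthonormal_frame_set[OF assms _ that])
    then show ?thesis using that by (simp add: w_def metric_left(2) sum.delta)
  qed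
  have "g x w u = 0" if "u \<in> span (set es)" for u
    using that by (induction rule: span_induct_alt) (simp_all add: metric_right w)
  then have "g x w w = 0" using orthonormal_frame_span[OF assms] by simp
  then have "w = 0" using metric_pos[of w x] by auto
  then show ?thesis by (simp add: w_def)
qed

text \<open>The transition matrix between two orthonormal frames is orthogonal; the fact
  \<open>id\<close> in the proof is this relation, and it collapses the double sum to its
  diagonal.\<close>

lemma orthonormal_frame_trace:
  fixes B :: "'a \<Rightarrow> 'a \<Rightarrow> complex"
  assumes es: "orthonormal_frame g x es" and es': "orthonormal_frame g x es'"
    and B1: "\<And>v. linear (\<lambda>u. B u v)" and B2: "\<And>u. linear (B u)"
  shows "(\<Sum>e\<leftarrow>es. B e e) = (\<Sum>e\<leftarrow>es'. B e e)"
proof -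
  let ?E = "set es" and ?E' = "set es'"
  have B: "B u v = (\<Sum>e\<in>?E. \<Sum>f\<in>?E. of_real (g x u e * g x v f) * B e f)" for u v
  proof -
    have "B u v = B (\<Sum>e\<in>?E. g x u e *\<^sub>R e) v"
      using orthonormal_frame_expansion[OF es, of u] by simp
    also have "\<dots> = (\<Sum>e\<in>?E. g x u e *\<^sub>R B e v)"
      by (simp only: linear_sum[OF B1] linear_scale[OF B1])
    also have "\<dots> = (\<Sum>e\<in>?E. g x u e *\<^sub>R B e (\<Sum>f\<in>?E. g x v f *\<^sub>R f))"
      using orthonormal_frame_expansion[OF es, of v] by simp
    also have "\<dots> = (\<Sum>e\<in>?E. \<Sum>f\<in>?E. of_real (g x u e * g x v f) * B e f)"
      by (simp add: linear_sum[OF B2] linear_scale[OF B2] scaleR_conv_of_real sum_distrib_left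
          mult.assoc)
    finally show ?thesis .
  qed
  have id: "(\<Sum>u\<in>?E'. g x u e * g x u f) = (if e = f then 1 else 0)" if "e \<in> ?E" "f \<in> ?E" for e f
  proof -
    have "g x e f = g x (\<Sum>u\<in>?E'. g x e u *\<^sub>R u) f"
      using orthonormal_frame_expansion[OF es', of e] by simp
    also have "\<dots> = (\<Sum>u\<in>?E'. g x u e * g x u f)"
      by (simp add: metric_left metric_sym[of x e])
    finally show ?thesis using orthonormal_frame_set[OF es that] by simp
  qed
  have "(\<Sum>u\<in>?E'. B u u) = (\<Sum>u\<in>?E'. \<Sum>e\<in>?E. \<Sum>f\<in>?E. of_real (g x u e * g x u f) * B e f)"
    by (intro sum.cong refl B)
  also have "\<dots> = (\<Sum>e\<in>?E. \<Sum>f\<in>?E. \<Sum>u\<in>?E'. of_real (g x u e * g x u f) * B e f)"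
    by (subst sum.swap, intro sum.cong refl sum.swap)
  also have "\<dots> = (\<Sum>e\<in>?E. \<Sum>f\<in>?E. of_real (if e = f then 1 else 0) * B e f)"
    by (intro sum.cong refl) (simp only: sum_distrib_right[symmetric] of_real_sum[symmetric] id)
  also have "\<dots> = (\<Sum>e\<in>?E. \<Sum>f\<in>?E. if e = f then B e f else 0)"
    by (intro sum.cong refl) simp
  also have "\<dots> = (\<Sum>e\<in>?E. B e e)"
    by simp
  finally show ?thesis
    using orthonormal_frame_distinct[OF es] orthonormal_frame_distinct[OF es']
    by (simp add: sum_list_distinct_conv_sum_set)
qed

end

lemma contract_linear:
  assumes "a \<in> alternating_multicovectors"
  shows "contract (u + v) a = (\<lambda>vs. contract u a vs + contract v a vs)"
    and "contract (r *\<^sub>R u) a = (\<lambda>vs. of_real r * contract u a vs)"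
  using alternating_add[OF assms, of "[]"] alternating_scaleR[OF assms, of "[]"]
  by (auto simp: contract_def scaleR_conv_of_real)

lemma frame_inner_contract_linear:
  assumes "a \<in> alternating_multicovectors"
  shows "linear (\<lambda>u. frame_inner L (contract u a) b)"
    and "linear (\<lambda>u. frame_inner L b (contract u a))"
  by (auto intro!: linearI simp: contract_linear[OF assms] frame_inner_add_left frame_inner_scale_left
      frame_inner_add_right frame_inner_scale_right scaleR_conv_of_real)

context hermitian_structure
begin

text \<open>Induction on the degree. Multiplied by the degree, the inner product is a trace over
  contractions: the induction hypothesis changes the frame inside the trace, and
  \<open>orthonormal_frame_trace\<close> changes the one summed over.\<close>

lemma frame_inner_independent:
  assumes "orthonormal_frame g x es" "orthonormal_frame g x es'"
    and "a \<in> alternating_multicovectors" "b \<in> alternating_multicovectors"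
  shows "frame_inner es a b = frame_inner es' a b"
proof -
  have hom: "frame_inner es a b = frame_inner es' a b"
    if "homogeneous k a" "a \<in> alternating_multicovectors" "b \<in> alternating_multicovectors" for k a b
    using that
  proof (induction k arbitrary: a b)
    case 0
    then show ?case by (simp add: frame_inner_homogeneous_0)
  next
    case (Suc k)
    have IH: "frame_inner es (contract e a) (contract e b) = frame_inner es' (contract e a) (contract e b)" for e
      using Suc by (intro Suc.IH contract_homogeneous_Suc contract_alternating)
    have num: "of_nat (Suc k) * frame_inner L a b = (\<Sum>e\<leftarrow>L. frame_inner L (contract e a) (contract e b))" for L
      using frame_inner_number_operator[OF Suc.prems(2,3), of L]
      unfolding number_operator_homogeneous[OF Suc.prems(1)] frame_inner_scale_left .
    have "of_nat (Suc k) * frame_inner es a b = (\<Sum>e\<leftarrow>es. frame_inner es' (contract e a) (contract e b))"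
      unfolding num IH ..
    also have "\<dots> = (\<Sum>e\<leftarrow>es'. frame_inner es' (contract e a) (contract e b))"
      by (rule orthonormal_frame_trace[OF assms(1,2)])
        (rule frame_inner_contract_linear[OF Suc.prems(2)] frame_inner_contract_linear[OF Suc.prems(3)])+
    also have "\<dots> = of_nat (Suc k) * frame_inner es' a b"
      unfolding num ..
    finally show ?case by (metis mult_cancel_left of_nat_eq_0_iff nat.distinct(1))
  qed
  have "length es = length es'" using assms(1,2) by (simp add: orthonormal_frame_def)
  then show ?thesis
    unfolding frame_inner_degree_parts[of es a b] frame_inner_degree_parts[of es' a b]
    by (simp add: hom[OF degree_part_homogeneous degree_part_alternating[OF assms(3)] assms(4)])
qed

text \<open>Eliminates the choice in \<open>covector_inner\<close>. Smooth frames, and frames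
  transported by an isometry, become admissible for computing it.\<close>

lemma covector_inner_frame:
  assumes "orthonormal_frame g x es"
    and "a \<in> alternating_multicovectors" "b \<in> alternating_multicovectors"
  shows "covector_inner g x a b = frame_inner es a b"
proof -
  have some: "orthonormal_frame g x (SOME es. orthonormal_frame g x es)"
    using assms(1) by (rule someI)
  then have "length (SOME es. orthonormal_frame g x es) = DIM('a)"
    by (simp add: orthonormal_frame_def)
  then have "covector_inner g x a b = frame_inner (SOME es. orthonormal_frame g x es) a b"
    by (simp add: covector_inner_def frame_inner_def Let_def)
  then show ?thesis
    using frame_inner_independent[OF some assms] by simp
qed

lemma orthonormal_frame_exists: obtains es where "orthonormal_frame g x es"
  using smooth_orthonormal_frame by blast

text \<open>With K = J this concerns forms b of type (p,0), with K = -J forms of type (0,q).\<close>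

lemma frame_inner_type_orthogonal:
  assumes es: "orthonormal_frame g x es"
    and K: "\<And>u v. g x (K u) (K v) = g x u v"
    and \<theta>: "linear \<theta>" "\<And>v. \<theta> (K v) = - \<i> * \<theta> v"
    and a: "a \<in> alternating_multicovectors"
    and b: "b \<in> alternating_multicovectors" "\<And>v vs. b (K v # vs) = \<i> * b (v # vs)"
  shows "frame_inner es (covector1 \<theta> \<and>\<^sub>w a) b = 0"
proof -
  have esK: "orthonormal_frame g x (map K es)"
    using es K by (simp add: orthonormal_frame_def)
  have hom: "frame_inner es (degree_part k (covector1 \<theta> \<and>\<^sub>w a)) b = 0"
    if "a \<in> alternating_multicovectors" "b \<in> alternating_multicovectors"
      "\<And>v vs. b (K v # vs) = \<i> * b (v # vs)" for k a b
    using that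
  proof (induction k arbitrary: a b)
    case 0
    have "degree_part 0 (covector1 \<theta> \<and>\<^sub>w a) [] = 0"
      by (simp add: degree_part_def covector1_wedge_Nil)
    then show ?case
      by (simp add: frame_inner_homogeneous_0[OF degree_part_homogeneous])
  next
    case (Suc k)
    have alt: "degree_part (Suc k) (covector1 \<theta> \<and>\<^sub>w a) \<in> alternating_multicovectors"
      by (intro degree_part_alternating wedge_alternating covector1_alternating \<theta>(1) Suc.prems)
    have IH: "frame_inner es (degree_part k (covector1 \<theta> \<and>\<^sub>w contract e a)) (contract e b) = 0" for e
    proof (rule Suc.IH)
      show "contract e b (K v # vs) = \<i> * contract e b (v # vs)" for v vs
        using alternating_swap_hd[OF Suc.prems(2), of e "K v" vs]
          alternating_swap_hd[OF Suc.prems(2), of e v vs] Suc.prems(3)[of v "e # vs"]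
        by (simp add: contract_def)
    qed (intro contract_alternating Suc.prems)+
    have c: "contract e (degree_part (Suc k) (covector1 \<theta> \<and>\<^sub>w a)) =
        (\<lambda>vs. \<theta> e * degree_part k a vs - degree_part k (covector1 \<theta> \<and>\<^sub>w contract e a) vs)" for e
      by (rule ext, subst contract_def) (simp add: degree_part_def covector1_wedge_Cons)
    \<comment> \<open>The part of the Leibniz rule in which \<open>\<theta>\<close> absorbs the
      contracted vector; the other part has the same shape one degree lower and vanishes by
      \<open>IH\<close>.\<close>
    define B where "B = (\<lambda>u v. \<theta> u * frame_inner es (degree_part k a) (contract v b))"
    have B1: "linear (\<lambda>u. B u v)" for v
      unfolding B_def using linear_add[OF \<theta>(1)] linear_scale[OF \<theta>(1)]
      by (intro linearI) (simp_all add: algebra_simps)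
    have B2: "linear (B u)" for u
      unfolding B_def using linear_add[OF frame_inner_contract_linear(2)[OF Suc.prems(2)]]
        linear_scale[OF frame_inner_contract_linear(2)[OF Suc.prems(2)]]
      by (intro linearI) (simp_all add: algebra_simps)
    \<comment> \<open>\<open>\<theta>\<close> contributes \<open>- \<i>\<close>. So does
      \<open>b\<close>, since its factor \<open>\<i>\<close> leaves the antilinear slot conjugated;
      together they give -1.\<close>
    have BK: "B (K u) (K u) = - B u u" for u
    proof -
      have "contract (K u) b = (\<lambda>vs. \<i> * contract u b vs)"
        using Suc.prems(3) by (simp add: contract_def)
      moreover have "\<i> * p * (\<i> * q) = - (p * q)" for p q :: complex
        by (metis complex_i_mult_minus mult.assoc mult.left_commute)
      ultimately show ?thesis by (simp add: B_def \<theta>(2) frame_inner_scale_right)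
    qed
    \<comment> \<open>Applying \<open>K\<close> to the frame preserves the trace, although it
      reverses the sign of each term.\<close>
    have "(\<Sum>e\<leftarrow>es. B e e) = (\<Sum>e\<leftarrow>map K es. B e e)"
      by (rule orthonormal_frame_trace[OF es esK B1 B2])
    also have "\<dots> = - (\<Sum>e\<leftarrow>es. B e e)"
      by (simp add: o_def BK uminus_sum_list_map)
    finally have tr: "(\<Sum>e\<leftarrow>es. B e e) = 0" by simp
    have "of_nat (Suc k) * frame_inner es (degree_part (Suc k) (covector1 \<theta> \<and>\<^sub>w a)) b = (\<Sum>e\<leftarrow>es. B e e)"
      using frame_inner_number_operator[OF alt Suc.prems(2), of es]
      unfolding number_operator_homogeneous[OF degree_part_homogeneous] frame_inner_scale_left c
        frame_inner_diff_left IH B_def by simp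
    then show ?case using tr by (metis mult_eq_0_iff of_nat_eq_0_iff nat.distinct(1))
  qed
  show ?thesis
    unfolding frame_inner_degree_parts[of es "covector1 \<theta> \<and>\<^sub>w a" b] by (simp add: hom[OF a b])
qed

end

section \<open>The volume form\<close>

lemma alternating_span_eq_0:
  assumes "a \<in> alternating_multicovectors" "w \<in> span (set us \<union> set vs)"
  shows "a (us @ w # vs) = 0"
  using assms(2)
proof (induction rule: span_induct_alt)
  case base
  show ?case
    using alternating_scaleR[OF assms(1), of us 0 0 vs] by simp
next
  case (step r x y)
  have "a (us @ x # vs) = 0"
    using step by (intro alternating_not_distinct[OF assms(1)]) auto
  with step show ?case
    unfolding alternating_add[OF assms(1)] alternating_scaleR[OF assms(1)] by simp
qed

lemma wedge_unit: "a \<and>\<^sub>w unit_covector = a"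
proof
  fix vs
  show "(a \<and>\<^sub>w unit_covector) vs = a vs"
    by (induction vs arbitrary: a)
      (simp_all add: wedge_Nil wedge_Cons contract_unit_covector,
        simp_all add: unit_covector_def contract_def)
qed

lemma wedge_covector1_commute: "a \<and>\<^sub>w covector1 \<theta> = covector1 \<theta> \<and>\<^sub>w grade_involution a"
proof
  fix vs
  show "(a \<and>\<^sub>w covector1 \<theta>) vs = (covector1 \<theta> \<and>\<^sub>w grade_involution a) vs"
  proof (induction vs arbitrary: a)
    case Nil
    then show ?case by (simp add: wedge_Nil covector1_def)
  next
    case (Cons v vs)
    then show ?case
      by (simp add: covector1_wedge_Cons contract_grade_involution wedge_minus_right
          wedge_Cons[of a] contract_covector1 wedge_scale_right wedge_unit)
  qed
qed

lemma wedge_map: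
  "(a \<and>\<^sub>w b) (map L vs) = ((\<lambda>vs. a (map L vs)) \<and>\<^sub>w (\<lambda>vs. b (map L vs))) vs"
  by (simp add: wedge_def nths_map)

lemma map_alternating:
  assumes "a \<in> alternating_multicovectors" "linear L"
  shows "(\<lambda>vs. a (map L vs)) \<in> alternating_multicovectors"
proof -
  have "linear (\<lambda>v. a (map L (us @ v # vs)))" for us vs
    using linear_compose[OF assms(2) alternating_linear[OF assms(1), of "map L us" "map L vs"]]
    by (simp add: o_def)
  moreover have "a (map L vs) = 0" if "\<not> distinct vs" for vs
    using that by (intro alternating_not_distinct[OF assms(1)]) (simp add: distinct_map)
  ultimately show ?thesis by (simp add: alternating_multicovectors_def)
qed

lemma smooth_wedge:
  assumes "\<And>vs. smooth (\<lambda>x. \<alpha> x vs)" "\<And>vs. smooth (\<lambda>x. \<beta> x vs)"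
  shows "smooth (\<lambda>x. (\<alpha> x \<and>\<^sub>w \<beta> x) vs)"
  unfolding wedge_def by (intro smooth_sum smooth_mult smooth_const assms)

lemma linear_expand:
  fixes v :: "'a::euclidean_space"
  assumes "linear f"
  shows "f v = (\<Sum>b\<in>Basis. (v \<bullet> b) *\<^sub>R f b)"
proof -
  have "f v = f (\<Sum>b\<in>Basis. (v \<bullet> b) *\<^sub>R b)" by (simp add: euclidean_representation)
  then show ?thesis by (simp only: linear_sum[OF assms] linear_scale[OF assms])
qed

text \<open>The first field is expanded in the standard basis, which leaves a form contracted with
  constant vectors and one field fewer.\<close>

lemma smooth_insert_fields:
  fixes \<beta> :: "'a::euclidean_space form"
  assumes "\<And>x. \<beta> x \<in> alternating_multicovectors" "\<And>vs. smooth (\<lambda>x. \<beta> x vs)"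
    "\<And>f. f \<in> set F \<Longrightarrow> smooth f"
  shows "smooth (\<lambda>x. \<beta> x (map (\<lambda>f. f x) F))"
  using assms
proof (induction F arbitrary: \<beta>)
  case (Cons f F)
  have eq: "\<beta> x (map (\<lambda>f. f x) (f # F)) =
      (\<Sum>b\<in>Basis. (f x \<bullet> b) *\<^sub>R contract b (\<beta> x) (map (\<lambda>f. f x) F))" for x
    using linear_expand[OF alternating_linear[OF Cons.prems(1)[of x], of "[]" "map (\<lambda>f. f x) F"], where v = "f x"]
    by (simp add: contract_def)
  have "smooth (\<lambda>x. contract b (\<beta> x) (map (\<lambda>f. f x) F))" for b
  proof (rule Cons.IH)
    show "contract b (\<beta> x) \<in> alternating_multicovectors" for x
      by (rule contract_alternating[OF Cons.prems(1)])
    show "smooth (\<lambda>x. contract b (\<beta> x) vs)" for vs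
      unfolding contract_def by (rule Cons.prems(2))
  qed (use Cons.prems in auto)
  then show ?case
    unfolding eq using Cons.prems(3)[of f]
    by (intro smooth_sum smooth_scaleR smooth_inner smooth_const) simp_all
qed simp

lemma nths_Compl: "nths vs (- S) = nths vs ({..<length vs} - S)"
  unfolding nths_def by (intro arg_cong[where f = "map fst"] filter_cong refl) (auto simp: set_zip)

lemma shuffle_sign_sq: "shuffle_sign n S * shuffle_sign n S = 1"
  by (simp add: shuffle_sign_def flip: power_mult_distrib)

context hermitian_structure
begin

lemma fundamental_form_alternating: "fundamental_form J g x \<in> alternating_multicovectors"
proof (rule alternatingI)
  have l1: "linear (\<lambda>v. complex_of_real (g x (J u) v))" for u
    using metric_right[of x "J u"] by (intro linearI) (simp_all add: scaleR_conv_of_real)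
  have l2: "linear (\<lambda>u. complex_of_real (g x (J u) v))" for v
    by (intro linearI)
      (simp_all add: linear_add[OF linear_J] linear_scale[OF linear_J] metric_left scaleR_conv_of_real)
  show "linear (\<lambda>v. fundamental_form J g x (us @ v # vs))" for us vs
  proof -
    consider (a) u where "us = [u]" "vs = []" | (b) w where "us = []" "vs = [w]"
      | (c) "length us + length vs \<noteq> 1"
      by (cases us; cases vs) (auto simp: length_Suc_conv)
    then show ?thesis
    proof cases
      case c
      then have "(\<lambda>v. fundamental_form J g x (us @ v # vs)) = (\<lambda>v. 0)"
        by (cases us; cases vs) (auto simp: fundamental_form_def split: list.split)
      then show ?thesis by (simp add: linear_zero)
    qed (simp_all add: fundamental_form_def l1 l2)
  qed
  show "fundamental_form J g x (us @ v # v # vs) = 0" for us v vs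
    by (cases us) (auto simp: fundamental_form_def metric_J_self split: list.split)
qed

definition kaehler_power :: "'a \<Rightarrow> nat \<Rightarrow> 'a multicovector" where
  "kaehler_power x k = ((\<lambda>a. fundamental_form J g x \<and>\<^sub>w a) ^^ k) unit_covector"

lemma kaehler_power_Suc: "kaehler_power x (Suc k) = fundamental_form J g x \<and>\<^sub>w kaehler_power x k"
  by (simp add: kaehler_power_def)

lemma kaehler_power_0: "kaehler_power x 0 = unit_covector"
  by (simp add: kaehler_power_def)

lemma volume_form_kaehler_power:
  "volume_form J g x = (\<lambda>vs. kaehler_power x (DIM('a) div 2) vs / fact (DIM('a) div 2))"
  by (simp add: volume_form_def kaehler_power_def)

lemma kaehler_power_alternating: "kaehler_power x k \<in> alternating_multicovectors"
  by (induction k) (simp_all add: kaehler_power_0 kaehler_power_Suc unit_covector_alternating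
      wedge_alternating fundamental_form_alternating)

lemma volume_form_alternating: "volume_form J g x \<in> alternating_multicovectors"
  using scale_alternating[OF kaehler_power_alternating, of "1 / fact (DIM('a) div 2)"]
  by (simp add: volume_form_kaehler_power)

end

lemma wedge_eq_0_left:
  "(\<And>us. set us \<subseteq> set vs \<Longrightarrow> a us = 0) \<Longrightarrow> (a \<and>\<^sub>w b) vs = 0"
  unfolding wedge_def by (simp add: set_nths_subset)

context hermitian_structure
begin

lemma contract_fundamental_form_eq_0:
  "(\<And>v. v \<in> set vs \<Longrightarrow> g x (J u) v = 0) \<Longrightarrow> contract u (fundamental_form J g x) vs = 0"
  by (auto simp: contract_def fundamental_form_def split: list.split)

lemma grade_involution_fundamental_form:
  "grade_involution (fundamental_form J g x) = fundamental_form J g x"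
  by (auto simp: grade_involution_def fundamental_form_def fun_eq_iff split: list.split)

lemma contract_contract_fundamental_form:
  "contract (J u) (contract u (fundamental_form J g x)) = (\<lambda>vs. of_real (g x u u) * unit_covector vs)"
  by (auto simp: contract_def fundamental_form_def unit_covector_def metric_J fun_eq_iff
      split: list.split)

text \<open>The fundamental form pairs neither \<open>u\<close> nor \<open>J u\<close> with an entry
  of \<open>vs\<close>, so both vectors must go into the same one of the \<open>Suc k\<close>
  factors, where they give \<open>g x u u\<close>.\<close>

lemma kaehler_power_split:
  assumes "\<And>v. v \<in> set vs \<Longrightarrow> g x u v = 0" "\<And>v. v \<in> set vs \<Longrightarrow> g x (J u) v = 0"
  shows "kaehler_power x (Suc k) (u # J u # vs) =
    of_nat (Suc k) * of_real (g x u u) * kaehler_power x k vs"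
  using assms
proof (induction k arbitrary: vs)
  \<comment> \<open>One factor is peeled off. Either it takes both vectors or it passes both on; the
    mixed terms vanish by orthogonality.\<close>
  have expand: "kaehler_power x (Suc k) (u # J u # vs) =
      of_real (g x u u) * kaehler_power x k vs +
      (fundamental_form J g x \<and>\<^sub>w contract (J u) (contract u (kaehler_power x k))) vs"
    if "\<And>v. v \<in> set vs \<Longrightarrow> g x u v = 0" "\<And>v. v \<in> set vs \<Longrightarrow> g x (J u) v = 0" for k vs
  proof -
    have z: "contract (J u) (fundamental_form J g x) us = 0" "contract u (fundamental_form J g x) us = 0"
      if "set us \<subseteq> set vs" for us
      using that \<open>\<And>v. v \<in> set vs \<Longrightarrow> g x u v = 0\<close> \<open>\<And>v. v \<in> set vs \<Longrightarrow> g x (J u) v = 0\<close>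
      by (auto intro!: contract_fundamental_form_eq_0 simp: J_J metric_left)
    have "(contract (J u) (fundamental_form J g x) \<and>\<^sub>w contract u (kaehler_power x k)) vs = 0"
      by (rule wedge_eq_0_left) (rule z)
    moreover have "(grade_involution (contract u (fundamental_form J g x)) \<and>\<^sub>w
        contract (J u) (kaehler_power x k)) vs = 0"
      by (rule wedge_eq_0_left) (simp add: grade_involution_def z)
    ultimately show ?thesis
      by (simp add: kaehler_power_Suc wedge_Cons contract_contract_fundamental_form
          grade_involution_fundamental_form wedge_scale_left unit_wedge)
  qed
  {
    case 0
    then show ?case
      by (subst expand) (simp_all add: kaehler_power_0 contract_unit_covector contract_def[of _ "\<lambda>_. 0"])
  next
    case (Suc k)
    have "(fundamental_form J g x \<and>\<^sub>w contract (J u) (contract u (kaehler_power x (Suc k)))) vs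
      = (fundamental_form J g x \<and>\<^sub>w
          (\<lambda>vs. (of_nat (Suc k) * of_real (g x u u)) * kaehler_power x k vs)) vs"
      unfolding wedge_def
    proof (intro sum.cong refl arg_cong2[where f = times])
      fix S
      show "contract (J u) (contract u (kaehler_power x (Suc k))) (nths vs (- S)) =
          of_nat (Suc k) * of_real (g x u u) * kaehler_power x k (nths vs (- S))"
        unfolding contract_def by (rule Suc.IH) (auto intro: Suc.prems dest: in_set_nthsD)
    qed
    then have *: "(fundamental_form J g x \<and>\<^sub>w contract (J u) (contract u (kaehler_power x (Suc k)))) vs
      = of_nat (Suc k) * of_real (g x u u) * kaehler_power x (Suc k) vs"
      unfolding wedge_scale_right kaehler_power_Suc[symmetric] .
    have "kaehler_power x (Suc (Suc k)) (u # J u # vs) =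
      of_real (g x u u) * kaehler_power x (Suc k) vs +
      of_nat (Suc k) * of_real (g x u u) * kaehler_power x (Suc k) vs"
      unfolding *[symmetric] by (rule expand) (use Suc.prems in auto)
    then show ?case by (simp add: algebra_simps)
  }
qed

text \<open>The order in which each vector is followed at once by its image under \<open>J\<close>
  is the complex orientation, on which the volume form is positive.\<close>

definition J_pairs :: "'a list \<Rightarrow> 'a list" where
  "J_pairs us = concat (map (\<lambda>u. [u, J u]) us)"

text \<open>Linear independence over the complex numbers, since the real span of
  \<open>J_pairs us\<close> is stable under \<open>J\<close>. The recursive form follows the
  orthogonalization in \<open>kaehler_power_pos\<close>.\<close>

fun J_independent :: "'a list \<Rightarrow> bool" where
  "J_independent [] = True"
| "J_independent (u # us) = (u \<notin> span (set (J_pairs us)) \<and> J_independent us)"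

lemma orthogonal_projection:
  obtains w where "w \<in> span A" "\<And>v. v \<in> span A \<Longrightarrow> g x (u - w) v = 0"
proof -
  obtain B where B: "B \<subseteq> A" "independent B" "A \<subseteq> span B"
    using maximal_independent_subset by blast
  then have "span B = span A" by (metis span_mono span_minimal subspace_span subset_antisym)
  obtain bs where bs: "set bs = B" "distinct bs"
    using finite_distinct_list[OF independent_imp_finite[OF B(2)]] by blast
  obtain F where F: "\<And>i j. i < length F \<Longrightarrow> j < length F \<Longrightarrow> g x ((F ! i) x) ((F ! j) x) = (if i = j then 1 else 0)"
    "span ((\<lambda>f. f x) ` set F) = span (set bs)"
    using smooth_orthonormal_fields[OF bs(2)] B(2) bs(1) by blast
  define w where "w = (\<Sum>i<length F. g x u ((F ! i) x) *\<^sub>R (F ! i) x)"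
  have "w \<in> span ((\<lambda>f. f x) ` set F)"
    unfolding w_def by (intro span_sum span_mul span_base) auto
  then have wA: "w \<in> span A" using F(2) bs(1) \<open>span B = span A\<close> by simp
  have orth: "g x (u - w) ((F ! j) x) = 0" if "j < length F" for j
  proof -
    have "g x w ((F ! j) x) = (\<Sum>i<length F. if i = j then g x u ((F ! i) x) else 0)"
      unfolding w_def metric_left(4) metric_left(3) using F(1) that by (intro sum.cong) auto
    then show ?thesis using that by (simp add: metric_left(2) sum.delta)
  qed
  have "g x (u - w) v = 0" if "v \<in> span A" for v
  proof -
    have "v \<in> span ((\<lambda>f. f x) ` set F)" using that F(2) bs(1) \<open>span B = span A\<close> by simp
    then show ?thesis
      by (induction rule: span_induct_alt) (auto simp: metric_right in_set_conv_nth orth)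
  qed
  with wA show thesis by (rule that)
qed

lemma J_pairs_J_span: "v \<in> span (set (J_pairs us)) \<Longrightarrow> J v \<in> span (set (J_pairs us))"
proof (induction rule: span_induct_alt)
  case base
  then show ?case by (simp add: linear_0[OF linear_J] span_zero)
next
  case (step c x y)
  have "J x \<in> span (set (J_pairs us))"
  proof -
    obtain u where u: "u \<in> set us" "x = u \<or> x = J u"
      using step(1) by (auto simp: J_pairs_def)
    then have "u \<in> span (set (J_pairs us))" "J u \<in> span (set (J_pairs us))"
      by (auto simp: J_pairs_def intro!: span_base)
    then show ?thesis using u(2) by (auto simp: J_J span_neg)
  qed
  with step show ?case
    by (simp add: linear_add[OF linear_J] linear_scale[OF linear_J] span_add span_mul)
qed

text \<open>Replacing \<open>u\<close> by its component \<open>u'\<close> orthogonal to the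
  \<open>J\<close>-stable span of the later pairs does not change an alternating value. The pair
  \<open>u'\<close>, \<open>J u'\<close> then splits off with a positive factor.\<close>

lemma kaehler_power_pos:
  "J_independent us \<Longrightarrow> \<exists>r>0. kaehler_power x (length us) (J_pairs us) = of_real r"
proof (induction us)
  case Nil
  then show ?case by (auto simp: J_pairs_def kaehler_power_0 unit_covector_def intro: exI[of _ 1])
next
  case (Cons u us)
  let ?vs = "J_pairs us"
  obtain r where r: "r > 0" "kaehler_power x (length us) ?vs = of_real r"
    using Cons by auto
  obtain w where w: "w \<in> span (set ?vs)" "\<And>v. v \<in> span (set ?vs) \<Longrightarrow> g x (u - w) v = 0"
    using orthogonal_projection by metis
  define u' where "u' = u - w"
  have "u' \<noteq> 0" using w(1) Cons.prems by (auto simp: u'_def)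
  have u: "u = u' + w" "J u = J u' + J w"
    by (simp_all add: u'_def linear_diff[OF linear_J])
  have orth: "g x u' v = 0" "g x (J u') v = 0" if "v \<in> set ?vs" for v
    using w(2)[OF span_base[OF that]] w(2)[OF J_pairs_J_span[OF span_base[OF that]]]
    by (simp_all add: u'_def metric_skew_J)
  let ?c = "kaehler_power x (Suc (length us))"
  note alt = kaehler_power_alternating[of x "Suc (length us)"]
  have "?c (J_pairs (u # us)) = ?c ([] @ (u' + w) # J u # ?vs)"
    by (simp add: J_pairs_def u'_def)
  also have "\<dots> = ?c (u' # J u # ?vs) + ?c ([] @ w # J u # ?vs)"
    unfolding alternating_add[OF alt] by simp
  also have "?c ([] @ w # J u # ?vs) = 0"
    using w(1) span_mono[of "set ?vs" "set [] \<union> set (J u # ?vs)"]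
    by (intro alternating_span_eq_0[OF alt]) auto
  also have "?c (u' # J u # ?vs) = ?c ([u'] @ (J u' + J w) # ?vs)"
    unfolding u(2) by simp
  also have "\<dots> = ?c (u' # J u' # ?vs) + ?c ([u'] @ J w # ?vs)"
    unfolding alternating_add[OF alt] by simp
  also have "?c ([u'] @ J w # ?vs) = 0"
    using J_pairs_J_span[OF w(1)] span_mono[of "set ?vs" "set [u'] \<union> set ?vs"]
    by (intro alternating_span_eq_0[OF alt]) auto
  also have "?c (u' # J u' # ?vs) = of_nat (Suc (length us)) * of_real (g x u' u') * of_real r"
    using kaehler_power_split[OF orth, where k = "length us"] r(2) by simp
  finally have "?c (J_pairs (u # us)) = of_real (real (Suc (length us)) * g x u' u' * r)"
    by simp
  moreover have "real (Suc (length us)) * g x u' u' * r > 0"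
    using r(1) metric_pos[OF \<open>u' \<noteq> 0\<close>, of x] by simp
  ultimately show ?case by (metis length_Cons)
qed

lemma volume_form_pos:
  assumes "J_independent us" "length us = DIM('a) div 2"
  obtains r where "r > 0" "volume_form J g x (J_pairs us) = of_real r"
proof -
  obtain r where "r > 0" "kaehler_power x (length us) (J_pairs us) = of_real r"
    using kaehler_power_pos[OF assms(1)] by blast
  then have "r / fact (DIM('a) div 2) > 0"
    "volume_form J g x (J_pairs us) = of_real (r / fact (DIM('a) div 2))"
    by (simp_all add: volume_form_kaehler_power assms(2))
  then show thesis by (rule that)
qed

lemma volume_form_smooth: "smooth (\<lambda>x. volume_form J g x vs)"
proof -
  have "smooth (\<lambda>x. fundamental_form J g x vs)" for vs
    proof (cases "length vs = 2")
      case True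
      then obtain u v where "vs = [u, v]"
        by (auto simp: numeral_2_eq_2 length_Suc_conv)
      then show ?thesis
        using smooth_bounded_linear[OF bounded_linear_of_real metric_smooth]
        by (simp add: fundamental_form_def)
    next
      case False
      then have "fundamental_form J g x vs = 0" for x
        by (auto simp: fundamental_form_def split: list.split)
      then show ?thesis by (simp add: smooth_const)
    qed
  then have "smooth (\<lambda>x. kaehler_power x k vs)" for k vs
    by (induction k arbitrary: vs) (simp_all add: kaehler_power_0 kaehler_power_Suc smooth_const smooth_wedge)
  then have "smooth (\<lambda>x. kaehler_power x k vs * (1 / fact (DIM('a) div 2)))" for k
    by (intro smooth_mult smooth_const)
  then show ?thesis by (simp add: volume_form_kaehler_power)
qed

end

section \<open>The Hodge star\<close>

text \<open>In degree \<open>length E\<close> every proper sublist of \<open>E\<close> is too short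
  to contribute, so the value at \<open>E\<close> itself determines everything.\<close>

lemma homogeneous_alternating_eqI:
  assumes "a \<in> alternating_multicovectors" "b \<in> alternating_multicovectors"
    and "span (set E) = UNIV" "a E = b E" "length vs = length E"
  shows "a vs = b vs"
proof -
  have "degree_part (length E) a = degree_part (length E) b"
  proof (rule alternating_eqI[OF _ _ assms(3)])
    fix S assume S: "S \<subseteq> {..<length E}"
    show "degree_part (length E) a (nths E S) = degree_part (length E) b (nths E S)"
    proof (cases "S = {..<length E}")
      case True
      then have "nths E S = E" by (simp add: nths_all)
      then show ?thesis using assms(4) by (simp add: degree_part_def)
    next
      case False
      then have "card S < card {..<length E}" using S by (intro psubset_card_mono) auto
      then show ?thesis by (simp add: degree_part_def length_nths_subset[OF S])
    qed
  qed (intro degree_part_alternating assms)+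
  then have "degree_part (length E) a vs = degree_part (length E) b vs" by simp
  then show ?thesis
    using assms(5) by (simp add: degree_part_def)
qed

text \<open>A covector dual to the complement of \<open>T\<close> isolates a single coefficient of
  \<open>c\<close>. This gives both the uniqueness of the star and a formula for its
  coefficients.\<close>

lemma wedge_basis_select:
  assumes "\<And>S. S \<subseteq> {..<length E} \<Longrightarrow> a (nths E S) = (if S = {..<length E} - T then 1 else 0)"
    and "T \<subseteq> {..<length E}"
  shows "(a \<and>\<^sub>w c) E = shuffle_sign (length E) ({..<length E} - T) * c (nths E T)"
proof -
  let ?U = "{..<length E} - T"
  have "(a \<and>\<^sub>w c) E = (\<Sum>S\<in>Pow {..<length E}.
      if S = ?U then shuffle_sign (length E) S * c (nths E (- S)) else 0)"
    unfolding wedge_def by (intro sum.cong refl) (auto simp: assms(1))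
  also have "\<dots> = shuffle_sign (length E) ?U * c (nths E (- ?U))"
    by (subst sum.delta) auto
  also have "nths E (- ?U) = nths E T"
    using assms(2) by (subst nths_Compl) (simp add: double_diff)
  finally show ?thesis .
qed

lemma wedge_nondegenerate:
  fixes c c' :: "'a::euclidean_space multicovector"
  assumes "c \<in> alternating_multicovectors" "c' \<in> alternating_multicovectors"
    and eq: "\<And>a vs. a \<in> alternating_multicovectors \<Longrightarrow> length vs = DIM('a) \<Longrightarrow>
      (a \<and>\<^sub>w c) vs = (a \<and>\<^sub>w c') vs"
  shows "c = c'"
proof -
  obtain E :: "'a list" where E: "set E = Basis" "distinct E"
    using finite_distinct_list[OF finite_Basis] by blast
  have len: "length E = DIM('a)" using E distinct_card by metis
  show ?thesis
  proof (rule alternating_eqI[OF assms(1,2)])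
    show "span (set E) = UNIV" by (simp add: E)
    fix T assume T: "T \<subseteq> {..<length E}"
    obtain a where a: "a \<in> alternating_multicovectors"
      "\<And>S. S \<subseteq> {..<length E} \<Longrightarrow> a (nths E S) = (if S = {..<length E} - T then 1 else 0)"
      using alternating_extend[of E "\<lambda>S. if S = {..<length E} - T then 1 else 0"] E independent_Basis
      by metis
    have "shuffle_sign (length E) ({..<length E} - T) * c (nths E T) =
        shuffle_sign (length E) ({..<length E} - T) * c' (nths E T)"
      using eq[OF a(1) len] by (simp only: wedge_basis_select[OF a(2) T])
    moreover have "shuffle_sign (length E) ({..<length E} - T) \<noteq> 0"
      by (simp add: shuffle_sign_def)
    ultimately show "c (nths E T) = c' (nths E T)" by simp
  qed
qed

context hermitian_structure
begin

definition is_hodge_star :: "'a \<Rightarrow> 'a multicovector \<Rightarrow> 'a multicovector \<Rightarrow> bool" where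
  "is_hodge_star x b c \<longleftrightarrow> c \<in> alternating_multicovectors \<and>
    (\<forall>a\<in>alternating_multicovectors. \<forall>vs. length vs = DIM('a) \<longrightarrow>
      (a \<and>\<^sub>w c) vs = covector_inner g x a b * volume_form J g x vs)"

lemma hodge_star_eqI: "is_hodge_star x (\<beta> x) c \<Longrightarrow> hodge_star J g \<beta> x = c"
  unfolding hodge_star_def is_hodge_star_def[symmetric]
  by (rule the_equality) (auto simp: is_hodge_star_def intro!: wedge_nondegenerate)

lemma is_hodge_star_exists:
  assumes b: "b \<in> alternating_multicovectors"
  shows "\<exists>c. is_hodge_star x b c"
proof -
  obtain es where es: "orthonormal_frame g x es" by (rule orthonormal_frame_exists)
  let ?n = "length es" and ?v = "volume_form J g x"
  have n: "?n = DIM('a)" using es by (simp add: orthonormal_frame_def)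
  \<comment> \<open>These values are forced by testing against the monomial dual to the complement
    of \<open>T\<close>. The factor \<open>?v es\<close> stays because an orthonormal frame need not
    be positively oriented.\<close>
  obtain c where c: "c \<in> alternating_multicovectors"
    "\<And>T. T \<subseteq> {..<?n} \<Longrightarrow> c (nths es T) =
      shuffle_sign ?n ({..<?n} - T) * cnj (b (nths es ({..<?n} - T))) * ?v es"
    using alternating_extend[OF orthonormal_frame_distinct[OF es] orthonormal_frame_independent[OF es],
      of "\<lambda>T. shuffle_sign ?n ({..<?n} - T) * cnj (b (nths es ({..<?n} - T))) * ?v es"] by metis
  have "(a \<and>\<^sub>w c) vs = covector_inner g x a b * ?v vs"
    if a: "a \<in> alternating_multicovectors" and vs: "length vs = DIM('a)" for a vs
  proof (rule homogeneous_alternating_eqI[where E = es])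
    show "a \<and>\<^sub>w c \<in> alternating_multicovectors" by (intro wedge_alternating a c)
    show "(\<lambda>vs. covector_inner g x a b * ?v vs) \<in> alternating_multicovectors"
      by (intro scale_alternating volume_form_alternating)
    show "span (set es) = UNIV" by (rule orthonormal_frame_span[OF es])
    show "length vs = ?n" using vs n by simp
    have "(a \<and>\<^sub>w c) es = (\<Sum>S\<in>Pow {..<?n}. a (nths es S) * cnj (b (nths es S)) * ?v es)"
      unfolding wedge_def
    proof (intro sum.cong refl)
      fix S assume "S \<in> Pow {..<?n}"
      then have "c (nths es (- S)) = shuffle_sign ?n S * cnj (b (nths es S)) * ?v es"
        by (subst nths_Compl) (simp add: c(2) double_diff)
      then show "shuffle_sign ?n S * a (nths es S) * c (nths es (- S)) =
          a (nths es S) * cnj (b (nths es S)) * ?v es"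
        using shuffle_sign_sq[of ?n S] by (simp add: algebra_simps)
    qed
    also have "\<dots> = covector_inner g x a b * ?v es"
      by (simp add: covector_inner_frame[OF es a b] frame_inner_def sum_distrib_right)
    finally show "(a \<and>\<^sub>w c) es = covector_inner g x a b * ?v es" .
  qed
  with c(1) show ?thesis by (auto simp: is_hodge_star_def)
qed

section \<open>Additivity, type, naturality and smoothness of the star\<close>

lemma hodge_star_is_hodge_star:
  "\<beta> x \<in> alternating_multicovectors \<Longrightarrow> is_hodge_star x (\<beta> x) (hodge_star J g \<beta> x)"
  using is_hodge_star_exists hodge_star_eqI by metis

lemma hodge_star_alternating:
  "\<beta> x \<in> alternating_multicovectors \<Longrightarrow> hodge_star J g \<beta> x \<in> alternating_multicovectors"
  using hodge_star_is_hodge_star by (simp add: is_hodge_star_def)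

lemma wedge_hodge_star:
  "\<beta> x \<in> alternating_multicovectors \<Longrightarrow> a \<in> alternating_multicovectors \<Longrightarrow> length vs = DIM('a) \<Longrightarrow>
    (a \<and>\<^sub>w hodge_star J g \<beta> x) vs = covector_inner g x a (\<beta> x) * volume_form J g x vs"
  using hodge_star_is_hodge_star by (simp add: is_hodge_star_def)

lemma hodge_star_sum:
  assumes "\<And>i. i \<in> I \<Longrightarrow> \<beta> i x \<in> alternating_multicovectors"
  shows "hodge_star J g (\<lambda>x vs. \<Sum>i\<in>I. \<beta> i x vs) x = (\<lambda>vs. \<Sum>i\<in>I. hodge_star J g (\<beta> i) x vs)"
proof (rule hodge_star_eqI)
  obtain es where es: "orthonormal_frame g x es" by (rule orthonormal_frame_exists)
  have alt: "(\<lambda>vs. \<Sum>i\<in>I. \<beta> i x vs) \<in> alternating_multicovectors"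
    using assms by (rule sum_alternating)
  show "is_hodge_star x (\<lambda>vs. \<Sum>i\<in>I. \<beta> i x vs) (\<lambda>vs. \<Sum>i\<in>I. hodge_star J g (\<beta> i) x vs)"
    unfolding is_hodge_star_def
  proof (intro conjI ballI allI impI)
    show "(\<lambda>vs. \<Sum>i\<in>I. hodge_star J g (\<beta> i) x vs) \<in> alternating_multicovectors"
      using assms by (intro sum_alternating hodge_star_alternating)
    fix a :: "'a multicovector" and vs :: "'a list"
    assume a: "a \<in> alternating_multicovectors" and vs: "length vs = DIM('a)"
    show "(a \<and>\<^sub>w (\<lambda>vs. \<Sum>i\<in>I. hodge_star J g (\<beta> i) x vs)) vs =
        covector_inner g x a (\<lambda>vs. \<Sum>i\<in>I. \<beta> i x vs) * volume_form J g x vs"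
      unfolding wedge_sum_right covector_inner_frame[OF es a alt] frame_inner_sum_right sum_distrib_right
      using assms by (intro sum.cong refl)
        (simp add: wedge_hodge_star[OF _ a vs] covector_inner_frame[OF es a])
  qed
qed

text \<open>Test against an arbitrary \<open>a\<close>: once \<open>\<theta>\<close> is moved in
  front of \<open>a\<close>, the product becomes the inner product of \<open>\<theta>\<close> wedge
  \<open>grade_involution a\<close> with \<open>\<beta> x\<close>, which vanishes for reasons of
  type. Nondegeneracy concludes.\<close>

lemma covector1_wedge_hodge_star_eq_0:
  assumes \<beta>: "\<beta> x \<in> alternating_multicovectors" "\<And>v vs. \<beta> x (K v # vs) = \<i> * \<beta> x (v # vs)"
    and K: "\<And>u v. g x (K u) (K v) = g x u v"
    and \<theta>: "linear \<theta>" "\<And>v. \<theta> (K v) = - \<i> * \<theta> v"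
  shows "covector1 \<theta> \<and>\<^sub>w hodge_star J g \<beta> x = (\<lambda>vs. 0)"
proof (rule wedge_nondegenerate)
  obtain es where es: "orthonormal_frame g x es" by (rule orthonormal_frame_exists)
  show "covector1 \<theta> \<and>\<^sub>w hodge_star J g \<beta> x \<in> alternating_multicovectors"
    by (intro wedge_alternating covector1_alternating \<theta> hodge_star_alternating \<beta>(1))
  show "(\<lambda>vs. 0) \<in> alternating_multicovectors" by (rule zero_alternating)
  fix a :: "'a multicovector" and vs :: "'a list"
  assume a: "a \<in> alternating_multicovectors" and vs: "length vs = DIM('a)"
  let ?a = "grade_involution a"
  have a': "?a \<in> alternating_multicovectors"
    by (rule grade_involution_alternating[OF a])
  have alt: "covector1 \<theta> \<and>\<^sub>w ?a \<in> alternating_multicovectors"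
    by (intro wedge_alternating covector1_alternating \<theta> a')
  have "a \<and>\<^sub>w (covector1 \<theta> \<and>\<^sub>w hodge_star J g \<beta> x) = (covector1 \<theta> \<and>\<^sub>w ?a) \<and>\<^sub>w hodge_star J g \<beta> x"
    by (simp only: wedge_covector1_commute flip: wedge_assoc)
  then have "(a \<and>\<^sub>w (covector1 \<theta> \<and>\<^sub>w hodge_star J g \<beta> x)) vs =
      frame_inner es (covector1 \<theta> \<and>\<^sub>w ?a) (\<beta> x) * volume_form J g x vs"
    using wedge_hodge_star[of \<beta> x, OF \<beta>(1) alt vs] covector_inner_frame[OF es alt \<beta>(1)] by simp
  also have "frame_inner es (covector1 \<theta> \<and>\<^sub>w ?a) (\<beta> x) = 0"
    by (rule frame_inner_type_orthogonal[OF es K \<theta> a' \<beta>])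
  finally show "(a \<and>\<^sub>w (covector1 \<theta> \<and>\<^sub>w hodge_star J g \<beta> x)) vs = (a \<and>\<^sub>w (\<lambda>vs. 0)) vs"
    by simp
qed

text \<open>An isometry commuting with \<open>J\<close> carries orthonormal frames to orthonormal
  frames and fundamental forms to fundamental forms, so it transports the identity characterizing
  the star. It is meant for derivatives of deck transformations.\<close>

lemma hodge_star_natural:
  assumes L: "linear L" "bij L" "\<And>v. J (L v) = L (J v)" "\<And>u v. g y (L u) (L v) = g x u v"
    and \<beta>: "\<beta> y \<in> alternating_multicovectors" "\<And>vs. \<beta> x vs = \<beta> y (map L vs)"
  shows "hodge_star J g \<beta> x = (\<lambda>vs. hodge_star J g \<beta> y (map L vs))"
proof (rule hodge_star_eqI, unfold is_hodge_star_def, intro conjI ballI allI impI)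
  have \<beta>x: "\<beta> x \<in> alternating_multicovectors"
    using map_alternating[OF \<beta>(1) L(1)] by (simp flip: \<beta>(2))
  show "(\<lambda>vs. hodge_star J g \<beta> y (map L vs)) \<in> alternating_multicovectors"
    by (intro map_alternating hodge_star_alternating \<beta> L)
  fix a :: "'a multicovector" and vs :: "'a list"
  assume a: "a \<in> alternating_multicovectors" and vs: "length vs = DIM('a)"
  have Linv: "linear (inv L)" by (rule inj_linear_imp_inv_linear[OF L(1) bij_is_inj[OF L(2)]])
  define a' where "a' = (\<lambda>vs. a (map (inv L) vs))"
  have a': "a' \<in> alternating_multicovectors"
    unfolding a'_def by (rule map_alternating[OF a Linv])
  have a'L: "a' (map L vs) = a vs" for vs
    by (simp add: a'_def o_def bij_is_inj[OF L(2)] inv_f_f)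
  have kp: "kaehler_power y k (map L vs) = kaehler_power x k vs" for k vs
  proof (induction k arbitrary: vs)
    case 0
    then show ?case by (simp add: kaehler_power_0 unit_covector_def)
  next
    case (Suc k)
    have "fundamental_form J g y (map L vs) = fundamental_form J g x vs" for vs
      by (auto simp: fundamental_form_def L(3,4) split: list.split)
    then show ?case by (simp add: kaehler_power_Suc wedge_map Suc)
  qed
  obtain es where es: "orthonormal_frame g x es" by (rule orthonormal_frame_exists)
  have esL: "orthonormal_frame g y (map L es)"
    using es L(4) by (simp add: orthonormal_frame_def)
  have "covector_inner g y a' (\<beta> y) = covector_inner g x a (\<beta> x)"
    unfolding covector_inner_frame[OF es a \<beta>x] covector_inner_frame[OF esL a' \<beta>(1)]
    by (simp add: frame_inner_def nths_map a'L \<beta>(2))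
  moreover have "(a \<and>\<^sub>w (\<lambda>vs. hodge_star J g \<beta> y (map L vs))) vs = (a' \<and>\<^sub>w hodge_star J g \<beta> y) (map L vs)"
    by (simp add: wedge_map a'L)
  ultimately show "(a \<and>\<^sub>w (\<lambda>vs. hodge_star J g \<beta> y (map L vs))) vs =
      covector_inner g x a (\<beta> x) * volume_form J g x vs"
    using wedge_hodge_star[of \<beta> y, OF \<beta>(1) a', of "map L vs"] vs
    by (simp add: volume_form_kaehler_power kp)
qed

text \<open>The description by \<open>THE\<close> says nothing about dependence on the point. In a
  constant basis, however, the coefficients of the star are inner products with constant covectors
  times the volume form, and a smooth orthonormal frame makes the inner products smooth.\<close>

lemma hodge_star_smooth:
  assumes \<beta>: "\<And>x. \<beta> x \<in> alternating_multicovectors" "\<And>vs. smooth (\<lambda>x. \<beta> x vs)"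
  shows "smooth (\<lambda>x. hodge_star J g \<beta> x vs)"
proof -
  obtain E :: "'a list" where E: "set E = Basis" "distinct E"
    using finite_distinct_list[OF finite_Basis] by blast
  have len: "length E = DIM('a)" using E distinct_card by metis
  have "\<exists>a. a \<in> alternating_multicovectors \<and> (\<forall>S\<subseteq>{..<length E}. a (nths E S) = (if S = T then 1 else 0))" for T
    using alternating_extend[of E "\<lambda>S. if S = T then 1 else 0"] E independent_Basis by metis
  then obtain dual where dual: "\<And>T. dual T \<in> alternating_multicovectors"
    "\<And>S T. S \<subseteq> {..<length E} \<Longrightarrow> dual T (nths E S) = (if S = T then 1 else 0)" by metis
  obtain F where F: "length F = DIM('a)" "\<And>f. f \<in> set F \<Longrightarrow> smooth f"
    "\<And>x. orthonormal_frame g x (map (\<lambda>f. f x) F)" using smooth_orthonormal_frame by metis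
  have inner: "smooth (\<lambda>x. covector_inner g x a (\<beta> x))" if a: "a \<in> alternating_multicovectors" for a
  proof -
    have "smooth (\<lambda>x. a (map (\<lambda>f. f x) (nths F S)))" for S
      by (rule smooth_insert_fields[where \<beta> = "\<lambda>x. a"]) (use a F(2) in \<open>auto simp: smooth_const dest: in_set_nthsD\<close>)
    moreover have "smooth (\<lambda>x. \<beta> x (map (\<lambda>f. f x) (nths F S)))" for S
      by (rule smooth_insert_fields) (use \<beta> F(2) in \<open>auto dest: in_set_nthsD\<close>)
    ultimately show ?thesis
      unfolding covector_inner_frame[OF F(3) a \<beta>(1)] frame_inner_def nths_map length_map
      by (intro smooth_sum smooth_mult smooth_bounded_linear[OF bounded_linear_cnj])
  qed
  define coef where "coef = (\<lambda>T x. shuffle_sign (length E) ({..<length E} - T) *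
      (covector_inner g x (dual ({..<length E} - T)) (\<beta> x) * volume_form J g x E))"
  have coef: "hodge_star J g \<beta> x (nths E T) = coef T x" if T: "T \<subseteq> {..<length E}" for x T
  proof -
    let ?s = "shuffle_sign (length E) ({..<length E} - T)"
    have "(dual ({..<length E} - T) \<and>\<^sub>w hodge_star J g \<beta> x) E = ?s * hodge_star J g \<beta> x (nths E T)"
      by (rule wedge_basis_select[OF dual(2) T])
    then have "covector_inner g x (dual ({..<length E} - T)) (\<beta> x) * volume_form J g x E =
        ?s * hodge_star J g \<beta> x (nths E T)"
      using wedge_hodge_star[OF \<beta>(1) dual(1) len] by simp
    then show ?thesis
      unfolding coef_def by (simp add: shuffle_sign_sq flip: mult.assoc)
  qed
  have "hodge_star J g \<beta> x = (\<lambda>vs. \<Sum>T\<in>Pow {..<length E}. coef T x * dual T vs)" for x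
  proof (rule alternating_eqI[where E = E])
    show "hodge_star J g \<beta> x \<in> alternating_multicovectors" by (rule hodge_star_alternating[OF \<beta>(1)])
    show "(\<lambda>vs. \<Sum>T\<in>Pow {..<length E}. coef T x * dual T vs) \<in> alternating_multicovectors"
      by (intro sum_alternating scale_alternating dual)
    show "span (set E) = UNIV" by (simp add: E)
    fix S assume S: "S \<subseteq> {..<length E}"
    have "(\<Sum>T\<in>Pow {..<length E}. coef T x * dual T (nths E S)) =
        (\<Sum>T\<in>Pow {..<length E}. if S = T then coef T x else 0)"
      by (intro sum.cong refl) (simp add: dual(2)[OF S])
    then show "hodge_star J g \<beta> x (nths E S) = (\<Sum>T\<in>Pow {..<length E}. coef T x * dual T (nths E S))"
      using S by (simp add: coef)
  qed
  moreover have "smooth (coef T)" for T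
    unfolding coef_def by (intro smooth_mult smooth_const inner dual volume_form_smooth)
  ultimately show ?thesis
    by (simp only:) (intro smooth_sum smooth_mult smooth_const)
qed

end

section \<open>The operators del and delbar\<close>

lemma covector1_wedge_expand:
  "(covector1 \<theta> \<and>\<^sub>w b) vs =
    (\<Sum>i<length vs. (-1) ^ i * (\<theta> (vs ! i) * b (take i vs @ drop (Suc i) vs)))"
proof (induction vs arbitrary: b)
  case (Cons v vs)
  show ?case
    unfolding covector1_wedge_Cons Cons.IH length_Cons sum.lessThan_Suc_shift
    by (simp add: contract_def sum_negf)
qed (simp add: covector1_wedge_Nil)

definition dolbeault :: "complex \<Rightarrow> ('a::real_normed_vector \<Rightarrow> 'a) \<Rightarrow> 'a form \<Rightarrow> 'a form" where
  "dolbeault s J \<alpha> = (\<lambda>x vs. \<Sum>i<length vs. (-1) ^ i *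
      (let D = frechet_derivative (\<lambda>y. \<alpha> y (take i vs @ drop (Suc i) vs)) (at x)
       in (D (vs ! i) + s * D (J (vs ! i))) / 2))"

lemma del_dolbeault: "del = dolbeault (- \<i>)"
  by (simp add: fun_eq_iff del_def dolbeault_def Let_def)

lemma delbar_dolbeault: "delbar = dolbeault \<i>"
  by (simp add: fun_eq_iff delbar_def dolbeault_def)

text \<open>The (0,1)-part for \<open>s = \<i>\<close>, and the (1,0)-part for
  \<open>s = - \<i>\<close>, of the real covector pairing with \<open>b\<close>.\<close>

definition dolbeault_covector :: "complex \<Rightarrow> ('a::euclidean_space \<Rightarrow> 'a) \<Rightarrow> 'a \<Rightarrow> 'a \<Rightarrow> complex" where
  "dolbeault_covector s J b v = (of_real (v \<bullet> b) + s * of_real (J v \<bullet> b)) / 2"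

text \<open>The classical coordinate expression, a sum of constant covectors wedged with partial
  derivatives. It turns statements about del and delbar into pointwise wedge algebra.\<close>

lemma dolbeault_eq_wedge:
  fixes \<alpha> :: "'a::euclidean_space form"
  assumes "\<And>vs. smooth (\<lambda>x. \<alpha> x vs)"
  shows "dolbeault s J \<alpha> x vs = (\<Sum>b\<in>Basis. (covector1 (dolbeault_covector s J b) \<and>\<^sub>w
    (\<lambda>us. frechet_derivative (\<lambda>y. \<alpha> y us) (at x) b)) vs)"
proof -
  have eq: "(D v + s * D (J v)) / 2 = (\<Sum>b\<in>Basis. dolbeault_covector s J b v * D b)"
    if "linear D" for D :: "'a \<Rightarrow> complex" and v
  proof -
    have "D v + s * D (J v) = (\<Sum>b\<in>Basis. (v \<bullet> b) *\<^sub>R D b) + s * (\<Sum>b\<in>Basis. (J v \<bullet> b) *\<^sub>R D b)"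
      using linear_expand[OF that, of v] linear_expand[OF that, of "J v"] by simp
    then show ?thesis
      by (simp add: dolbeault_covector_def scaleR_conv_of_real sum_distrib_left sum_divide_distrib
          algebra_simps add_divide_distrib flip: sum.distrib)
  qed
  show ?thesis
    unfolding covector1_wedge_expand dolbeault_def Let_def
      eq[OF smooth_linear_frechet_derivative[OF assms]] sum_distrib_left
    by (rule sum.swap)
qed

lemma frechet_derivative_wedge:
  assumes "\<And>vs. smooth (\<lambda>x. \<alpha> x vs)"
  shows "frechet_derivative (\<lambda>y. (a \<and>\<^sub>w \<alpha> y) vs) (at x) v =
    (a \<and>\<^sub>w (\<lambda>us. frechet_derivative (\<lambda>y. \<alpha> y us) (at x) v)) vs"
proof -
  have "((\<lambda>y. (a \<and>\<^sub>w \<alpha> y) vs) has_derivative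
      (\<lambda>v. (a \<and>\<^sub>w (\<lambda>us. frechet_derivative (\<lambda>y. \<alpha> y us) (at x) v)) vs)) (at x)"
    unfolding wedge_def
    by (intro has_derivative_sum has_derivative_mult_right smooth_has_derivative assms)
  then show ?thesis by (simp add: frechet_derivativeI)
qed

lemma frechet_derivative_zero: "frechet_derivative (\<lambda>y. 0) (at x) v = 0"
  by (simp add: frechet_derivative_const)

lemma dolbeault_smooth:
  fixes \<alpha> :: "'a::euclidean_space form"
  assumes "\<And>vs. smooth (\<lambda>x. \<alpha> x vs)"
  shows "smooth (\<lambda>x. dolbeault s J \<alpha> x vs)"
  unfolding dolbeault_eq_wedge[OF assms]
  by (intro smooth_sum smooth_wedge smooth_const smooth_frechet_derivative assms)

lemma dolbeault_sum:
  assumes "\<And>k vs. k \<in> K \<Longrightarrow> smooth (\<lambda>x. \<alpha> k x vs)"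
  shows "dolbeault s J (\<lambda>x vs. \<Sum>k\<in>K. \<alpha> k x vs) = (\<lambda>x vs. \<Sum>k\<in>K. dolbeault s J (\<alpha> k) x vs)"
proof (intro ext)
  fix x vs
  have D: "frechet_derivative (\<lambda>y. \<Sum>k\<in>K. \<alpha> k y us) (at x) v =
      (\<Sum>k\<in>K. frechet_derivative (\<lambda>y. \<alpha> k y us) (at x) v)" for us v
    by (subst frechet_derivative_sum) (auto intro: smooth_differentiable assms)
  show "dolbeault s J (\<lambda>x vs. \<Sum>k\<in>K. \<alpha> k x vs) x vs = (\<Sum>k\<in>K. dolbeault s J (\<alpha> k) x vs)"
    unfolding dolbeault_def Let_def D
    by (subst sum.swap, intro sum.cong refl)
      (simp add: sum_distrib_left sum_divide_distrib add_divide_distrib sum.distrib algebra_simps)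
qed

text \<open>The covectors are constant, so their vanishing products with \<open>\<alpha>\<close> may
  be differentiated.\<close>

lemma dolbeault_eq_0:
  fixes \<alpha> :: "'a::euclidean_space form"
  assumes "\<And>vs. smooth (\<lambda>x. \<alpha> x vs)"
    and "\<And>x b. covector1 (dolbeault_covector s J b) \<and>\<^sub>w \<alpha> x = (\<lambda>vs. 0)"
  shows "dolbeault s J \<alpha> = (\<lambda>x vs. 0)"
  by (simp add: fun_eq_iff dolbeault_eq_wedge[OF assms(1)] assms(2) frechet_derivative_zero
      flip: frechet_derivative_wedge[OF assms(1)])

lemma dolbeault_zero: "dolbeault s J (\<lambda>x vs. 0) = (\<lambda>x vs. 0)"
  by (simp add: fun_eq_iff dolbeault_def frechet_derivative_zero)

text \<open>The hypothesis concerns the outer operator, whereas the inner one acts first.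
  Anticommutation brings the outer covector next to the derivatives of \<open>\<alpha>\<close>,
  where it gives zero. This is the situation of the star of a (0,q)-form under del delbar.\<close>

lemma dolbeault_dolbeault_eq_0:
  fixes \<alpha> :: "'a::euclidean_space form"
  assumes \<alpha>: "\<And>vs. smooth (\<lambda>x. \<alpha> x vs)"
    and 0: "\<And>x b. covector1 (dolbeault_covector s J b) \<and>\<^sub>w \<alpha> x = (\<lambda>vs. 0)"
  shows "dolbeault s J (dolbeault t J \<alpha>) = (\<lambda>x vs. 0)"
proof (rule dolbeault_eq_0)
  show "smooth (\<lambda>x. dolbeault t J \<alpha> x vs)" for vs by (rule dolbeault_smooth[OF \<alpha>])
  fix x b
  let ?\<theta> = "covector1 (dolbeault_covector s J b)"
  have "(?\<theta> \<and>\<^sub>w covector1 (dolbeault_covector t J c) \<and>\<^sub>w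
      (\<lambda>us. frechet_derivative (\<lambda>y. \<alpha> y us) (at x) c)) vs = 0" for c vs
  proof -
    have "?\<theta> \<and>\<^sub>w (\<lambda>us. frechet_derivative (\<lambda>y. \<alpha> y us) (at x) c) = (\<lambda>vs. 0)"
      by (simp add: fun_eq_iff 0 frechet_derivative_zero flip: frechet_derivative_wedge[OF \<alpha>])
    then show ?thesis
      by (subst covector1_wedge_anticommute) simp
  qed
  moreover have "dolbeault t J \<alpha> x = (\<lambda>vs. \<Sum>c\<in>Basis. (covector1 (dolbeault_covector t J c) \<and>\<^sub>w
      (\<lambda>us. frechet_derivative (\<lambda>y. \<alpha> y us) (at x) c)) vs)"
    by (rule ext) (rule dolbeault_eq_wedge[OF \<alpha>])
  ultimately show "?\<theta> \<and>\<^sub>w dolbeault t J \<alpha> x = (\<lambda>vs. 0)"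
    by (intro ext) (simp only: wedge_sum_right sum.neutral_const)
qed

context hermitian_structure
begin

lemma dolbeault_covector_linear: "linear (dolbeault_covector s J b)"
  by (rule linearI) (simp_all add: dolbeault_covector_def linear_add[OF linear_J]
      linear_scale[OF linear_J] inner_add_left scaleR_conv_of_real algebra_simps add_divide_distrib)

lemma dolbeault_covector_J:
  "dolbeault_covector \<i> J b (J v) = - \<i> * dolbeault_covector \<i> J b v"
  "dolbeault_covector (- \<i>) J b (J v) = \<i> * dolbeault_covector (- \<i>) J b v"
  by (simp_all add: dolbeault_covector_def J_J field_simps)

text \<open>
  The star of a (p,0)-form is a (d-p,d)-form, hence killed by delbar; the star of a (0,q)-form
  is killed by del.
\<close>

lemma del_delbar_hodge_star_eq_0:
  assumes alt: "\<And>x. \<beta> x \<in> alternating_multicovectors" and smooth: "\<And>vs. smooth (\<lambda>x. \<beta> x vs)"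
    and type: "(\<forall>x v vs. \<beta> x (J v # vs) = \<i> * \<beta> x (v # vs)) \<or>
      (\<forall>x v vs. \<beta> x (J v # vs) = - \<i> * \<beta> x (v # vs))"
  shows "del J (delbar J (hodge_star J g \<beta>)) = (\<lambda>x vs. 0)"
proof -
  have smooth': "smooth (\<lambda>x. hodge_star J g \<beta> x vs)" for vs
    by (rule hodge_star_smooth[OF alt smooth])
  from type show ?thesis
  proof
    assume type: "\<forall>x v vs. \<beta> x (J v # vs) = \<i> * \<beta> x (v # vs)"
    have "delbar J (hodge_star J g \<beta>) = (\<lambda>x vs. 0)"
      unfolding delbar_dolbeault
      by (rule dolbeault_eq_0[OF smooth'], rule covector1_wedge_hodge_star_eq_0[where K = J])
        (use type in \<open>auto simp: alt metric_J dolbeault_covector_linear dolbeault_covector_J\<close>)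
    then show ?thesis by (simp add: del_dolbeault dolbeault_zero)
  next
    assume type: "\<forall>x v vs. \<beta> x (J v # vs) = - \<i> * \<beta> x (v # vs)"
    have neg: "\<beta> x (- v # vs) = - \<beta> x (v # vs)" for x v vs
      using alternating_scaleR[OF alt[of x], of "[]" "-1" v vs] by simp
    have neg': "dolbeault_covector s J b (- v) = - dolbeault_covector s J b v" for s b v
      by (rule linear_neg[OF dolbeault_covector_linear])
    show ?thesis
      unfolding delbar_dolbeault del_dolbeault
      by (rule dolbeault_dolbeault_eq_0[OF smooth'],
          rule covector1_wedge_hodge_star_eq_0[where K = "\<lambda>v. - J v"])
        (use type in \<open>auto simp: alt metric_J metric_left metric_right neg neg' dolbeault_covector_linear
          dolbeault_covector_J\<close>)
  qed
qed

end

definition second_derivative :: "'a::real_normed_vector \<Rightarrow> 'a \<Rightarrow> ('a \<Rightarrow> complex) \<Rightarrow> 'a \<Rightarrow> complex" where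
  "second_derivative u v f = (\<lambda>x. frechet_derivative (\<lambda>y. frechet_derivative f (at y) v) (at x) u)"

lemma frechet_derivative_add:
  fixes f f' :: "'a::real_normed_vector \<Rightarrow> complex"
  assumes "smooth f" "smooth f'"
  shows "frechet_derivative (\<lambda>y. f y + f' y) (at x) v = frechet_derivative f (at x) v + frechet_derivative f' (at x) v"
  by (subst frechet_derivativeI[OF has_derivative_add[OF assms[THEN smooth_has_derivative]]]) simp

lemma frechet_derivative_diff:
  fixes f f' :: "'a::real_normed_vector \<Rightarrow> complex"
  assumes "smooth f" "smooth f'"
  shows "frechet_derivative (\<lambda>y. f y - f' y) (at x) v = frechet_derivative f (at x) v - frechet_derivative f' (at x) v"
  by (subst frechet_derivativeI[OF has_derivative_diff[OF assms[THEN smooth_has_derivative]]]) simp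

lemma frechet_derivative_mult_const:
  fixes f :: "'a::real_normed_vector \<Rightarrow> complex"
  assumes "smooth f"
  shows "frechet_derivative (\<lambda>y. c * f y) (at x) v = c * frechet_derivative f (at x) v"
  by (subst frechet_derivativeI[OF has_derivative_mult_right[OF smooth_has_derivative[OF assms]]]) simp

lemmas frechet_derivative_algebra =
  frechet_derivative_add frechet_derivative_diff frechet_derivative_mult_const

lemma second_derivative_algebra:
  "smooth f \<Longrightarrow> smooth f' \<Longrightarrow>
    second_derivative u v (\<lambda>y. f y + f' y) x = second_derivative u v f x + second_derivative u v f' x"
  "smooth f \<Longrightarrow> smooth f' \<Longrightarrow>
    second_derivative u v (\<lambda>y. f y - f' y) x = second_derivative u v f x - second_derivative u v f' x"
  "smooth f \<Longrightarrow> second_derivative u v (\<lambda>y. c * f y) x = c * second_derivative u v f x"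
  unfolding second_derivative_def
  by (simp_all add: frechet_derivative_algebra smooth_frechet_derivative)

lemma second_derivative_minus:
  assumes "smooth f"
  shows "second_derivative (- u) v f = (\<lambda>x. - second_derivative u v f x)"
    and "second_derivative u (- v) f = (\<lambda>x. - second_derivative u v f x)"
proof -
  show "second_derivative (- u) v f = (\<lambda>x. - second_derivative u v f x)"
    unfolding second_derivative_def
    by (simp add: linear_neg[OF smooth_linear_frechet_derivative[OF smooth_frechet_derivative[OF assms]]])
  have "frechet_derivative (\<lambda>y. - frechet_derivative f (at y) v) (at x) u =
      - frechet_derivative (\<lambda>y. frechet_derivative f (at y) v) (at x) u" for x
    using frechet_derivative_mult_const[OF smooth_frechet_derivative[OF assms], of "-1"]
    by simp
  then show "second_derivative u (- v) f = (\<lambda>x. - second_derivative u v f x)"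
    unfolding second_derivative_def
    by (simp add: linear_neg[OF smooth_linear_frechet_derivative[OF assms]])
qed

context hermitian_structure
begin

text \<open>An ordered pair of the four arguments is used for differentiation and the other two are
  inserted into the form: twelve terms, each with the sign of its permutation. The factor 4 clears
  the halves in \<open>del\<close> and \<open>delbar\<close>.\<close>

lemma del_delbar_2form:
  assumes "\<And>vs. smooth (\<lambda>x. \<Omega> x vs)"
  defines "P \<equiv> \<lambda>s u v f x. second_derivative u v f x + \<i> * second_derivative u (J v) f x
      + s * (second_derivative (J u) v f x + \<i> * second_derivative (J u) (J v) f x)"
    and "\<omega> \<equiv> \<lambda>u v y. \<Omega> y [u, v]"
  shows "4 * del J (delbar J \<Omega>) x [a, b, c, d] =
     P (- \<i>) a b (\<omega> c d) x - P (- \<i>) a c (\<omega> b d) x + P (- \<i>) a d (\<omega> b c) x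
    - P (- \<i>) b a (\<omega> c d) x + P (- \<i>) b c (\<omega> a d) x - P (- \<i>) b d (\<omega> a c) x
    + P (- \<i>) c a (\<omega> b d) x - P (- \<i>) c b (\<omega> a d) x + P (- \<i>) c d (\<omega> a b) x
    - P (- \<i>) d a (\<omega> b c) x + P (- \<i>) d b (\<omega> a c) x - P (- \<i>) d c (\<omega> a b) x"
proof -
  let ?D = "\<lambda>v f y. frechet_derivative f (at y) v"
  have delbar: "delbar J \<Omega> y [a, b, c] = 1/2 * (?D a (\<omega> b c) y + \<i> * ?D (J a) (\<omega> b c) y
      - (?D b (\<omega> a c) y + \<i> * ?D (J b) (\<omega> a c) y) + (?D c (\<omega> a b) y + \<i> * ?D (J c) (\<omega> a b) y))" for y a b c
    by (simp add: delbar_def Let_def \<omega>_def numeral_eq_Suc lessThan_Suc field_simps)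
  have sm: "smooth (\<omega> u v)" for u v unfolding \<omega>_def by (rule assms)
  have D: "?D u (\<lambda>y. delbar J \<Omega> y [a, b, c]) y = 1/2 * (
      second_derivative u a (\<omega> b c) y + \<i> * second_derivative u (J a) (\<omega> b c) y
      - (second_derivative u b (\<omega> a c) y + \<i> * second_derivative u (J b) (\<omega> a c) y)
      + (second_derivative u c (\<omega> a b) y + \<i> * second_derivative u (J c) (\<omega> a b) y))" for u a b c y
    unfolding delbar second_derivative_def
    by (simp only: frechet_derivative_algebra smooth_add smooth_diff smooth_mult
        smooth_const smooth_frechet_derivative sm)
  let ?\<Phi> = "\<lambda>a b c y. delbar J \<Omega> y [a, b, c]"
  have del: "del J (delbar J \<Omega>) x [a, b, c, d] = 1/2 *
      (?D a (?\<Phi> b c d) x - \<i> * ?D (J a) (?\<Phi> b c d) x - (?D b (?\<Phi> a c d) x - \<i> * ?D (J b) (?\<Phi> a c d) x)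
      + (?D c (?\<Phi> a b d) x - \<i> * ?D (J c) (?\<Phi> a b d) x) - (?D d (?\<Phi> a b c) x - \<i> * ?D (J d) (?\<Phi> a b c) x))"
    by (simp add: del_def Let_def numeral_eq_Suc lessThan_Suc field_simps)
  show ?thesis
    unfolding del D P_def by (simp add: algebra_simps)
qed

text \<open>The pure second derivative along \<open>X\<close> falls on the coefficient at
  \<open>[Z, J Z]\<close> only. Every other term has a derivative along \<open>J X\<close>,
  \<open>Z\<close> or \<open>J Z\<close>, which is what averaging in those directions can remove;
  the bound on \<open>G\<close> keeps these terms under control.\<close>

lemma del_delbar_2form_plane:
  fixes X Z :: 'a
  assumes smooth: "\<And>vs. smooth (\<lambda>x. \<Omega> x vs)"
    and zero: "\<And>x. del J (delbar J \<Omega>) x [X, J X, Z, J Z] = 0"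
  defines "e \<equiv> (!) [X, J X, Z, J Z]"
  obtains G :: "nat \<times> nat \<Rightarrow> 'a \<Rightarrow> complex" where
    "\<And>k. k \<in> {..<4} \<times> {..<4} \<Longrightarrow> smooth (G k)"
    "\<And>x. second_derivative (e 0) (e 0) (\<lambda>y. \<Omega> y [Z, J Z]) x =
      (\<Sum>k\<in>{..<4} \<times> {..<4} - {(0, 0)}. second_derivative (e (fst k)) (e (snd k)) (G k) x)"
    "\<And>k p C. k \<in> {..<4} \<times> {..<4} \<Longrightarrow> (\<And>i j. i < 4 \<Longrightarrow> j < 4 \<Longrightarrow> cmod (\<Omega> p [e i, e j]) \<le> C) \<Longrightarrow>
      cmod (G k p) \<le> 4 * C"
proof -
  define w where "w = (\<lambda>i j y. \<Omega> y [e i, e j])"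
  have sm: "smooth (w i j)" for i j unfolding w_def by (rule smooth)
  \<comment> \<open>Entry \<open>j\<close> of row \<open>i\<close> belongs to the derivative along
    \<open>e i\<close> of the derivative along \<open>e j\<close>. The outer operator differentiates
    along \<open>X\<close> and \<open>J X\<close> with weights 1 and \<open>- \<i>\<close>, and
    likewise along \<open>Z\<close> and \<open>J Z\<close>; the weights go into \<open>r\<close>, so
    two different rows suffice.\<close>
  define row where "row = (\<lambda>i::nat. if i < 2 then
    [\<lambda>y. - 2 * \<i> * w 2 3 y, \<lambda>y. 2 * w 2 3 y,
      \<lambda>y. \<i> * w 0 3 y - w 1 3 y - \<i> * w 1 2 y - w 0 2 y,
      \<lambda>y. w 1 2 y - \<i> * w 1 3 y - w 0 3 y - \<i> * w 0 2 y]
    else [\<lambda>y. w 1 3 y + \<i> * w 0 3 y - \<i> * w 1 2 y + w 0 2 y,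
      \<lambda>y. \<i> * w 1 3 y - w 0 3 y + w 1 2 y + \<i> * w 0 2 y,
      \<lambda>y. - 2 * \<i> * w 0 1 y, \<lambda>y. 2 * w 0 1 y])"
  define r where "r = (\<lambda>i::nat. if even i then 1 else - \<i>)"
  \<comment> \<open>The factor \<open>- \<i> / 2\<close> normalizes \<open>G (0, 0)\<close> to minus
    the coefficient at \<open>[Z, J Z]\<close>.\<close>
  define G where "G = (\<lambda>k y. - \<i> / 2 * r (fst k) * (row (fst k) ! snd k) y)"
  note smooths = smooth_add smooth_diff smooth_mult smooth_minus smooth_const sm
  have cases4: "i = 0 \<or> i = 1 \<or> i = 2 \<or> i = 3" if "i < 4" for i :: nat using that by auto
  have smG: "smooth (G k)" if k: "k \<in> {..<4} \<times> {..<4}" for k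
  proof -
    have "smooth (row (fst k) ! snd k)"
      using cases4[of "snd k"] k by (auto simp: row_def mem_Times_iff intro!: smooths)
    then show ?thesis unfolding G_def by (intro smooth_mult smooth_const)
  qed
  have bound: "cmod (G k p) \<le> 4 * C"
    if k: "k \<in> {..<4} \<times> {..<4}" and C: "\<And>i j. i < 4 \<Longrightarrow> j < 4 \<Longrightarrow> cmod (\<Omega> p [e i, e j]) \<le> C" for k p C
  proof -
    have w: "cmod (w i j p) \<le> C" if "i < 4" "j < 4" for i j using C[OF that] by (simp add: w_def)
    have C0: "C \<ge> 0" using w[of 0 0] norm_ge_zero[of "w 0 0 p"] by linarith
    have iw: "cmod (\<i> * w i j p) \<le> C" if "i < 4" "j < 4" for i j using w[OF that] by (simp add: norm_mult)
    have four: "cmod (a + b - c + d) \<le> 4 * C" "cmod (a - b + c + d) \<le> 4 * C" "cmod (a - b - c - d) \<le> 4 * C"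
      if "cmod a \<le> C" "cmod b \<le> C" "cmod c \<le> C" "cmod d \<le> C" for a b c d
      using that norm_triangle_ineq[of a b] norm_triangle_ineq4[of a b] norm_triangle_ineq4[of "a + b" c]
        norm_triangle_ineq[of "a - b" c] norm_triangle_ineq4[of "a - b" c]
        norm_triangle_ineq[of "a + b - c" d] norm_triangle_ineq[of "a - b + c" d]
        norm_triangle_ineq4[of "a - b - c" d]
      by linarith+
    have rows: "cmod ((row (fst k) ! snd k) p) \<le> 4 * C"
    proof -
      have "snd k = 0 \<or> snd k = 1 \<or> snd k = 2 \<or> snd k = 3" using cases4 k by auto
      then show ?thesis
        using w[of 2 3] w[of 0 1] C0
        by (auto simp: row_def norm_mult intro!: four w[simplified] iw[simplified])
    qed
    have "cmod (G k p) = cmod ((row (fst k) ! snd k) p) / 2"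
      by (simp add: G_def r_def norm_mult)
    then show ?thesis using rows C0 by linarith
  qed
  have e: "e 0 = X" "e 1 = J X" "e 2 = Z" "e 3 = J Z" by (simp_all add: e_def)
  have sum: "(\<Sum>k\<in>{..<4} \<times> {..<4}. second_derivative (e (fst k)) (e (snd k)) (G k) x) = 0" for x
  proof -
    have w': "(\<lambda>y. \<Omega> y [e i, e j]) = w i j" for i j by (simp add: w_def)
    have sd: "second_derivative u v (G (i, j)) x =
        - \<i> / 2 * r i * second_derivative u v (row i ! j) x" if "i < 4" "j < 4" for i j u v
    proof -
      have "smooth (row i ! j)"
        using cases4[OF that(2)] by (auto simp: row_def intro!: smooths)
      then show ?thesis unfolding G_def fst_conv snd_conv by (rule second_derivative_algebra(3))
    qed
    have "(\<Sum>k\<in>{..<4} \<times> {..<4}. second_derivative (e (fst k)) (e (snd k)) (G k) x) =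
        (\<Sum>i<4. \<Sum>j<4. - \<i> / 2 * r i * second_derivative (e i) (e j) (row i ! j) x)"
      unfolding sum.cartesian_product by (intro sum.cong refl) (auto simp: sd)
    \<comment> \<open>The twelve terms at \<open>X\<close>, \<open>J X\<close>, \<open>Z\<close>,
      \<open>J Z\<close> are expanded with \<open>J_J\<close> and collected by pairs of directions;
      this verifies the table \<open>row\<close>.\<close>
    also have "\<dots> = - \<i> / 2 * (4 * del J (delbar J \<Omega>) x [X, J X, Z, J Z])"
    proof -
      have sum4: "(\<Sum>i<4. h i) = h 0 + h 1 + h 2 + h 3" for h :: "nat \<Rightarrow> complex"
        by (simp add: numeral_eq_Suc lessThan_Suc)
      have r: "r 0 = 1" "r 1 = - \<i>" "r 2 = 1" "r 3 = - \<i>"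
        by (simp_all add: r_def)
      have rows: "row i ! 0 = (\<lambda>y. - 2 * \<i> * w 2 3 y)" "row i ! 1 = (\<lambda>y. 2 * w 2 3 y)"
        "row i ! 2 = (\<lambda>y. \<i> * w 0 3 y - w 1 3 y - \<i> * w 1 2 y - w 0 2 y)"
        "row i ! 3 = (\<lambda>y. w 1 2 y - \<i> * w 1 3 y - w 0 3 y - \<i> * w 0 2 y)" if "i < 2" for i
        using that by (simp_all add: row_def)
      have rows': "row i ! 0 = (\<lambda>y. w 1 3 y + \<i> * w 0 3 y - \<i> * w 1 2 y + w 0 2 y)"
        "row i ! 1 = (\<lambda>y. \<i> * w 1 3 y - w 0 3 y + w 1 2 y + \<i> * w 0 2 y)"
        "row i ! 2 = (\<lambda>y. - 2 * \<i> * w 0 1 y)" "row i ! 3 = (\<lambda>y. 2 * w 0 1 y)" if "\<not> i < 2" for i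
        using that by (simp_all add: row_def)
      have less: "(0::nat) < 2" "(1::nat) < 2" "\<not> (2::nat) < 2" "\<not> (3::nat) < 2" by simp_all
      show ?thesis
        unfolding del_delbar_2form[where \<Omega> = \<Omega> and x = x and a = X and b = "J X" and c = Z and d = "J Z", OF smooth]
          J_J w'[of 0 1, unfolded e] w'[of 0 2, unfolded e] w'[of 0 3, unfolded e]
          w'[of 1 2, unfolded e] w'[of 1 3, unfolded e] w'[of 2 3, unfolded e] second_derivative_minus[OF sm]
          sum4 r rows[OF less(1)] rows[OF less(2)] rows'[OF less(3)] rows'[OF less(4)]
        by (simp only: second_derivative_algebra smooths e) (simp add: algebra_simps)
    qed
    finally show ?thesis by (simp add: zero)
  qed
  have main: "second_derivative (e 0) (e 0) (\<lambda>y. \<Omega> y [Z, J Z]) x =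
      (\<Sum>k\<in>{..<4} \<times> {..<4} - {(0, 0)}. second_derivative (e (fst k)) (e (snd k)) (G k) x)" for x
  proof -
    have "G (0, 0) = (\<lambda>y. (-1) * w 2 3 y)"
      by (simp add: G_def row_def r_def fun_eq_iff)
    then have "second_derivative (e 0) (e 0) (G (0, 0)) x = - second_derivative (e 0) (e 0) (w 2 3) x"
      by (simp only: second_derivative_algebra(3)[OF sm]) simp
    moreover have "w 2 3 = (\<lambda>y. \<Omega> y [Z, J Z])" by (simp add: w_def e)
    ultimately show ?thesis
      using sum[of x] sum.remove[of "{..<4} \<times> {..<4}" "(0::nat, 0::nat)"
          "\<lambda>k. second_derivative (e (fst k)) (e (snd k)) (G k) x"] by simp
  qed
  show thesis by (rule that[OF smG main bound])
qed

end

section \<open>Averaging a second-order equation\<close>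

definition average :: "real \<Rightarrow> 'a::euclidean_space \<Rightarrow> ('a \<Rightarrow> complex) \<Rightarrow> 'a \<Rightarrow> complex" where
  "average R v f = (\<lambda>p. integral {0..R} (\<lambda>r. f (p + r *\<^sub>R v)) / of_real R)"

definition difference_quotient :: "real \<Rightarrow> 'a::euclidean_space \<Rightarrow> ('a \<Rightarrow> complex) \<Rightarrow> 'a \<Rightarrow> complex" where
  "difference_quotient R v f = (\<lambda>p. (f (p + R *\<^sub>R v) - f p) / of_real R)"

lemma continuous_on_line:
  fixes f :: "'a::euclidean_space \<Rightarrow> complex"
  shows "continuous_on UNIV f \<Longrightarrow> continuous_on S (\<lambda>r. f (p + r *\<^sub>R v))"
  by (rule continuous_on_compose2[of UNIV f]) (auto intro!: continuous_intros)

lemma integrable_on_line: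
  fixes f :: "'a::euclidean_space \<Rightarrow> complex"
  shows "continuous_on UNIV f \<Longrightarrow> (\<lambda>r. f (p + r *\<^sub>R v)) integrable_on {0..R}"
  by (intro integrable_continuous_real continuous_on_line)

lemma average_continuous:
  assumes "continuous_on UNIV f"
  shows "continuous_on UNIV (average R v f)"
proof -
  have "continuous_on (UNIV \<times> cbox 0 R) (\<lambda>(p, r). f (p + r *\<^sub>R v))"
    unfolding case_prod_beta
    by (rule continuous_on_compose2[OF assms]) (auto intro!: continuous_intros)
  then have "continuous_on UNIV (\<lambda>p. integral (cbox 0 R) (\<lambda>r. f (p + r *\<^sub>R v)))"
    by (rule integral_continuous_on_param)
  \<comment> \<open>For \<open>R = 0\<close> the division by zero makes the average constantly
    0.\<close>
  then show ?thesis
    unfolding average_def by (cases "R = 0") (auto intro!: continuous_intros)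
qed

lemma average_commute:
  assumes "continuous_on UNIV f"
  shows "average R v (average S w f) = average S w (average R v f)"
proof
  fix p
  have "continuous_on (cbox (0, 0) (R, S)) (\<lambda>(r, s). f (p + r *\<^sub>R v + s *\<^sub>R w))"
    unfolding case_prod_beta
    by (rule continuous_on_compose2[OF assms]) (auto intro!: continuous_intros)
  then have "integral (cbox 0 R) (\<lambda>r. integral (cbox 0 S) (\<lambda>s. f (p + r *\<^sub>R v + s *\<^sub>R w))) =
      integral (cbox 0 S) (\<lambda>s. integral (cbox 0 R) (\<lambda>r. f (p + r *\<^sub>R v + s *\<^sub>R w)))"
    by (rule integral_swap_continuous)
  also have "\<dots> = integral (cbox 0 S) (\<lambda>s. integral (cbox 0 R) (\<lambda>r. f (p + s *\<^sub>R w + r *\<^sub>R v)))"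
    by (intro arg_cong[where f = "integral _"] ext arg_cong[where f = f]) (simp add: algebra_simps)
  finally show "average R v (average S w f) p = average S w (average R v f) p"
    by (simp add: average_def mult.commute)
qed

text \<open>The fundamental theorem of calculus: averaging trades a derivative for a difference
  quotient, which is of order 1/R for bounded functions.\<close>

lemma average_derivative:
  assumes "smooth f" "R > 0"
  shows "average R v (\<lambda>x. frechet_derivative f (at x) v) = difference_quotient R v f"
proof
  fix p
  have "((\<lambda>r. frechet_derivative f (at (p + r *\<^sub>R v)) v) has_integral
      f (p + R *\<^sub>R v) - f (p + 0 *\<^sub>R v)) {0..R}"
  proof (rule fundamental_theorem_of_calculus)
    fix r :: real
    have "((\<lambda>r. p + r *\<^sub>R v) has_derivative (\<lambda>h. h *\<^sub>R v)) (at r)"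
      by (auto intro!: derivative_eq_intros)
    from has_derivative_compose[OF this smooth_has_derivative[OF assms(1)]]
    have "((\<lambda>r. f (p + r *\<^sub>R v)) has_derivative
        (\<lambda>h. frechet_derivative f (at (p + r *\<^sub>R v)) (h *\<^sub>R v))) (at r)" .
    then have "((\<lambda>r. f (p + r *\<^sub>R v)) has_vector_derivative
        frechet_derivative f (at (p + r *\<^sub>R v)) v) (at r)"
      unfolding has_vector_derivative_def
      by (simp add: linear_scale[OF smooth_linear_frechet_derivative[OF assms(1)]])
    then show "((\<lambda>r. f (p + r *\<^sub>R v)) has_vector_derivative
        frechet_derivative f (at (p + r *\<^sub>R v)) v) (at r within {0..R})"
      by (rule has_vector_derivative_at_within)
  qed (use assms in auto)
  then show "average R v (\<lambda>x. frechet_derivative f (at x) v) p = difference_quotient R v f p"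
    by (simp add: average_def difference_quotient_def integral_unique)
qed

lemma average_difference_quotient:
  assumes "continuous_on UNIV f"
  shows "average R v (difference_quotient S w f) = difference_quotient S w (average R v f)"
proof
  fix p
  have c: "(\<lambda>r. f (p + r *\<^sub>R v + S *\<^sub>R w)) integrable_on {0..R}"
    using integrable_on_line[OF assms, of "p + S *\<^sub>R w" v R] by (simp add: algebra_simps)
  have "integral {0..R} (\<lambda>r. (f (p + r *\<^sub>R v + S *\<^sub>R w) - f (p + r *\<^sub>R v)) / of_real S) =
      (integral {0..R} (\<lambda>r. f (p + r *\<^sub>R v + S *\<^sub>R w)) - integral {0..R} (\<lambda>r. f (p + r *\<^sub>R v))) / of_real S"
    using integral_diff[OF c integrable_on_line[OF assms, of p v R]]
    by simp
  moreover have "(\<lambda>r. f (p + S *\<^sub>R w + r *\<^sub>R v)) = (\<lambda>r. f (p + r *\<^sub>R v + S *\<^sub>R w))"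
    by (intro ext arg_cong[where f = f]) (simp add: algebra_simps)
  ultimately show "average R v (difference_quotient S w f) p = difference_quotient S w (average R v f) p"
    by (simp only: average_def difference_quotient_def) (simp add: diff_divide_distrib mult.commute)
qed

lemma average_sum:
  assumes "finite K" "\<And>k. k \<in> K \<Longrightarrow> continuous_on UNIV (f k)"
  shows "average R v (\<lambda>x. \<Sum>k\<in>K. f k x) = (\<lambda>x. \<Sum>k\<in>K. average R v (f k) x)"
  unfolding average_def
  by (subst integral_sum) (auto intro!: integrable_on_line assms simp: sum_divide_distrib)

lemma average_bound:
  assumes "continuous_on UNIV f" "R > 0" "\<And>r. 0 \<le> r \<Longrightarrow> r \<le> R \<Longrightarrow> cmod (f (p + r *\<^sub>R v)) \<le> C"
  shows "cmod (average R v f p) \<le> C"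
proof -
  have "norm (integral {0..R} (\<lambda>r. f (p + r *\<^sub>R v))) \<le> C * (R - 0)"
    using assms by (intro integral_bound continuous_on_line) auto
  then show ?thesis using assms(2) by (simp add: average_def norm_divide field_simps)
qed

lemma average_Re_ge:
  assumes "continuous_on UNIV f" "R > 0" "\<And>r. 0 \<le> r \<Longrightarrow> r \<le> R \<Longrightarrow> Re (f (p + r *\<^sub>R v)) \<ge> C"
  shows "Re (average R v f p) \<ge> C"
proof -
  have int: "(\<lambda>r. f (p + r *\<^sub>R v)) integrable_on {0..R}"
    by (rule integrable_on_line[OF assms(1)])
  have "integral {0..R} (\<lambda>r. C) \<le> integral {0..R} (\<lambda>r. Re (f (p + r *\<^sub>R v)))"
    using assms(3) integrable_linear[OF int bounded_linear_Re]
    by (intro integral_le) (auto simp: o_def)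
  also have "\<dots> = Re (integral {0..R} (\<lambda>r. f (p + r *\<^sub>R v)))"
    using integral_linear[OF int bounded_linear_Re] by (simp add: o_def)
  finally show ?thesis using assms(2) by (simp add: average_def field_simps)
qed

lemma difference_quotient_continuous:
  assumes "continuous_on UNIV f"
  shows "continuous_on UNIV (difference_quotient R v f)"
proof -
  have "continuous_on UNIV (\<lambda>p. f (p + R *\<^sub>R v))"
    by (rule continuous_on_compose2[OF assms]) (auto intro!: continuous_intros)
  then show ?thesis
    unfolding difference_quotient_def using assms by (cases "R = 0") (auto intro!: continuous_intros)
qed

section \<open>Iterated averages in several directions\<close>

context
  fixes R :: "nat \<Rightarrow> real" and e :: "nat \<Rightarrow> 'a::euclidean_space"
  assumes R_pos: "\<And>i. R i > 0"
begin

text \<open>The list is a word in the indices of directions. Averages of continuous functions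
  commute, so its order is immaterial for them, and a derivative along \<open>e i\<close> uses up
  one occurrence of \<open>i\<close>.\<close>

definition averages :: "nat list \<Rightarrow> ('a \<Rightarrow> complex) \<Rightarrow> 'a \<Rightarrow> complex" where
  "averages w f = foldr (\<lambda>i. average (R i) (e i)) w f"

lemma averages_Nil: "averages [] f = f"
  and averages_Cons: "averages (i # w) f = average (R i) (e i) (averages w f)"
  by (simp_all add: averages_def)

lemma averages_continuous: "continuous_on UNIV f \<Longrightarrow> continuous_on UNIV (averages w f)"
  by (induction w) (simp_all add: averages_Nil averages_Cons average_continuous)

lemma averages_move_last:
  "continuous_on UNIV f \<Longrightarrow> averages (i # w) f = averages w (average (R i) (e i) f)"
proof (induction w)
  case (Cons j w)
  then show ?case
    by (simp add: averages_Cons average_commute[OF averages_continuous, of f "R i"])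
qed (simp add: averages_Cons averages_Nil)

lemma averages_remove1:
  assumes "continuous_on UNIV f"
  shows "i \<in> set w \<Longrightarrow> averages w f = averages (remove1 i w) (average (R i) (e i) f)"
proof (induction w)
  case (Cons j w)
  show ?case
  proof (cases "i = j")
    case True
    then show ?thesis by (simp add: averages_move_last[OF assms])
  next
    case False
    then show ?thesis using Cons by (simp add: averages_Cons)
  qed
qed simp

lemma averages_sum:
  assumes "finite K" "\<And>k. k \<in> K \<Longrightarrow> continuous_on UNIV (f k)"
  shows "averages w (\<lambda>x. \<Sum>k\<in>K. f k x) = (\<lambda>x. \<Sum>k\<in>K. averages w (f k) x)"
  by (induction w)
    (simp_all add: averages_Nil averages_Cons average_sum[OF assms(1) averages_continuous[OF assms(2)]])

text \<open>Each derivative consumes an average in its own direction. For \<open>i = j\<close> this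
  takes two occurrences, which is why \<open>j\<close> is looked for after \<open>i\<close> has been
  removed.\<close>

lemma averages_second_derivative:
  assumes "smooth f" "i \<in> set w" "j \<in> set (remove1 i w)"
  shows "averages w (\<lambda>x. frechet_derivative (\<lambda>y. frechet_derivative f (at y) (e j)) (at x) (e i)) =
    averages (remove1 j (remove1 i w))
      (difference_quotient (R i) (e i) (difference_quotient (R j) (e j) f))"
proof -
  let ?f' = "\<lambda>y. frechet_derivative f (at y) (e j)"
  have s: "smooth ?f'" by (rule smooth_frechet_derivative[OF assms(1)])
  have "averages w (\<lambda>x. frechet_derivative ?f' (at x) (e i)) =
      averages (remove1 i w) (difference_quotient (R i) (e i) ?f')"
    unfolding averages_remove1[OF smooth_continuous[OF smooth_frechet_derivative[OF s]] assms(2)]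
      average_derivative[OF s R_pos] ..
  also have "\<dots> = averages (remove1 j (remove1 i w))
      (average (R j) (e j) (difference_quotient (R i) (e i) ?f'))"
    by (rule averages_remove1[OF difference_quotient_continuous[OF smooth_continuous[OF s]] assms(3)])
  also have "average (R j) (e j) (difference_quotient (R i) (e i) ?f') =
      difference_quotient (R i) (e i) (difference_quotient (R j) (e j) f)"
    unfolding average_difference_quotient[OF smooth_continuous[OF s]] average_derivative[OF assms(1) R_pos] ..
  finally show ?thesis .
qed

text \<open>The index of \<open>U\<close> counts steps along \<open>e 0\<close>, the only direction
  in which the available bounds are local; steps in all other directions leave it unchanged.\<close>

lemma averages_bound:
  assumes "continuous_on UNIV f"
    and U: "\<And>i n p r. p \<in> U n \<Longrightarrow> 0 \<le> r \<Longrightarrow> r \<le> R i \<Longrightarrow> p + r *\<^sub>R e i \<in> U (n + of_bool (i = 0))"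
    and "\<And>p. p \<in> U (n + count_list w 0) \<Longrightarrow> cmod (f p) \<le> C"
  shows "p \<in> U n \<Longrightarrow> cmod (averages w f p) \<le> C"
  using assms(3)
proof (induction w arbitrary: n p)
  case (Cons i w)
  have "cmod (averages w f (p + r *\<^sub>R e i)) \<le> C" if "0 \<le> r" "r \<le> R i" for r
  proof (rule Cons.IH[OF U[OF Cons.prems(1) that]])
    fix q assume "q \<in> U (n + of_bool (i = 0) + count_list w 0)"
    moreover have "n + of_bool (i = 0) + count_list w 0 = n + count_list (i # w) 0" by simp
    ultimately show "cmod (f q) \<le> C" using Cons.prems(2) by simp
  qed
  then show ?case
    unfolding averages_Cons by (intro average_bound averages_continuous assms(1) R_pos)
qed (simp add: averages_Nil)

lemma averages_Re_ge:
  assumes "continuous_on UNIV f"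
    and U: "\<And>i p r. i \<in> set w \<Longrightarrow> p \<in> U \<Longrightarrow> 0 \<le> r \<Longrightarrow> r \<le> R i \<Longrightarrow> p + r *\<^sub>R e i \<in> U"
    and "\<And>p. p \<in> U \<Longrightarrow> Re (f p) \<ge> C"
  shows "p \<in> U \<Longrightarrow> Re (averages w f p) \<ge> C"
  using U
proof (induction w arbitrary: p)
  case (Cons i w)
  have "Re (averages w f (p + r *\<^sub>R e i)) \<ge> C" if "0 \<le> r" "r \<le> R i" for r
    by (rule Cons.IH) (use Cons.prems that in auto)
  then show ?case
    unfolding averages_Cons by (intro average_Re_ge averages_continuous assms(1) R_pos)
qed (simp add: averages_Nil assms(3))

lemma difference_quotient_bound:
  assumes U: "\<And>i n p r. p \<in> U n \<Longrightarrow> 0 \<le> r \<Longrightarrow> r \<le> R i \<Longrightarrow> p + r *\<^sub>R e i \<in> U (n + of_bool (i = 0))"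
    and mono: "U n \<subseteq> U (n + of_bool (i = 0))"
    and f: "\<And>p. p \<in> U (n + of_bool (i = 0)) \<Longrightarrow> cmod (f p) \<le> C" and p: "p \<in> U n"
  shows "cmod (difference_quotient (R i) (e i) f p) \<le> 2 * C / R i"
proof -
  have "cmod (f (p + R i *\<^sub>R e i)) \<le> C" "cmod (f p) \<le> C"
    using U[OF p, of "R i" i] R_pos[of i] f mono p by auto
  then have "cmod (f (p + R i *\<^sub>R e i) - f p) \<le> 2 * C"
    using norm_triangle_ineq4[of "f (p + R i *\<^sub>R e i)" "f p"] by simp
  then show ?thesis
    using R_pos[of i] by (simp add: difference_quotient_def norm_divide divide_right_mono)
qed

end

text \<open>
  Averaging the differential equation over a box of size h in direction e 0 and size S in the
  other directions annihilates all terms on the right up to O(1/S), whereas the left-hand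
  side becomes the average of second differences of F.
\<close>

lemma averaged_second_difference_contradiction:
  fixes e :: "nat \<Rightarrow> 'a::euclidean_space" and F :: "'a \<Rightarrow> complex"
  assumes h: "h > 0" and K: "finite K"
    and F: "smooth F" and f: "\<And>k. k \<in> K \<Longrightarrow> smooth (f k)"
    and uv: "\<And>k. k \<in> K \<Longrightarrow> u k < 4 \<and> v k < 4 \<and> \<not> (u k = 0 \<and> v k = 0)"
    and pde: "\<And>x. frechet_derivative (\<lambda>y. frechet_derivative F (at y) (e 0)) (at x) (e 0) =
      (\<Sum>k\<in>K. frechet_derivative (\<lambda>y. frechet_derivative (f k) (at y) (e (v k))) (at x) (e (u k)))"
    and bound: "\<And>k s t x y. k \<in> K \<Longrightarrow> \<bar>s\<bar> \<le> h \<Longrightarrow>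
      cmod (f k (s *\<^sub>R e 0 + t *\<^sub>R e 1 + x *\<^sub>R e 2 + y *\<^sub>R e 3)) \<le> C"
    and \<delta>: "\<delta> > 0" "\<And>t x y. let q = t *\<^sub>R e 1 + x *\<^sub>R e 2 + y *\<^sub>R e 3
      in Re (F (h *\<^sub>R e 0 + q) - 2 * F q + F (- h *\<^sub>R e 0 + q)) \<ge> \<delta>"
  shows False
proof -
  define N where "N = real (card K) + 1"
  define C' where "C' = \<bar>C\<bar> + 1"
  \<comment> \<open>Chosen so that \<open>\<delta> * S\<close> exceeds
    \<open>4 * C' * N * h\<close>, against the final estimate. The summand \<open>h\<close> also
    gives \<open>S \<ge> h\<close>, so that \<open>h * S\<close> bounds \<open>R i * R j\<close>
    from below unless both indices are 0.\<close>
  define S where "S = h + 4 * C' * N * h / \<delta>"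
  define R where "R = (\<lambda>i::nat. if i = 0 then h else S)"
  \<comment> \<open>\<open>U n\<close> leaves room for \<open>n\<close> steps of length
    \<open>h\<close> from the face where the coordinate along \<open>e 0\<close> is
    \<open>- h\<close>: \<open>U 0\<close> is that face, and \<open>U 2\<close> is exactly the slab
    in which \<open>bound\<close> applies.\<close>
  define U where "U = (\<lambda>n::nat. {s *\<^sub>R e 0 + t *\<^sub>R e 1 + x *\<^sub>R e 2 + y *\<^sub>R e 3 | s t x y.
    - h \<le> s \<and> s \<le> (real n - 1) * h})"
  have C': "C' > 0" "C \<le> C'" and N: "N > 0" by (auto simp: C'_def N_def)
  have S: "S \<ge> h" "S > 0" using h C' N \<delta>(1) by (auto simp: S_def intro: add_pos_pos)
  have R: "R i > 0" for i using h S by (simp add: R_def)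
  \<comment> \<open>Indices from 4 on receive the zero direction, so that the step condition on
    \<open>U\<close> holds for every index.\<close>
  define dir where "dir = (\<lambda>i. if i < 4 then e i else 0)"
  have dir: "dir 0 = e 0" "\<And>i. i < 4 \<Longrightarrow> dir i = e i" by (simp_all add: dir_def)
  have U_step: "p + r *\<^sub>R dir i \<in> U (n + of_bool (i = 0))" if pU: "p \<in> U n" and r: "0 \<le> r" "r \<le> R i" for i n p r
  proof -
    obtain s t x y where p: "p = s *\<^sub>R e 0 + t *\<^sub>R e 1 + x *\<^sub>R e 2 + y *\<^sub>R e 3"
      "- h \<le> s" "s \<le> (real n - 1) * h" using pU by (auto simp: U_def)
    consider "i = 0" | "i = 1" | "i = 2" | "i = 3" | "i \<ge> 4" by linarith
    then show ?thesis
    proof cases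
      case 1
      have "p + r *\<^sub>R dir i = (s + r) *\<^sub>R e 0 + t *\<^sub>R e 1 + x *\<^sub>R e 2 + y *\<^sub>R e 3"
        by (simp add: p 1 dir algebra_simps)
      moreover have "s + r \<le> (real (n + 1) - 1) * h"
        using p(3) r(2) 1 by (simp add: R_def algebra_simps)
      ultimately show ?thesis using p(2) r(1) 1 unfolding U_def by fastforce
    next
      case 2
      have "p + r *\<^sub>R dir i = s *\<^sub>R e 0 + (t + r) *\<^sub>R e 1 + x *\<^sub>R e 2 + y *\<^sub>R e 3"
        by (simp add: p 2 dir algebra_simps)
      then show ?thesis using p 2 unfolding U_def by fastforce
    next
      case 3
      have "p + r *\<^sub>R dir i = s *\<^sub>R e 0 + t *\<^sub>R e 1 + (x + r) *\<^sub>R e 2 + y *\<^sub>R e 3"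
        by (simp add: p 3 dir algebra_simps)
      then show ?thesis using p 3 unfolding U_def by fastforce
    next
      case 4
      have "p + r *\<^sub>R dir i = s *\<^sub>R e 0 + t *\<^sub>R e 1 + x *\<^sub>R e 2 + (y + r) *\<^sub>R e 3"
        by (simp add: p 4 dir algebra_simps)
      then show ?thesis using p 4 unfolding U_def by fastforce
    next
      case 5
      then show ?thesis using pU by (simp add: dir_def)
    qed
  qed
  have U_mono: "U m \<subseteq> U n" if "m \<le> n" for m n
  proof -
    have "(real m - 1) * h \<le> (real n - 1) * h"
      using that h by (intro mult_right_mono) auto
    then show ?thesis unfolding U_def by fastforce
  qed
  \<comment> \<open>Two averages per direction suffice for every second derivative, mixed or
    pure.\<close>
  define Q where "Q = averages R dir [0, 0, 1, 1, 2, 2, 3, 3]"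
  \<comment> \<open>From this base point the second difference along \<open>e 0\<close> is centred
    at coordinate 0 and stays inside the slab.\<close>
  define p where "p = (- h) *\<^sub>R e 0"
  have p: "p \<in> U 0"
    unfolding U_def p_def by (rule CollectI, rule exI[of _ "- h"]) (auto intro!: exI[of _ 0])
  have idx: "i \<in> set [0, 0, 1, 1, 2, 2, 3, 3]" "j \<in> set (remove1 i [0, 0, 1, 1, 2, 2, 3, 3::nat])"
    if "i < 4" "j < 4" for i j :: nat
  proof -
    have "i = 0 \<or> i = 1 \<or> i = 2 \<or> i = 3" "j = 0 \<or> j = 1 \<or> j = 2 \<or> j = 3" using that by auto
    then show "i \<in> set [0, 0, 1, 1, 2, 2, 3, 3]" "j \<in> set (remove1 i [0, 0, 1, 1, 2, 2, 3, 3::nat])"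
      by auto
  qed
  let ?dd = "\<lambda>i j f x. frechet_derivative (\<lambda>y. frechet_derivative f (at y) (dir j)) (at x) (dir i)"
  have Q: "Q (?dd i j f) = averages R dir (remove1 j (remove1 i [0, 0, 1, 1, 2, 2, 3, 3]))
      (difference_quotient (R i) (dir i) (difference_quotient (R j) (dir j) f))"
    if "smooth f" "i < 4" "j < 4" for i j f
    unfolding Q_def by (rule averages_second_derivative[OF R that(1) idx[OF that(2,3)]])
  have small: "cmod (Q (?dd (u k) (v k) (f k)) p) \<le> 4 * C' / (h * S)" if k: "k \<in> K" for k
  proof -
    let ?i = "u k" and ?j = "v k"
    let ?w = "remove1 ?j (remove1 ?i [0, 0, 1, 1, 2, 2, 3, 3])"
    let ?b = "\<lambda>i. of_bool (i = 0) :: nat"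
    have ij: "?i < 4" "?j < 4" "\<not> (?i = 0 \<and> ?j = 0)" using uv[OF k] by auto
    \<comment> \<open>Steps along \<open>e 0\<close> come from an average or from a difference
      quotient, two in all, so \<open>f k\<close> is only evaluated in \<open>U 2\<close>.\<close>
    have cnt: "?b ?i + ?b ?j + count_list ?w 0 = 2"
      using ij by (auto simp: less_Suc_eq numeral_eq_Suc)
    have f_bound: "cmod (f k q) \<le> C'" if q: "q \<in> U 2" for q
    proof -
      obtain s t x y where "q = s *\<^sub>R e 0 + t *\<^sub>R e 1 + x *\<^sub>R e 2 + y *\<^sub>R e 3" "\<bar>s\<bar> \<le> h"
        using q by (force simp: U_def)
      then show ?thesis using bound[OF k, of s t x y] C'(2) by simp
    qed
    have d1: "cmod (difference_quotient (R ?j) (dir ?j) (f k) q) \<le> 2 * C' / R ?j"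
      if "q \<in> U (?b ?i + count_list ?w 0)" for q
      by (rule difference_quotient_bound[where U = U and n = "?b ?i + count_list ?w 0", OF R U_step])
        (use that cnt U_mono f_bound in \<open>auto simp: ac_simps\<close>)
    have d2: "cmod (difference_quotient (R ?i) (dir ?i) (difference_quotient (R ?j) (dir ?j) (f k)) q)
        \<le> 2 * (2 * C' / R ?j) / R ?i"
      if "q \<in> U (0 + count_list ?w 0)" for q
      by (rule difference_quotient_bound[where U = U and n = "count_list ?w 0", OF R U_step])
        (use that U_mono d1 in \<open>auto simp: ac_simps\<close>)
    have "cmod (Q (?dd ?i ?j (f k)) p) \<le> 2 * (2 * C' / R ?j) / R ?i"
      unfolding Q[OF f[OF k] ij(1,2)]
      by (rule averages_bound[where U = U, OF R _ U_step d2 p])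
        (intro difference_quotient_continuous smooth_continuous f k)
    also have "\<dots> = 4 * C' / (R ?i * R ?j)" by (simp add: field_simps)
    also have "\<dots> \<le> 4 * C' / (h * S)"
    proof -
      have "h * S \<le> R ?i * R ?j"
        using ij(3) S h by (auto simp: R_def mult.commute[of h S] intro!: mult_mono)
      then show ?thesis using C' h S R by (intro divide_left_mono mult_pos_pos) auto
    qed
    finally show ?thesis .
  qed
  \<comment> \<open>The two derivatives use up both averages along \<open>e 0\<close>. The remaining
    averages stay in \<open>U 0\<close>, where the second difference has real part at least
    \<open>\<delta>\<close>.\<close>
  have large: "Re (Q (?dd 0 0 F) p) \<ge> \<delta> / (h * h)"
  proof -
    have "Re (averages R dir [1, 1, 2, 2, 3, 3] (difference_quotient (R 0) (dir 0) (difference_quotient (R 0) (dir 0) F)) p) \<ge> \<delta> / (h * h)"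
    proof (rule averages_Re_ge[where U = "U 0", OF R _ _ _ p])
      show "continuous_on UNIV (difference_quotient (R 0) (dir 0) (difference_quotient (R 0) (dir 0) F))"
        by (intro difference_quotient_continuous smooth_continuous F)
      show "q + r *\<^sub>R dir i \<in> U 0" if "i \<in> set [1, 1, 2, 2, 3, 3]" "q \<in> U 0" "0 \<le> r" "r \<le> R i" for i q r
        using U_step[OF that(2-4)] that(1) by auto
      fix q assume "q \<in> U 0"
      then obtain t x y where q: "q = (- h) *\<^sub>R e 0 + t *\<^sub>R e 1 + x *\<^sub>R e 2 + y *\<^sub>R e 3"
        by (force simp: U_def)
      define q' where "q' = t *\<^sub>R e 1 + x *\<^sub>R e 2 + y *\<^sub>R e 3"
      have "difference_quotient (R 0) (dir 0) (difference_quotient (R 0) (dir 0) F) q =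
          (F (h *\<^sub>R e 0 + q') - 2 * F q' + F (- h *\<^sub>R e 0 + q')) / of_real (h * h)"
        using h by (simp add: difference_quotient_def dir R_def q q'_def field_simps)
      then show "Re (difference_quotient (R 0) (dir 0) (difference_quotient (R 0) (dir 0) F) q) \<ge> \<delta> / (h * h)"
        using \<delta>(2)[of t x y, unfolded Let_def, folded q'_def] h
        by (simp only: Re_divide_of_real) (intro divide_right_mono, auto)
    qed
    then show ?thesis unfolding Q[OF F, of 0 0, simplified] by simp
  qed
  have "?dd 0 0 F = (\<lambda>x. \<Sum>k\<in>K. ?dd (u k) (v k) (f k) x)"
    using pde uv by (auto simp: dir fun_eq_iff intro!: sum.cong)
  then have "Q (?dd 0 0 F) p = (\<Sum>k\<in>K. Q (?dd (u k) (v k) (f k)) p)"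
    unfolding Q_def
    by (simp only:) (subst averages_sum[OF R K], auto intro!: smooth_continuous smooth_frechet_derivative f)
  then have "Re (Q (?dd 0 0 F) p) \<le> cmod (\<Sum>k\<in>K. Q (?dd (u k) (v k) (f k)) p)"
    by (simp only: complex_Re_le_cmod)
  also have "\<dots> \<le> real (card K) * (4 * C' / (h * S))"
    by (rule sum_norm_bound[OF small])
  also have "\<dots> \<le> N * (4 * C' / (h * S))"
    using C' h S by (intro mult_right_mono) (auto simp: N_def)
  finally have "\<delta> / (h * h) \<le> N * (4 * C' / (h * S))" using large by simp
  then have "\<delta> * S \<le> 4 * C' * N * h"
    using h S by (simp add: field_simps)
  moreover have "\<delta> * S = \<delta> * h + 4 * C' * N * h"
    using \<delta>(1) by (simp add: S_def field_simps)
  moreover have "\<delta> * h > 0" using \<delta>(1) h by simp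
  ultimately show False by linarith
qed

section \<open>Covectors with constant coefficients\<close>

lemma pq_covectors_alternating: "a \<in> pq_covectors J p q \<Longrightarrow> a \<in> alternating_multicovectors"
proof (induction rule: pq_covectors.induct)
  case (wedge \<alpha>s \<beta>s)
  then show ?case
    by (intro wedge_list_alternating) (auto simp: covectors10_def covectors01_def)
qed (simp_all add: add_alternating scale_alternating)

lemma wedge_list_homogeneous: "homogeneous (length \<theta>s) (wedge_list \<theta>s)"
  by (simp add: homogeneous_def wedge_list_eq_0_if_length)

lemma length_nths_Compl: "length (nths vs S) + length (nths vs (- S)) = length vs"
proof -
  have "card {i. i < length vs \<and> i \<in> S} + card {i. i < length vs \<and> i \<notin> S} = card {..<length vs}"
  proof (subst card_Un_disjoint[symmetric])
    have "{i. i < length vs \<and> i \<in> S} \<union> {i. i < length vs \<and> i \<notin> S} = {..<length vs}" by auto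
    then show "card ({i. i < length vs \<and> i \<in> S} \<union> {i. i < length vs \<and> i \<notin> S}) = card {..<length vs}"
      by simp
  qed auto
  then show ?thesis by (simp add: length_nths)
qed

lemma wedge_homogeneous:
  assumes "homogeneous p a" "homogeneous q b"
  shows "homogeneous (p + q) (a \<and>\<^sub>w b)"
  unfolding homogeneous_def
proof (intro allI impI)
  fix vs :: "'a list" assume "length vs \<noteq> p + q"
  then have "a (nths vs S) = 0 \<or> b (nths vs (- S)) = 0" for S
    using assms length_nths_Compl[of vs S] unfolding homogeneous_def by metis
  then show "(a \<and>\<^sub>w b) vs = 0"
    unfolding wedge_def by (intro sum.neutral) auto
qed

lemma grade_involution_homogeneous:
  "homogeneous k a \<Longrightarrow> grade_involution a = (\<lambda>vs. (-1) ^ k * a vs)"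
  by (fastforce simp: homogeneous_def grade_involution_def)

lemma wedge_homogeneous_full:
  assumes "homogeneous (length vs) a"
  shows "(a \<and>\<^sub>w b) vs = a vs * b []"
proof -
  have "(a \<and>\<^sub>w b) vs = (\<Sum>S\<in>Pow {..<length vs}. if S = {..<length vs} then a vs * b [] else 0)"
    unfolding wedge_def
  proof (intro sum.cong refl)
    fix S assume S: "S \<in> Pow {..<length vs}"
    show "shuffle_sign (length vs) S * a (nths vs S) * b (nths vs (- S)) =
        (if S = {..<length vs} then a vs * b [] else 0)"
    proof (cases "S = {..<length vs}")
      case True
      have "length (nths vs {..<length vs}) + length (nths vs (- {..<length vs})) = length vs"
        by (rule length_nths_Compl)
      then have "nths vs (- {..<length vs}) = []" by simp
      then show ?thesis by (simp add: True shuffle_sign_def)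
    next
      case False
      then have "card S < card {..<length vs}" using S by (intro psubset_card_mono) auto
      then have "length (nths vs S) \<noteq> length vs" using S by (simp add: length_nths_subset)
      then show ?thesis using assms False by (simp add: homogeneous_def)
    qed
  qed
  then show ?thesis by simp
qed

text \<open>As \<open>u\<close> and \<open>v\<close> annihilate \<open>a\<close>, both go to
  \<open>c\<close>, and \<open>a\<close> has just the degree to absorb all the rest. This reads off
  one coefficient of a star from a product of top degree.\<close>

lemma wedge_contract2:
  assumes "contract u a = (\<lambda>vs. 0)" "contract v a = (\<lambda>vs. 0)" "homogeneous (length vs) a"
  shows "(a \<and>\<^sub>w c) (u # v # vs) = a vs * c [u, v]"
proof -
  have inv: "grade_involution (grade_involution a) = a"
    by (auto simp: grade_involution_def simp flip: power_add mult.assoc)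
  have "contract v (grade_involution a) = (\<lambda>vs. 0)"
    unfolding contract_grade_involution assms(2) by (simp add: grade_involution_def)
  then have "(a \<and>\<^sub>w c) (u # v # vs) = (a \<and>\<^sub>w contract v (contract u c)) vs"
    by (simp add: wedge_Cons assms(1) inv)
  also have "\<dots> = a vs * c [u, v]"
    using wedge_homogeneous_full[OF assms(3)] by (simp add: contract_def)
  finally show ?thesis .
qed

lemma wedge_list_map_linear:
  "wedge_list \<theta>s (map L vs) = wedge_list (map (\<lambda>\<theta> v. \<theta> (L v)) \<theta>s) vs"
proof (induction \<theta>s arbitrary: vs)
  case Nil
  then show ?case by (simp add: unit_covector_def)
next
  case (Cons \<theta> \<theta>s)
  have "covector1 \<theta> (map L us) = covector1 (\<lambda>v. \<theta> (L v)) us" for us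
    by (cases us; cases "tl us") (auto simp: covector1_def)
  then show ?case by (simp add: wedge_map Cons)
qed

lemma wedge_list_scale:
  "wedge_list (map (\<lambda>k v. c k * \<theta> k v) ks) vs = (\<Prod>k\<leftarrow>ks. c k) * wedge_list (map \<theta> ks) vs"
proof (induction ks arbitrary: vs)
  case (Cons k ks)
  have 1: "covector1 (\<lambda>v. c k * \<theta> k v) = (\<lambda>vs. c k * covector1 (\<theta> k) vs)"
    by (auto simp: covector1_def fun_eq_iff split: list.split)
  have 2: "wedge_list (map (\<lambda>k v. c k * \<theta> k v) ks) = (\<lambda>vs. (\<Prod>k\<leftarrow>ks. c k) * wedge_list (map \<theta> ks) vs)"
    using Cons by blast
  show ?case by (simp add: 1 2 wedge_scale_left wedge_scale_right)
qed simp

lemma wedge_list_type: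
  assumes "\<And>\<theta> v. \<theta> \<in> set \<theta>s \<Longrightarrow> \<theta> (J v) = c * \<theta> v"
  shows "contract (J v) (wedge_list \<theta>s) = (\<lambda>vs. c * contract v (wedge_list \<theta>s) vs)"
  using assms
proof (induction \<theta>s)
  case (Cons \<theta> \<theta>s)
  then have "contract (J v) (wedge_list \<theta>s) = (\<lambda>vs. c * contract v (wedge_list \<theta>s) vs)" by simp
  moreover have "\<theta> (J v) = c * \<theta> v" using Cons.prems by simp
  ultimately show ?case
    by (simp add: contract_covector1_wedge wedge_scale_right algebra_simps)
qed (simp add: contract_unit_covector)

lemma covector1_linear_combination_wedge:
  assumes "\<And>i. i \<in> I \<Longrightarrow> \<theta> i \<in> set \<theta>s"
  shows "covector1 (\<lambda>v. c * (\<Sum>i\<in>I. \<theta> i v)) \<and>\<^sub>w wedge_list \<theta>s = (\<lambda>vs. 0)"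
proof -
  have eq: "covector1 (\<lambda>v. c * (\<Sum>i\<in>I. \<theta> i v)) = (\<lambda>vs. c * (\<Sum>i\<in>I. covector1 (\<theta> i) vs))"
    by (auto simp: covector1_def fun_eq_iff split: list.split)
  show ?thesis
    unfolding eq using assms
    by (simp add: fun_eq_iff wedge_scale_left wedge_sum_left covector1_wedge_wedge_list)
qed

text \<open>The differential of exp(h) is exp(h) times \<open>h\<close>. Since \<open>h\<close> is
  an eigenvector of composition with \<open>J\<close>, its (1,0)- and (0,1)-parts are multiples of
  \<open>h\<close>, so both operators produce multiples of
  \<open>covector1 h \<and>\<^sub>w A\<close>.\<close>

lemma dolbeault_exp_eq_0:
  fixes A :: "'a::euclidean_space multicovector"
  assumes h: "bounded_linear h" "\<And>v. h (J v) = c * h v"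
    and A: "covector1 h \<and>\<^sub>w A = (\<lambda>vs. 0)"
  shows "dolbeault s J (\<lambda>x vs. exp (h x) * A vs) x vs = 0"
proof -
  have D: "frechet_derivative (\<lambda>y. exp (h y) * a) (at x) = (\<lambda>v. exp (h x) * h v * a)" for a
  proof (rule frechet_derivativeI)
    have "((\<lambda>x. exp (h x)) has_derivative (\<lambda>v. exp (h x) * h v)) (at x)"
      using DERIV_exp[of "h x"] unfolding has_field_derivative_def
      by (rule has_derivative_compose[OF bounded_linear_imp_has_derivative[OF h(1)]])
    from has_derivative_mult_left[OF this, of a]
    show "((\<lambda>y. exp (h y) * a) has_derivative (\<lambda>v. exp (h x) * h v * a)) (at x)" .
  qed
  have "dolbeault s J (\<lambda>x vs. exp (h x) * A vs) x vs = exp (h x) * (1 + s * c) / 2 *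
      (\<Sum>i<length vs. (-1) ^ i * (h (vs ! i) * A (take i vs @ drop (Suc i) vs)))"
    unfolding dolbeault_def Let_def D h(2) sum_distrib_left
    by (intro sum.cong refl) (simp add: field_simps)
  also have "\<dots> = exp (h x) * (1 + s * c) / 2 * (covector1 h \<and>\<^sub>w A) vs"
    by (simp add: covector1_wedge_expand)
  finally show ?thesis by (simp add: A)
qed

context hermitian_structure
begin

text \<open>Each pair contributes \<open>- 2 * \<i>\<close>, the value of dz wedge dzbar on
  \<open>u\<close>, \<open>J u\<close>, up to the sign from moving the conjugate covector past the
  other factors.\<close>

lemma wedge_list_cnj_J_pairs_nonzero:
  assumes "length \<theta>s = length us"
    and "\<And>\<theta> v. \<theta> \<in> set \<theta>s \<Longrightarrow> \<theta> (J v) = \<i> * \<theta> v"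
    and "\<And>i j. i < length us \<Longrightarrow> j < length us \<Longrightarrow> (\<theta>s ! i) (us ! j) = (if i = j then 1 else 0)"
  shows "(wedge_list \<theta>s \<and>\<^sub>w wedge_list (map (\<lambda>\<theta> v. cnj (\<theta> v)) \<theta>s)) (J_pairs us) \<noteq> 0"
  using assms
proof (induction \<theta>s us rule: list_induct2)
  case Nil
  then show ?case by (simp add: J_pairs_def wedge_Nil unit_covector_def)
next
  case (Cons \<theta> \<theta>s u us)
  define A where "A = wedge_list \<theta>s"
  define B where "B = wedge_list (map (\<lambda>\<theta> v. cnj (\<theta> v)) \<theta>s)"
  have IH: "(A \<and>\<^sub>w B) (J_pairs us) \<noteq> 0"
    unfolding A_def B_def
  proof (rule Cons.IH)
    show "(\<theta>s ! i) (us ! j) = (if i = j then 1 else 0)" if "i < length us" "j < length us" for i j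
      using Cons.prems(2)[of "Suc i" "Suc j"] that by simp
  qed (use Cons.prems in auto)
  have \<theta>: "\<theta> u = 1" "\<theta> (J u) = \<i>" using Cons.prems(2)[of 0 0] Cons.prems(1)[of \<theta> u] by simp_all
  have kill: "\<eta> u = 0" "\<eta> (J u) = 0" if \<eta>: "\<eta> \<in> set \<theta>s" for \<eta>
  proof -
    obtain j where "j < length \<theta>s" "\<eta> = \<theta>s ! j" using \<eta> by (auto simp: in_set_conv_nth)
    then show "\<eta> u = 0" using Cons.prems(2)[of "Suc j" 0] Cons.hyps by simp
    then show "\<eta> (J u) = 0" using Cons.prems(1)[of \<eta> u] \<eta> by simp
  qed
  have cA: "contract u A = (\<lambda>vs. 0)" "contract (J u) A = (\<lambda>vs. 0)"
    "contract u B = (\<lambda>vs. 0)" "contract (J u) B = (\<lambda>vs. 0)"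
    unfolding A_def B_def using kill by (auto intro!: contract_wedge_list_eq_0)
  have inv: "grade_involution A = (\<lambda>vs. (-1) ^ length \<theta>s * A vs)"
    unfolding A_def by (rule grade_involution_homogeneous[OF wedge_list_homogeneous])
  let ?A = "covector1 \<theta> \<and>\<^sub>w A" and ?B = "covector1 (\<lambda>v. cnj (\<theta> v)) \<and>\<^sub>w B"
  have c: "contract u ?A = A" "contract (J u) ?A = (\<lambda>vs. \<i> * A vs)"
    "contract u ?B = B" "contract (J u) ?B = (\<lambda>vs. - \<i> * B vs)"
    by (simp_all add: contract_covector1_wedge cA \<theta>)
  have gi: "grade_involution (\<lambda>vs. \<i> * A vs) = (\<lambda>vs. \<i> * grade_involution A vs)"
    by (simp add: grade_involution_def algebra_simps)
  have "(?A \<and>\<^sub>w ?B) (u # J u # J_pairs us) = - 2 * \<i> * (grade_involution A \<and>\<^sub>w B) (J_pairs us)"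
    by (simp add: wedge_Cons c cA contract_grade_involution gi wedge_scale_left wedge_scale_right
        wedge_minus_left wedge_minus_right)
  also have "\<dots> = - 2 * \<i> * ((-1) ^ length \<theta>s * (A \<and>\<^sub>w B) (J_pairs us))"
    unfolding inv wedge_scale_left ..
  finally have "(?A \<and>\<^sub>w ?B) (u # J u # J_pairs us) \<noteq> 0" using IH by simp
  then show ?case by (simp add: A_def B_def J_pairs_def)
qed

lemma covector_inner_self_pos:
  assumes "a \<in> alternating_multicovectors" "a vs \<noteq> 0"
  obtains r where "r > 0" "covector_inner g x a a = of_real r"
proof -
  obtain es where es: "orthonormal_frame g x es" by (rule orthonormal_frame_exists)
  let ?r = "\<Sum>S\<in>Pow {..<length es}. (cmod (a (nths es S)))\<^sup>2"
  have "\<exists>S\<subseteq>{..<length es}. a (nths es S) \<noteq> 0"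
  proof (rule ccontr)
    assume neg: "\<not> ?thesis"
    have "a vs = 0"
      by (rule alternating_eq_0_span[OF assms(1), of es])
        (use neg in \<open>auto simp: orthonormal_frame_span[OF es]\<close>)
    with assms(2) show False by simp
  qed
  then obtain S where S: "S \<subseteq> {..<length es}" "a (nths es S) \<noteq> 0" by auto
  then have "?r > 0"
    by (intro sum_pos2[of _ S]) auto
  moreover have "covector_inner g x a a = of_real ?r"
    by (simp add: covector_inner_frame[OF es assms(1) assms(1)] frame_inner_def
        complex_norm_square del: of_real_power)
  ultimately show thesis by (rule that)
qed

end

section \<open>Deck transformations of the solvmanifold\<close>

lemma hermitian_metric_imp_structure:
  fixes g :: "('n::finite, 'm::finite) cover metric"
  assumes "hermitian_metric J_N T g"
  shows "hermitian_structure J_N g"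
proof (rule hermitian_structure.intro)
  show "linear (J_N :: ('n, 'm) cover \<Rightarrow> _)"
    by (rule linearI) (simp_all add: J_N_def vec_eq_iff algebra_simps)
  show "J_N (J_N v) = - v" for v :: "('n, 'm) cover"
    by (simp add: J_N_def prod_eq_iff vec_eq_iff)
qed (use assms in \<open>auto simp: hermitian_metric_def\<close>)

definition coordinate :: "('n::finite \<times> bool) + ('m::finite \<times> bool) \<Rightarrow> ('n, 'm) cover \<Rightarrow> complex" where
  "coordinate k v = (case k of Inl i \<Rightarrow> fst v $ i | Inr i \<Rightarrow> snd v $ i)"

definition coordinate_axis :: "('n::finite \<times> bool) + ('m::finite \<times> bool) \<Rightarrow> ('n, 'm) cover" where
  "coordinate_axis k = (case k of Inl i \<Rightarrow> (axis i 1, 0) | Inr i \<Rightarrow> (0, axis i 1))"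

lemma coordinate_axis: "coordinate k (coordinate_axis k') = (if k = k' then 1 else 0)"
  by (auto simp: coordinate_def coordinate_axis_def axis_def split: sum.split)

lemma coordinate_J: "coordinate k (J_N v) = \<i> * coordinate k v"
  by (simp add: coordinate_def J_N_def split: sum.split)

lemma coordinate_linear: "linear (coordinate k)"
  by (rule linearI) (simp_all add: coordinate_def split: sum.split)

lemma cover_eqI: "(\<And>k. coordinate k u = coordinate k v) \<Longrightarrow> u = v"
  by (simp add: prod_eq_iff vec_eq_iff coordinate_def) (metis sum.case)

lemma DIM_cover: "DIM(('n::finite, 'm::finite) cover) div 2 = CARD(('n \<times> bool) + ('m \<times> bool))"
  by simp

text \<open>The function h of the overview: \<open>phi\<close> with its conjugations dropped, hence
  complex linear.\<close>

definition holomorphic_phi :: "real \<Rightarrow> ('n::finite, 'm::finite) cover \<Rightarrow> complex" where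
  "holomorphic_phi l x = of_real l * (\<Sum>i\<in>UNIV. fst x $ i)"

lemma bounded_linear_holomorphic_phi: "bounded_linear (holomorphic_phi l)"
  unfolding linear_conv_bounded_linear[symmetric]
  by (rule linearI)
    (simp_all add: holomorphic_phi_def sum.distrib distrib_left flip: scaleR_sum_right)

lemma holomorphic_phi_J: "holomorphic_phi l (J_N v) = \<i> * holomorphic_phi l v"
  by (simp add: holomorphic_phi_def J_N_def mult.left_commute flip: sum_distrib_left)

text \<open>The linear part of the affine map \<open>semidirect_mult l a\<close>, and so its
  derivative at every point.\<close>

definition deck_derivative :: "real \<Rightarrow> ('n::finite, 'm::finite) cover \<Rightarrow> ('n, 'm) cover \<Rightarrow> ('n, 'm) cover" where
  "deck_derivative l a v = (fst v, rho l (fst a) *v snd v)"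

lemma rho_mult: "(rho l w *v z) $ i = (if snd i then exp (- cnj (phi l w)) else exp (phi l w)) * z $ i"
proof -
  have "(rho l w *v z) $ i =
      (\<Sum>j\<in>UNIV. if i = j then (if snd i then exp (- cnj (phi l w)) else exp (phi l w)) * z $ j else 0)"
    unfolding matrix_vector_mult_def rho_def vec_lambda_beta by (intro sum.cong refl) simp
  then show ?thesis by simp
qed

lemma deck_derivative_linear: "linear (deck_derivative l a)"
  by (rule linearI)
    (simp_all add: deck_derivative_def vec_eq_iff rho_mult prod_eq_iff algebra_simps)

lemma semidirect_mult_eq: "semidirect_mult l a x = a + deck_derivative l a x"
  by (simp add: semidirect_mult_def deck_derivative_def prod_eq_iff)

lemma frechet_derivative_semidirect_mult:
  "frechet_derivative (semidirect_mult l a) (at x) = deck_derivative l a"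
proof (rule frechet_derivativeI)
  have "bounded_linear (deck_derivative l a)"
    using deck_derivative_linear by (simp add: linear_conv_bounded_linear)
  then have "((\<lambda>x. a + deck_derivative l a x) has_derivative deck_derivative l a) (at x)"
    by (auto intro!: derivative_eq_intros bounded_linear_imp_has_derivative)
  then show "(semidirect_mult l a has_derivative deck_derivative l a) (at x)"
    by (simp add: semidirect_mult_eq[abs_def])
qed

text \<open>The parameter \<open>r\<close> stands for the real value of \<open>exp (phi l w)\<close>
  at a lattice point.\<close>

definition multiplier :: "real \<Rightarrow> ('n::finite \<times> bool) + ('m::finite \<times> bool) \<Rightarrow> real" where
  "multiplier r k = (case k of Inl i \<Rightarrow> 1 | Inr i \<Rightarrow> if snd i then 1 / r else r)"

lemma sum_bool_pairs: "(\<Sum>i\<in>UNIV. f i) = (\<Sum>j\<in>UNIV. f (j, False) + f (j, True))"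
  for f :: "'n::finite \<times> bool \<Rightarrow> 'a::comm_monoid_add"
proof -
  have "(\<Sum>i\<in>UNIV. f i) = (\<Sum>j\<in>UNIV. \<Sum>b\<in>UNIV. f (j, b))"
    unfolding UNIV_Times_UNIV[symmetric] by (simp only: sum.cartesian_product case_prod_eta)
  then show ?thesis by (simp add: UNIV_bool)
qed

text \<open>
  On the lattice, phi and its holomorphic counterpart differ by an element of 2 pi i Z from the
  same real number, so both have the same real multiplier.
\<close>

lemma lattice_w_exp:
  fixes w :: "complex ^ ('n::finite \<times> bool)"
  assumes "l \<noteq> 0" and w: "w = (\<chi> i. of_int (a $ i) + \<i> * of_real (mu l k $ i) * of_int (b $ i))"
  defines "r \<equiv> exp (l * of_int (\<Sum>i\<in>UNIV. a $ i))"
  shows "exp (phi l w) = of_real r" "exp (- cnj (phi l w)) = of_real (1 / r)"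
    "exp (of_real l * (\<Sum>i\<in>UNIV. w $ i)) = of_real r"
proof -
  \<comment> \<open>The scaling of the imaginary lattice by \<open>mu\<close> turns the imaginary
    part into an integral multiple of 2 pi.\<close>
  have lw: "of_real l * w $ i = of_real (l * of_int (a $ i)) + 2 * of_int (k $ i * b $ i) * of_real pi * \<i>" for i
    using assms(1) by (simp add: w mu_def field_simps)
  have lw': "of_real l * cnj (w $ i) = of_real (l * of_int (a $ i)) + 2 * of_int (- (k $ i * b $ i)) * of_real pi * \<i>" for i
    using arg_cong[OF lw[of i], of cnj] by simp
  \<comment> \<open>Conjugation reverses the integer at the even indices; the exponential only sees
    that it is an integer.\<close>
  define c where "c = (\<lambda>i::'n \<times> bool. if snd i then - (k $ i * b $ i) else k $ i * b $ i)"
  have "phi l w = (\<Sum>j\<in>UNIV. of_real l * w $ (j, False) + of_real l * cnj (w $ (j, True)))"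
    by (simp add: phi_def sum_distrib_left distrib_left)
  also have "\<dots> = (\<Sum>i\<in>UNIV. of_real (l * of_int (a $ i)) + 2 * of_int (c i) * of_real pi * \<i>)"
    unfolding lw lw' sum_bool_pairs by (simp add: c_def)
  also have "\<dots> = of_real (l * of_int (\<Sum>i\<in>UNIV. a $ i)) + 2 * of_int (\<Sum>i\<in>UNIV. c i) * of_real pi * \<i>"
    by (simp add: sum.distrib sum_distrib_left sum_distrib_right)
  finally have phi: "phi l w = of_real (l * of_int (\<Sum>i\<in>UNIV. a $ i)) + 2 * of_int (\<Sum>i\<in>UNIV. c i) * of_real pi * \<i>" .
  have per: "exp (of_real x + 2 * of_int n * of_real pi * \<i>) = of_real (exp x)" for x n
    using exp_integer_2pi[of "of_int n"] by (simp add: exp_add exp_of_real)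
  show 1: "exp (phi l w) = of_real r"
    unfolding phi per r_def ..
  have "exp (- cnj (phi l w)) = inverse (cnj (exp (phi l w)))"
    by (simp add: exp_minus exp_cnj)
  then show "exp (- cnj (phi l w)) = of_real (1 / r)"
    unfolding 1 by (simp add: field_simps)
  have "of_real l * (\<Sum>i\<in>UNIV. w $ i) =
      of_real (l * of_int (\<Sum>i\<in>UNIV. a $ i)) + 2 * of_int (\<Sum>i\<in>UNIV. k $ i * b $ i) * of_real pi * \<i>"
    unfolding sum_distrib_left lw by (simp add: sum.distrib sum_distrib_left sum_distrib_right)
  then show "exp (of_real l * (\<Sum>i\<in>UNIV. w $ i)) = of_real r"
    unfolding r_def by (simp only: per)
qed

lemma Gamma_multiplier:
  fixes a :: "('n::finite, 'm::finite) cover"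
  assumes "l \<noteq> 0" "a \<in> Gamma l k P"
  obtains r where "r > 0" "exp (holomorphic_phi l a) = of_real r"
    "\<And>k v. coordinate k (deck_derivative l a v) = of_real (multiplier r k) * coordinate k v"
proof -
  obtain c b where w: "fst a = (\<chi> i. of_int (c $ i) + \<i> * of_real (mu l k $ i) * of_int (b $ i))"
    using assms(2) by (auto simp: Gamma_def lattice_w_def)
  note e = lattice_w_exp[OF assms(1) w]
  show thesis
  proof (rule that)
    show "exp (l * of_int (\<Sum>i\<in>UNIV. c $ i)) > 0" by simp
    show "exp (holomorphic_phi l a) = of_real (exp (l * of_int (\<Sum>i\<in>UNIV. c $ i)))"
      unfolding holomorphic_phi_def by (rule e(3))
    show "coordinate k (deck_derivative l a v) =
        of_real (multiplier (exp (l * of_int (\<Sum>i\<in>UNIV. c $ i))) k) * coordinate k v" for k v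
      by (cases k) (simp_all only: coordinate_def multiplier_def deck_derivative_def fst_conv snd_conv
          sum.case rho_mult e if_distrib[where f = of_real] of_real_1 mult_1_left)
  qed
qed

text \<open>The multipliers cancel in pairs \<open>r\<close>, \<open>1 / r\<close>, so omitting one
  odd coordinate leaves the reciprocal of its multiplier.\<close>

lemma prod_multiplier:
  assumes "r > 0"
  shows "(\<Prod>k\<in>UNIV - {Inr (j, False)}. multiplier r (k :: ('n::finite \<times> bool) + ('m::finite \<times> bool))) = 1 / r"
proof -
  have "(\<Prod>k\<in>UNIV. multiplier r (k :: ('n \<times> bool) + ('m \<times> bool))) =
      (\<Prod>i\<in>UNIV. multiplier r (Inr i :: ('n \<times> bool) + ('m \<times> bool)))"
    unfolding UNIV_Plus_UNIV[symmetric] by (subst prod.Plus) (simp_all add: o_def multiplier_def)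
  also have "\<dots> = (\<Prod>(j, b)\<in>UNIV \<times> UNIV. multiplier r (Inr (j, b) :: ('n \<times> bool) + ('m \<times> bool)))"
    by simp
  also have "\<dots> = (\<Prod>j\<in>UNIV. \<Prod>b\<in>UNIV. multiplier r (Inr (j, b) :: ('n \<times> bool) + ('m \<times> bool)))"
    by (simp only: prod.cartesian_product)
  also have "\<dots> = 1"
    using assms by (simp add: UNIV_bool multiplier_def)
  finally have "multiplier r (Inr (j, False) :: ('n \<times> bool) + ('m \<times> bool)) *
      (\<Prod>k\<in>UNIV - {Inr (j, False)}. multiplier r (k :: ('n \<times> bool) + ('m \<times> bool))) = 1"
    by (subst (asm) prod.remove[of UNIV "Inr (j, False)"]) auto
  then show ?thesis using assms by (simp add: multiplier_def field_simps)
qed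

text \<open>The covectors \<open>\<theta> k\<close> are kept general so that the coordinates and
  their conjugates are treated alike.\<close>

lemma coordinate_wedge_multiplier:
  fixes others :: "(('n::finite \<times> bool) + ('m::finite \<times> bool)) list"
  assumes "r > 0" "distinct others" "set others = UNIV - {Inr (j, False)}"
    and L: "\<And>k v. k \<in> set others \<Longrightarrow> \<theta> k (L v) = of_real (multiplier r k) * \<theta> k v"
  shows "wedge_list (map \<theta> others) (map L vs) = of_real (1 / r) * wedge_list (map \<theta> others) vs"
proof -
  have "map ((\<lambda>\<theta> v. \<theta> (L v)) \<circ> \<theta>) others = map (\<lambda>k v. of_real (multiplier r k) * \<theta> k v) others"
    using L by (intro map_cong refl) (simp add: fun_eq_iff)
  then have "wedge_list (map \<theta> others) (map L vs) =
      (\<Prod>k\<leftarrow>others. complex_of_real (multiplier r k)) * wedge_list (map \<theta> others) vs"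
    unfolding wedge_list_map_linear map_map by (simp only: wedge_list_scale)
  also have "(\<Prod>k\<leftarrow>others. complex_of_real (multiplier r k)) = of_real (\<Prod>k\<in>set others. multiplier r k)"
    unfolding prod.distinct_set_conv_list[OF assms(2), symmetric] of_real_prod ..
  finally show ?thesis unfolding assms(3) prod_multiplier[OF assms(1)] .
qed

section \<open>Compactness and Bott-Chern harmonic forms\<close>

lemma norm_le_sum_components: "norm x \<le> (\<Sum>i\<in>UNIV. norm (x $ i))"
  unfolding norm_vec_def by (rule L2_set_le_sum) simp

lemma norm_axis_le: "norm (axis i c) \<le> norm c"
  for c :: "'a::real_normed_vector"
proof -
  have "(\<Sum>j\<in>UNIV. norm (axis i c $ j)) = (\<Sum>j\<in>UNIV. if j = i then norm c else 0)"
    by (intro sum.cong refl) (simp add: axis_def)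
  then show ?thesis using norm_le_sum_components[of "axis i c"] by simp
qed

text \<open>Rounding the coordinates of \<open>x\<close> with respect to the columns of
  \<open>P\<close> leaves fractional parts, and \<open>P\<close> maps these into a bounded
  set.\<close>

lemma real_lattice_reduction:
  fixes P :: "real ^ 'i::finite ^ 'i"
  assumes "invertible P"
  shows "\<exists>B. \<forall>x. \<exists>a :: int ^ 'i. \<forall>i. \<bar>(P *v (\<chi> j. of_int (a $ j))) $ i + x $ i\<bar> \<le> B"
proof -
  obtain Q where Q: "P ** Q = mat 1" using assms by (auto simp: invertible_def)
  obtain B where B: "\<And>v. norm (P *v v) \<le> norm v * B" "B > 0"
    using bounded_linear.pos_bounded[OF matrix_vector_mul_bounded_linear, of P] by auto
  have "\<exists>a :: int ^ 'i. \<forall>i. \<bar>(P *v (\<chi> j. of_int (a $ j))) $ i + x $ i\<bar> \<le> real CARD('i) * B" for x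
  proof -
    define a :: "int ^ 'i" where "a = (\<chi> i. - \<lfloor>(Q *v x) $ i\<rfloor>)"
    define y where "y = (\<chi> j. of_int (a $ j)) + Q *v x"
    have "P *v (Q *v x) = x" by (simp add: matrix_vector_mul_assoc Q)
    then have y: "P *v (\<chi> j. of_int (a $ j)) + x = P *v y"
      by (simp add: y_def matrix_vector_right_distrib)
    have "norm (y $ i) \<le> 1" for i
      unfolding y_def a_def by simp linarith
    then have "norm y \<le> real CARD('i)"
      using norm_le_sum_components[of y] sum_bounded_above[of UNIV "\<lambda>i. norm (y $ i)" 1] by simp
    then have "norm (P *v y) \<le> real CARD('i) * B"
      using B(1)[of y] B(2) mult_right_mono[of "norm y" "real CARD('i)" B] by linarith
    moreover have "\<bar>(P *v y) $ i\<bar> \<le> norm (P *v y)" for i by (rule component_le_norm_cart)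
    ultimately have "\<bar>(P *v y) $ i\<bar> \<le> real CARD('i) * B" for i
      by (meson order_trans)
    then have "\<forall>i. \<bar>(P *v (\<chi> j. of_int (a $ j))) $ i + x $ i\<bar> \<le> real CARD('i) * B"
      unfolding vector_add_component[symmetric] y by blast
    then show ?thesis by blast
  qed
  then show ?thesis by blast
qed

lemma lattice_z_reduction:
  fixes P :: "real ^ ('m::finite \<times> bool) ^ ('m \<times> bool)"
  assumes "invertible P"
  shows "\<exists>B. \<forall>z. \<exists>\<zeta>\<in>lattice_z P. norm (\<zeta> + z) \<le> B"
proof -
  obtain B where B: "\<And>x. \<exists>a :: int ^ ('m \<times> bool). \<forall>i. \<bar>(P *v (\<chi> j. of_int (a $ j))) $ i + x $ i\<bar> \<le> B"
    using real_lattice_reduction[OF assms] by blast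
  have "\<exists>\<zeta>\<in>lattice_z P. norm (\<zeta> + z) \<le> real CARD('m \<times> bool) * (B + B)" for z
  proof -
    obtain a :: "int ^ ('m \<times> bool)" where a: "\<And>i. \<bar>(P *v (\<chi> j. of_int (a $ j))) $ i + Re (z $ i)\<bar> \<le> B"
      using B[of "\<chi> i. Re (z $ i)"] by auto
    obtain b :: "int ^ ('m \<times> bool)" where b: "\<And>i. \<bar>(P *v (\<chi> j. of_int (b $ j))) $ i + Im (z $ i)\<bar> \<le> B"
      using B[of "\<chi> i. Im (z $ i)"] by auto
    define \<zeta> where "\<zeta> = (\<chi> i. of_real ((P *v (\<chi> j. of_int (a $ j))) $ i)
      + \<i> * of_real ((P *v (\<chi> j. of_int (b $ j))) $ i))"
    have "cmod ((\<zeta> + z) $ i) \<le> B + B" for i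
      using cmod_le[of "(\<zeta> + z) $ i"] a[of i] b[of i] by (simp add: \<zeta>_def)
    then have "norm (\<zeta> + z) \<le> real CARD('m \<times> bool) * (B + B)"
      using norm_le_sum_components[of "\<zeta> + z"]
        sum_bounded_above[of UNIV "\<lambda>i. cmod ((\<zeta> + z) $ i)" "B + B"] by simp
    moreover have "\<zeta> \<in> lattice_z P" unfolding lattice_z_def \<zeta>_def by blast
    ultimately show ?thesis by blast
  qed
  then show ?thesis by blast
qed

text \<open>
  Translations by lattice elements with purely imaginary w-part are deck transformations without
  holonomy; they suffice to move a slab of bounded real part into a compact set.
\<close>

lemma slab_reduction:
  fixes k :: "int ^ ('n::finite \<times> bool)" and P :: "real ^ ('m::finite \<times> bool) ^ ('m \<times> bool)"
  assumes "l \<noteq> 0" "invertible P" "k $ i \<noteq> 0"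
  shows "\<exists>B. \<forall>x. (\<forall>j. j \<noteq> i \<longrightarrow> fst x $ j = 0) \<longrightarrow> \<bar>Re (fst x $ i)\<bar> \<le> h \<longrightarrow>
    (\<exists>a\<in>Gamma l k P. deck_derivative l a = id \<and> norm (a + x) \<le> B)"
proof -
  obtain B where B: "\<And>z. \<exists>\<zeta>\<in>lattice_z P. norm (\<zeta> + z) \<le> B"
    using lattice_z_reduction[OF assms(2)] by blast
  let ?\<mu> = "mu l k $ i"
  have \<mu>: "?\<mu> \<noteq> 0" using assms by (simp add: mu_def)
  have "\<exists>a\<in>Gamma l k P. deck_derivative l a = id \<and> norm (a + x) \<le> (h + \<bar>?\<mu>\<bar>) + B"
    if x: "\<And>j. j \<noteq> i \<Longrightarrow> fst x $ j = 0" "\<bar>Re (fst x $ i)\<bar> \<le> h" for x :: "('n, 'm) cover"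
  proof -
    obtain \<zeta> where \<zeta>: "\<zeta> \<in> lattice_z P" "norm (\<zeta> + snd x) \<le> B" using B by blast
    \<comment> \<open>The imaginary part is reduced modulo \<open>?\<mu>\<close>. The real part is
      left alone, since reducing it would introduce holonomy.\<close>
    define c where "c = - \<lfloor>Im (fst x $ i) / ?\<mu>\<rfloor>"
    define b :: "int ^ ('n \<times> bool)" where "b = (\<chi> j. if j = i then c else 0)"
    \<comment> \<open>With real part 0 the multiplier is \<open>exp 0 = 1\<close>.\<close>
    define w where "w = (\<chi> j. of_int ((0 :: int ^ ('n \<times> bool)) $ j) + \<i> * of_real (mu l k $ j) * of_int (b $ j))"
    define a where "a = (w, \<zeta>)"
    have "w \<in> lattice_w l k" unfolding lattice_w_def w_def by blast
    then have a: "a \<in> Gamma l k P" using \<zeta>(1) by (simp add: Gamma_def a_def)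
    have "rho l w *v z = z" for z :: "complex ^ ('m \<times> bool)"
      using lattice_w_exp(1,2)[OF assms(1) w_def] by (simp add: vec_eq_iff rho_mult)
    then have id: "deck_derivative l a = id"
      by (simp add: fun_eq_iff deck_derivative_def a_def)
    have "fst (a + x) = axis i (fst x $ i + \<i> * of_real (?\<mu> * of_int c))"
      using x(1) by (auto simp: vec_eq_iff axis_def a_def w_def b_def)
    then have "norm (fst (a + x)) \<le> cmod (fst x $ i + \<i> * of_real (?\<mu> * of_int c))"
      by (simp only: norm_axis_le)
    also have "\<dots> \<le> \<bar>Re (fst x $ i)\<bar> + \<bar>Im (fst x $ i) + ?\<mu> * of_int c\<bar>"
      using cmod_le[of "fst x $ i + \<i> * of_real (?\<mu> * of_int c)"] by simp
    also have "Im (fst x $ i) + ?\<mu> * of_int c = ?\<mu> * frac (Im (fst x $ i) / ?\<mu>)"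
      using \<mu> by (simp add: c_def frac_def field_simps)
    also have "\<bar>?\<mu> * frac (Im (fst x $ i) / ?\<mu>)\<bar> \<le> \<bar>?\<mu>\<bar> * 1"
      unfolding abs_mult using frac_lt_1[of "Im (fst x $ i) / ?\<mu>"]
      by (intro mult_left_mono) (auto simp: less_imp_le)
    finally have "norm (fst (a + x)) \<le> h + \<bar>?\<mu>\<bar>" using x(2) by simp
    moreover have "norm (a + x) \<le> norm (fst (a + x)) + norm (snd (a + x))"
      by (metis norm_Pair_le prod.collapse)
    moreover have "norm (snd (a + x)) \<le> B" using \<zeta>(2) by (simp add: a_def)
    ultimately show ?thesis using a id by (intro bexI[of _ a]) auto
  qed
  then show ?thesis by blast
qed

text \<open>A single coefficient of \<Omega> is rescaled by general deck transformations and
  invariant under the holonomy-free ones. By \<open>slab_reduction\<close> these already carry every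
  point of the slab into one fixed ball, where extrema exist.\<close>

lemma bounded_on_slab:
  fixes k :: "int ^ ('n::finite \<times> bool)" and P :: "real ^ ('m::finite \<times> bool) ^ ('m \<times> bool)"
    and f :: "('n, 'm) cover \<Rightarrow> real"
  assumes "l \<noteq> 0" "invertible P" "k $ i \<noteq> 0" and f: "continuous_on UNIV f"
    and inv: "\<And>a x. a \<in> Gamma l k P \<Longrightarrow> deck_derivative l a = id \<Longrightarrow> f (a + x) = f x"
  obtains p q where "\<And>x. (\<And>j. j \<noteq> i \<Longrightarrow> fst x $ j = 0) \<Longrightarrow> \<bar>Re (fst x $ i)\<bar> \<le> h \<Longrightarrow> f p \<le> f x \<and> f x \<le> f q"
proof -
  obtain B where B: "\<And>x. (\<And>j. j \<noteq> i \<Longrightarrow> fst x $ j = 0) \<Longrightarrow> \<bar>Re (fst x $ i)\<bar> \<le> h \<Longrightarrow>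
    (\<exists>a\<in>Gamma l k P. deck_derivative l a = id \<and> norm (a + x) \<le> B)"
    using slab_reduction[OF assms(1-3), of h] by blast
  let ?K = "cball (0 :: ('n, 'm) cover) \<bar>B\<bar>"
  have cont: "continuous_on ?K f" by (rule continuous_on_subset[OF f]) simp
  have ne: "?K \<noteq> {}" by simp
  obtain p where p: "\<forall>y\<in>?K. f p \<le> f y"
    using continuous_attains_inf[OF compact_cball ne cont] by blast
  obtain q where q: "\<forall>y\<in>?K. f y \<le> f q"
    using continuous_attains_sup[OF compact_cball ne cont] by blast
  show thesis
  proof (rule that)
    fix x :: "('n, 'm) cover"
    assume x: "\<And>j. j \<noteq> i \<Longrightarrow> fst x $ j = 0" "\<bar>Re (fst x $ i)\<bar> \<le> h"
    obtain a where a: "a \<in> Gamma l k P" "deck_derivative l a = id" "norm (a + x) \<le> B"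
      using B[OF x] by blast
    have "a + x \<in> ?K" using a(3) by simp
    then show "f p \<le> f x \<and> f x \<le> f q" using p q inv[OF a(1,2), of x] by metis
  qed
qed

section \<open>Membership in the space of Bott-Chern harmonic forms\<close>

context hermitian_structure
begin

text \<open>For types (p,0) and (0,q) the condition on the star holds for every metric, by
  \<open>del_delbar_hodge_star_eq_0\<close>; closedness is all that remains.\<close>

lemma bc_harmonic_pqI:
  assumes "\<alpha> \<in> pq_forms J T p q" "\<And>x vs. del J \<alpha> x vs = 0" "\<And>x vs. delbar J \<alpha> x vs = 0"
    and "(\<forall>x v vs. \<alpha> x (J v # vs) = \<i> * \<alpha> x (v # vs)) \<or>
      (\<forall>x v vs. \<alpha> x (J v # vs) = - \<i> * \<alpha> x (v # vs))"
  shows "\<alpha> \<in> bc_harmonic_pq J T g p q"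
proof -
  have "del J (delbar J (hodge_star J g \<alpha>)) = (\<lambda>x vs. 0)"
    by (rule del_delbar_hodge_star_eq_0[OF _ _ assms(4)])
      (use assms(1) in \<open>auto simp: pq_forms_def intro: pq_covectors_alternating\<close>)
  then show ?thesis using assms(1-3) by (simp add: bc_harmonic_pq_def)
qed

lemma zero_bc_harmonic_pq: "(\<lambda>x vs. 0) \<in> bc_harmonic_pq J T g p q"
proof (rule bc_harmonic_pqI)
  have "wedge_list (replicate p (\<lambda>v. 0) @ replicate q (\<lambda>v. 0)) \<in> pq_covectors J p q"
    by (rule pq_covectors.wedge) (auto simp: covectors10_def covectors01_def linear_zero)
  then have "(\<lambda>vs. 0) \<in> pq_covectors J p q"
    using pq_covectors.scale[of _ J p q 0] by fastforce
  then show "(\<lambda>x vs. 0) \<in> pq_forms J T p q"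
    by (simp add: pq_forms_def smooth_const pullback_def)
qed (simp_all add: del_dolbeault delbar_dolbeault dolbeault_zero)

lemma bc_harmonic_formsI:
  assumes "\<alpha> \<in> bc_harmonic_pq J T g p q" "p \<le> DIM('a) div 2" "q \<le> DIM('a) div 2"
  shows "\<alpha> \<in> bc_harmonic_forms J T g"
proof -
  define \<eta> where "\<eta> = (\<lambda>p' q'. if p' = p \<and> q' = q then \<alpha> else (\<lambda>x vs. 0))"
  have "(\<Sum>p'\<le>DIM('a) div 2. \<Sum>q'\<le>DIM('a) div 2. \<eta> p' q' x vs) = \<alpha> x vs" for x vs
  proof -
    have "(\<Sum>q'\<le>DIM('a) div 2. \<eta> p' q' x vs) = (if p' = p then \<alpha> x vs else 0)" for p'
    proof -
      have "(\<Sum>q'\<le>DIM('a) div 2. \<eta> p' q' x vs) =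
          (\<Sum>q'\<le>DIM('a) div 2. if q' = q then if p' = p then \<alpha> x vs else 0 else 0)"
        by (intro sum.cong refl) (simp add: \<eta>_def)
      then show ?thesis using assms(3) by simp
    qed
    then show ?thesis using assms(2) by simp
  qed
  then have "\<alpha> = (\<lambda>x vs. \<Sum>p'\<le>DIM('a) div 2. \<Sum>q'\<le>DIM('a) div 2. \<eta> p' q' x vs)" by simp
  moreover have "\<forall>p' q'. \<eta> p' q' \<in> bc_harmonic_pq J T g p' q'"
    using assms(1) by (simp add: \<eta>_def zero_bc_harmonic_pq)
  ultimately show ?thesis unfolding bc_harmonic_forms_def by blast
qed

text \<open>Formality places the product in a sum over all bidegrees. Star, delbar and del are
  additive, so the condition passes to the whole sum and the components need not be
  separated.\<close>

lemma bc_harmonic_forms_del_delbar: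
  assumes "\<gamma> \<in> bc_harmonic_forms J T g"
  shows "del J (delbar J (hodge_star J g \<gamma>)) x vs = 0"
proof -
  let ?K = "{..DIM('a) div 2} \<times> {..DIM('a) div 2}"
  obtain \<eta> where \<eta>: "\<gamma> = (\<lambda>x vs. \<Sum>p\<le>DIM('a) div 2. \<Sum>q\<le>DIM('a) div 2. \<eta> p q x vs)"
    "\<And>p q. \<eta> p q \<in> bc_harmonic_pq J T g p q"
    using assms unfolding bc_harmonic_forms_def by blast
  define \<eta>' where "\<eta>' = (\<lambda>k. \<eta> (fst k) (snd k))"
  have \<gamma>: "\<gamma> = (\<lambda>x vs. \<Sum>k\<in>?K. \<eta>' k x vs)"
    unfolding \<eta>(1) by (simp add: sum.cartesian_product case_prod_beta \<eta>'_def)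
  have alt: "\<eta>' k x \<in> alternating_multicovectors" for k x
    using \<eta>(2)[of "fst k" "snd k"]
    by (auto simp: bc_harmonic_pq_def pq_forms_def \<eta>'_def intro: pq_covectors_alternating)
  have smooth: "smooth (\<lambda>x. \<eta>' k x vs)" for k vs
    using \<eta>(2)[of "fst k" "snd k"] by (simp add: bc_harmonic_pq_def pq_forms_def \<eta>'_def)
  have smooth': "smooth (\<lambda>x. hodge_star J g (\<eta>' k) x vs)" for k vs
    by (rule hodge_star_smooth[OF alt smooth])
  have zero: "dolbeault (- \<i>) J (dolbeault \<i> J (hodge_star J g (\<eta>' k))) x vs = 0" for k x vs
    using \<eta>(2)[of "fst k" "snd k"]
    by (simp add: bc_harmonic_pq_def \<eta>'_def del_dolbeault delbar_dolbeault)
  have star: "hodge_star J g \<gamma> = (\<lambda>x vs. \<Sum>k\<in>?K. hodge_star J g (\<eta>' k) x vs)"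
    unfolding \<gamma> by (rule ext, rule hodge_star_sum, rule alt)
  show ?thesis
    unfolding star del_dolbeault delbar_dolbeault
    by (subst dolbeault_sum, rule smooth', subst dolbeault_sum, rule dolbeault_smooth, rule smooth')
      (simp add: zero)
qed

end

section \<open>The solvmanifold is not formal\<close>

locale hermitian_solvmanifold =
  fixes l :: real and k :: "int ^ ('n::finite \<times> bool)" and P :: "real ^ ('m::finite \<times> bool) ^ ('m \<times> bool)"
    and g :: "('n, 'm) cover metric"
  assumes l: "l \<noteq> 0" and P: "invertible P" and k: "\<forall>i. k $ i \<noteq> 0"
    and metric: "hermitian_metric J_N (deck_N l k P) g"

sublocale hermitian_solvmanifold \<subseteq> hermitian_structure J_N g
  by (rule hermitian_metric_imp_structure[OF metric])

section \<open>The harmonic forms \<open>\<alpha>\<close> and \<open>\<beta>\<close>\<close>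

context hermitian_solvmanifold
begin

text \<open>Here \<open>undefined\<close> names an arbitrary but fixed index, which exists because
  types are nonempty.\<close>

definition omitted :: "('n \<times> bool) + ('m \<times> bool)" where
  "omitted = Inr (undefined, False)"

definition others :: "(('n \<times> bool) + ('m \<times> bool)) list" where
  "others = (SOME ks. distinct ks \<and> set ks = UNIV - {omitted})"

lemma others: "distinct others" "set others = UNIV - {omitted}"
proof -
  have "\<exists>ks. distinct ks \<and> set ks = UNIV - {omitted}"
    using finite_distinct_list[of "UNIV - {omitted}"] by auto
  from someI_ex[OF this] show "distinct others" "set others = UNIV - {omitted}"
    unfolding others_def by simp_all
qed

lemma length_others: "Suc (length others) = DIM(('n, 'm) cover) div 2"
proof -
  have "length others = card (UNIV - {omitted})"
    using distinct_card[OF others(1)] others(2) by simp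
  also have "\<dots> = CARD(('n \<times> bool) + ('m \<times> bool)) - 1"
    by (simp add: card_Diff_singleton)
  finally show ?thesis
    unfolding DIM_cover by (simp add: Suc_diff_1 del: card_sum)
qed

abbreviation A :: "('n, 'm) cover multicovector" where
  "A \<equiv> wedge_list (map coordinate others)"

abbreviation B :: "('n, 'm) cover multicovector" where
  "B \<equiv> wedge_list (map (\<lambda>k v. cnj (coordinate k v)) others)"

definition \<alpha> :: "('n, 'm) cover form" where
  "\<alpha> = (\<lambda>x vs. exp (holomorphic_phi l x) * A vs)"

definition \<beta> :: "('n, 'm) cover form" where
  "\<beta> = (\<lambda>x vs. exp (cnj (holomorphic_phi l x)) * B vs)"

lemma cnj_coordinate_linear: "linear (\<lambda>v. cnj (coordinate i v))"
  using linear_compose[OF coordinate_linear[of i] bounded_linear.linear[OF bounded_linear_cnj]]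
  by (simp add: o_def)

lemma \<alpha>_pq: "\<alpha> x \<in> pq_covectors J_N (length others) 0"
proof -
  have "wedge_list (map coordinate others @ []) \<in> pq_covectors J_N (length others) 0"
    by (rule pq_covectors.wedge) (auto simp: covectors10_def coordinate_linear coordinate_J)
  then show ?thesis unfolding \<alpha>_def by (intro pq_covectors.scale) simp
qed

lemma \<beta>_pq: "\<beta> x \<in> pq_covectors J_N 0 (length others)"
proof -
  have "wedge_list ([] @ map (\<lambda>k v. cnj (coordinate k v)) others) \<in> pq_covectors J_N 0 (length others)"
    by (rule pq_covectors.wedge) (auto simp: covectors01_def cnj_coordinate_linear coordinate_J)
  then show ?thesis unfolding \<beta>_def by (intro pq_covectors.scale) simp
qed

lemma bounded_linear_cnj_phi:
  "bounded_linear (\<lambda>x :: ('n, 'm) cover. cnj (holomorphic_phi l x))"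
  by (rule bounded_linear_compose[OF bounded_linear_cnj bounded_linear_holomorphic_phi])

lemma \<alpha>_smooth: "smooth (\<lambda>x. \<alpha> x vs)"
  unfolding \<alpha>_def by (intro smooth_mult smooth_const smooth_exp_linear bounded_linear_holomorphic_phi)

lemma \<beta>_smooth: "smooth (\<lambda>x. \<beta> x vs)"
  unfolding \<beta>_def by (intro smooth_mult smooth_const smooth_exp_linear bounded_linear_cnj_phi)

lemma semidirect_phi:
  "holomorphic_phi l (semidirect_mult l a x) = holomorphic_phi l a + holomorphic_phi l x"
  by (simp add: holomorphic_phi_def semidirect_mult_def sum.distrib distrib_left)

text \<open>The factor \<open>r\<close> gained by the exponential cancels the factor
  \<open>1 / r\<close> of the monomial that lacks one odd coordinate.\<close>

lemma deck_invariant: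
  assumes "a \<in> Gamma l k P"
  shows "\<alpha> (semidirect_mult l a x) (map (deck_derivative l a) vs) = \<alpha> x vs"
    and "\<beta> (semidirect_mult l a x) (map (deck_derivative l a) vs) = \<beta> x vs"
proof -
  obtain r where r: "r > 0" "exp (holomorphic_phi l a) = of_real r"
    "\<And>k v. coordinate k (deck_derivative l a v) = of_real (multiplier r k) * coordinate k v"
    using Gamma_multiplier[OF l assms] by blast
  have set: "set others = UNIV - {Inr (undefined, False)}"
    using others(2) by (simp add: omitted_def)
  have "A (map (deck_derivative l a) vs) = of_real (1 / r) * A vs"
    by (rule coordinate_wedge_multiplier[OF r(1) others(1) set]) (rule r(3))
  moreover have "exp (holomorphic_phi l (semidirect_mult l a x)) = of_real r * exp (holomorphic_phi l x)"
    by (simp add: semidirect_phi exp_add r(2))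
  ultimately show "\<alpha> (semidirect_mult l a x) (map (deck_derivative l a) vs) = \<alpha> x vs"
    unfolding \<alpha>_def using r(1) by simp
  have "B (map (deck_derivative l a) vs) = of_real (1 / r) * B vs"
    by (rule coordinate_wedge_multiplier[OF r(1) others(1) set]) (simp add: r(3))
  moreover have "exp (cnj (holomorphic_phi l (semidirect_mult l a x))) =
      of_real r * exp (cnj (holomorphic_phi l x))"
    using arg_cong[OF r(2), of cnj] by (simp add: semidirect_phi exp_add exp_cnj)
  ultimately show "\<beta> (semidirect_mult l a x) (map (deck_derivative l a) vs) = \<beta> x vs"
    unfolding \<beta>_def using r(1) by simp
qed

lemma \<alpha>_pq_forms: "\<alpha> \<in> pq_forms J_N (deck_N l k P) (length others) 0"
  by (auto simp: pq_forms_def \<alpha>_smooth \<alpha>_pq deck_N_def pullback_def fun_eq_iff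
      frechet_derivative_semidirect_mult deck_invariant)

lemma \<beta>_pq_forms: "\<beta> \<in> pq_forms J_N (deck_N l k P) 0 (length others)"
  by (auto simp: pq_forms_def \<beta>_smooth \<beta>_pq deck_N_def pullback_def fun_eq_iff
      frechet_derivative_semidirect_mult deck_invariant)

lemma Inl_in_others: "Inl i \<in> set others"
  by (simp add: others(2) omitted_def)

lemma \<alpha>_harmonic: "\<alpha> \<in> bc_harmonic_pq J_N (deck_N l k P) g (length others) 0"
proof (rule bc_harmonic_pqI[OF \<alpha>_pq_forms])
  \<comment> \<open>The differential of h combines the dw_i. All of them are factors of
    \<open>A\<close>, as the omitted coordinate is one of the z's.\<close>
  have "covector1 (\<lambda>v. of_real l * (\<Sum>i\<in>UNIV. coordinate (Inl i) v)) \<and>\<^sub>w A = (\<lambda>vs. 0)"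
    by (rule covector1_linear_combination_wedge) (simp add: Inl_in_others)
  then have "covector1 (holomorphic_phi l) \<and>\<^sub>w A = (\<lambda>vs. 0)"
    by (simp add: holomorphic_phi_def[abs_def] coordinate_def)
  then have "dolbeault s J_N \<alpha> x vs = 0" for s x vs
    unfolding \<alpha>_def by (rule dolbeault_exp_eq_0[OF bounded_linear_holomorphic_phi holomorphic_phi_J])
  then show "del J_N \<alpha> x vs = 0" "delbar J_N \<alpha> x vs = 0" for x vs
    by (simp_all add: del_dolbeault delbar_dolbeault)
  have "contract (J_N v) A = (\<lambda>vs. \<i> * contract v A vs)" for v
    by (rule wedge_list_type) (auto simp: coordinate_J)
  then have "A (J_N v # vs) = \<i> * A (v # vs)" for v vs
    by (simp add: contract_def fun_eq_iff)
  then show "(\<forall>x v vs. \<alpha> x (J_N v # vs) = \<i> * \<alpha> x (v # vs)) \<or>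
      (\<forall>x v vs. \<alpha> x (J_N v # vs) = - \<i> * \<alpha> x (v # vs))"
    by (simp add: \<alpha>_def mult.left_commute)
qed

lemma \<beta>_harmonic: "\<beta> \<in> bc_harmonic_pq J_N (deck_N l k P) g 0 (length others)"
proof (rule bc_harmonic_pqI[OF \<beta>_pq_forms])
  have "covector1 (\<lambda>v. of_real l * (\<Sum>i\<in>UNIV. cnj (coordinate (Inl i) v))) \<and>\<^sub>w B = (\<lambda>vs. 0)"
    by (rule covector1_linear_combination_wedge) (simp add: Inl_in_others)
  then have "covector1 (\<lambda>v. cnj (holomorphic_phi l v)) \<and>\<^sub>w B = (\<lambda>vs. 0)"
    by (simp add: holomorphic_phi_def[abs_def] coordinate_def)
  moreover have "cnj (holomorphic_phi l (J_N v)) = - \<i> * cnj (holomorphic_phi l v)" for v :: "('n, 'm) cover"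
    by (simp add: holomorphic_phi_J)
  ultimately have "dolbeault s J_N \<beta> x vs = 0" for s x vs
    unfolding \<beta>_def by (intro dolbeault_exp_eq_0[OF bounded_linear_cnj_phi])
  then show "del J_N \<beta> x vs = 0" "delbar J_N \<beta> x vs = 0" for x vs
    by (simp_all add: del_dolbeault delbar_dolbeault)
  have "contract (J_N v) B = (\<lambda>vs. - \<i> * contract v B vs)" for v
    by (rule wedge_list_type) (auto simp: coordinate_J)
  then have "B (J_N v # vs) = - \<i> * B (v # vs)" for v vs
    by (simp add: contract_def fun_eq_iff)
  then show "(\<forall>x v vs. \<beta> x (J_N v # vs) = \<i> * \<beta> x (v # vs)) \<or>
      (\<forall>x v vs. \<beta> x (J_N v # vs) = - \<i> * \<beta> x (v # vs))"
    by (simp add: \<beta>_def mult.left_commute)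
qed

section \<open>The form \<open>\<Omega>\<close> and its invariance\<close>

definition \<gamma> :: "('n, 'm) cover form" where
  "\<gamma> = (\<lambda>x. \<alpha> x \<and>\<^sub>w \<beta> x)"

definition \<Omega> :: "('n, 'm) cover form" where
  "\<Omega> = hodge_star J_N g \<gamma>"

lemma \<gamma>_alternating: "\<gamma> x \<in> alternating_multicovectors"
  unfolding \<gamma>_def
  by (intro wedge_alternating pq_covectors_alternating[OF \<alpha>_pq] pq_covectors_alternating[OF \<beta>_pq])

lemma \<gamma>_eq: "\<gamma> x vs = of_real ((cmod (exp (holomorphic_phi l x)))\<^sup>2) * (A \<and>\<^sub>w B) vs"
  unfolding \<gamma>_def \<alpha>_def \<beta>_def wedge_scale_left wedge_scale_right complex_norm_square
  by (simp add: exp_cnj)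

lemma \<Omega>_smooth: "smooth (\<lambda>x. \<Omega> x vs)"
  unfolding \<Omega>_def
proof (rule hodge_star_smooth[OF \<gamma>_alternating])
  show "smooth (\<lambda>x. \<gamma> x vs)" for vs
    unfolding \<gamma>_def by (intro smooth_wedge \<alpha>_smooth \<beta>_smooth)
qed

lemma \<Omega>_del_delbar:
  assumes "geometrically_BC_formal J_N (deck_N l k P) g"
  shows "del J_N (delbar J_N \<Omega>) x vs = 0"
proof -
  have le: "length others \<le> DIM(('n, 'm) cover) div 2" using length_others by linarith
  have "\<alpha> \<in> bc_harmonic_forms J_N (deck_N l k P) g" "\<beta> \<in> bc_harmonic_forms J_N (deck_N l k P) g"
    by (rule bc_harmonic_formsI[OF \<alpha>_harmonic le], simp) (rule bc_harmonic_formsI[OF \<beta>_harmonic _ le], simp)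
  then have "\<gamma> \<in> bc_harmonic_forms J_N (deck_N l k P) g"
    using assms unfolding geometrically_BC_formal_def \<gamma>_def by blast
  then show ?thesis unfolding \<Omega>_def by (rule bc_harmonic_forms_del_delbar)
qed

lemma deck_metric:
  assumes "a \<in> Gamma l k P"
  shows "g (semidirect_mult l a x) (deck_derivative l a u) (deck_derivative l a v) = g x u v"
proof -
  have "semidirect_mult l a \<in> deck_N l k P" using assms by (simp add: deck_N_def)
  moreover have "\<forall>\<tau>\<in>deck_N l k P. \<forall>x u v. g (\<tau> x)
      (frechet_derivative \<tau> (at x) u) (frechet_derivative \<tau> (at x) v) = g x u v"
    using metric unfolding hermitian_metric_def by blast
  ultimately have "g (semidirect_mult l a x) (frechet_derivative (semidirect_mult l a) (at x) u)
      (frechet_derivative (semidirect_mult l a) (at x) v) = g x u v"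
    by blast
  then show ?thesis unfolding frechet_derivative_semidirect_mult .
qed

lemma \<Omega>_deck:
  assumes a: "a \<in> Gamma l k P"
  shows "\<Omega> x vs = \<Omega> (semidirect_mult l a x) (map (deck_derivative l a) vs)"
proof -
  let ?L = "deck_derivative l a :: ('n, 'm) cover \<Rightarrow> _"
  obtain r where r: "r > 0"
    "\<And>k v. coordinate k (?L v) = of_real (multiplier r k) * coordinate k v"
    using Gamma_multiplier[OF l a] by blast
  have nz: "multiplier r k \<noteq> 0" for k :: "('n \<times> bool) + ('m \<times> bool)"
    using r(1) by (simp add: multiplier_def split: sum.split)
  have "inj ?L"
  proof (rule injI)
    fix u v assume "?L u = ?L v"
    then have "coordinate k (?L u) = coordinate k (?L v)" for k by simp
    then show "u = v" by (intro cover_eqI) (simp add: r(2) nz)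
  qed
  then have "bij ?L"
    by (simp add: bij_def linear_injective_imp_surjective[OF deck_derivative_linear])
  moreover have "J_N (?L v) = ?L (J_N v)" for v
    by (rule cover_eqI) (simp add: coordinate_J r(2))
  ultimately have "hodge_star J_N g \<gamma> x = (\<lambda>vs. hodge_star J_N g \<gamma> (semidirect_mult l a x) (map ?L vs))"
    by (intro hodge_star_natural deck_derivative_linear deck_metric[OF a] \<gamma>_alternating)
      (simp_all add: \<gamma>_def wedge_map deck_invariant[OF a])
  then show ?thesis unfolding \<Omega>_def by simp
qed

section \<open>Positivity and scaling of the coefficient \<open>F\<close>\<close>

definition W :: "('n, 'm) cover list" where
  "W = J_pairs (map coordinate_axis others)"

text \<open>The constant of the overview: multiplication by it makes the coefficient of \<Omega> in
  the omitted direction real and positive.\<close>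

definition \<kappa> :: complex where
  "\<kappa> = (A \<and>\<^sub>w B) W"

abbreviation Z :: "('n, 'm) cover" where
  "Z \<equiv> coordinate_axis omitted"

lemma \<kappa>_nonzero: "\<kappa> \<noteq> 0"
proof -
  have "map (\<lambda>k v. cnj (coordinate k v)) others = map (\<lambda>\<theta> v. cnj (\<theta> v)) (map coordinate others)"
    by simp
  then show ?thesis
    unfolding \<kappa>_def W_def
    by (simp only:) (rule wedge_list_cnj_J_pairs_nonzero,
        auto simp: coordinate_J coordinate_axis nth_eq_iff_index_eq[OF others(1)])
qed

lemma J_independent_axes:
  fixes ks :: "(('n \<times> bool) + ('m \<times> bool)) list"
  shows "distinct ks \<Longrightarrow> J_independent (map coordinate_axis ks)"
proof (induction ks)
  case (Cons i ks)
  have "coordinate i v = 0" if "v \<in> span (set (J_pairs (map coordinate_axis ks)))" for v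
    using that
  proof (induction rule: span_induct_alt)
    case base
    then show ?case by (rule linear_0[OF coordinate_linear])
  next
    case (step c x y)
    have "coordinate i x = 0"
      using step(1) Cons.prems by (auto simp: J_pairs_def coordinate_J coordinate_axis)
    then show ?case
      using step(2) by (simp add: linear_add[OF coordinate_linear] linear_scale[OF coordinate_linear])
  qed
  then have "coordinate_axis i \<notin> span (set (J_pairs (map coordinate_axis ks)))"
    using coordinate_axis[of i i] by fastforce
  then show ?case using Cons by simp
qed simp

lemma length_W: "length W = length others + length others"
proof -
  have "length (J_pairs us) = length us + length us" for us :: "('n, 'm) cover list"
    unfolding J_pairs_def by (induction us) auto
  then show ?thesis by (simp add: W_def)
qed

text \<open>Evaluate the product of \<open>\<gamma>\<close> with its star, which is the squared norm
  of \<open>\<gamma>\<close> times the volume form, on \<open>Z\<close>, \<open>J_N Z\<close> and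
  \<open>W\<close>. Since \<open>Z\<close> and \<open>J_N Z\<close> annihilate
  \<open>\<gamma>\<close>, only \<open>\<gamma> x W\<close> times the wanted coefficient survives,
  and \<open>\<gamma> x W\<close> is a positive multiple of \<open>\<kappa>\<close>.\<close>

lemma \<Omega>_pos: obtains r where "r > 0" "\<kappa> * \<Omega> x [Z, J_N Z] = of_real r"
proof -
  let ?e = "(cmod (exp (holomorphic_phi l x)))\<^sup>2"
  have e: "?e > 0" by simp
  have dist: "distinct (omitted # others)" using others by simp
  have len: "length (map coordinate_axis (omitted # others)) = DIM(('n, 'm) cover) div 2"
    using length_others by simp
  obtain v where v: "v > 0" "volume_form J_N g x (J_pairs (map coordinate_axis (omitted # others))) = of_real v"
    using volume_form_pos[OF J_independent_axes[OF dist] len] by blast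
  have \<gamma>W: "\<gamma> x W = of_real ?e * \<kappa>" unfolding \<gamma>_eq \<kappa>_def ..
  then have "\<gamma> x W \<noteq> 0" using \<kappa>_nonzero by simp
  then obtain s where s: "s > 0" "covector_inner g x (\<gamma> x) (\<gamma> x) = of_real s"
    using covector_inner_self_pos[OF \<gamma>_alternating] by blast
  have pairs: "J_pairs (map coordinate_axis (omitted # others)) = Z # J_N Z # W"
    by (simp add: J_pairs_def W_def)
  have "DIM(('n, 'm) cover) = 2 * (DIM(('n, 'm) cover) div 2)" by simp
  then have lenZ: "length (Z # J_N Z # W) = DIM(('n, 'm) cover)"
    using length_others length_W by simp
  have kill: "contract u (A \<and>\<^sub>w B) = (\<lambda>vs. 0)" if u: "\<And>k. k \<in> set others \<Longrightarrow> coordinate k u = 0" for u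
  proof -
    have "contract u A = (\<lambda>vs. 0)" "contract u B = (\<lambda>vs. 0)"
      by (rule contract_wedge_list_eq_0, use u in auto)+
    then show ?thesis by (simp add: contract_wedge)
  qed
  have Z: "coordinate k Z = 0" "coordinate k (J_N Z) = 0" if "k \<in> set others" for k
    using that by (auto simp: others(2) coordinate_J coordinate_axis)
  have contr: "contract u (\<gamma> x) = (\<lambda>vs. 0)" if "contract u (A \<and>\<^sub>w B) = (\<lambda>vs. 0)" for u
    using that by (simp add: contract_def \<gamma>_eq fun_eq_iff)
  have "homogeneous (length W) (A \<and>\<^sub>w B)"
    unfolding length_W
    using wedge_homogeneous[OF wedge_list_homogeneous wedge_list_homogeneous,
        of "map coordinate others" "map (\<lambda>k v. cnj (coordinate k v)) others"] by simp
  then have hom: "homogeneous (length W) (\<gamma> x)" by (simp add: homogeneous_def \<gamma>_eq)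
  have "\<gamma> x W * \<Omega> x [Z, J_N Z] = (\<gamma> x \<and>\<^sub>w \<Omega> x) (Z # J_N Z # W)"
    by (rule wedge_contract2[symmetric, OF contr[OF kill[OF Z(1)]] contr[OF kill[OF Z(2)]] hom])
  also have "\<dots> = of_real (s * v)"
    unfolding \<Omega>_def using wedge_hodge_star[of \<gamma> x, OF \<gamma>_alternating \<gamma>_alternating[of x] lenZ] s(2)
      v(2)[unfolded pairs]
    by simp
  finally have "\<kappa> * \<Omega> x [Z, J_N Z] = of_real (s * v / ?e)"
    using e unfolding \<gamma>W of_real_divide by (simp add: field_simps)
  moreover have "s * v / ?e > 0" using s(1) v(1) e by simp
  ultimately show thesis by (intro that) 
qed

definition F :: "('n, 'm) cover \<Rightarrow> complex" where
  "F x = \<kappa> * \<Omega> x [Z, J_N Z]"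

abbreviation X :: "('n, 'm) cover" where
  "X \<equiv> coordinate_axis (Inl (undefined, False))"

lemma F_pos: "Re (F x) > 0"
  using \<Omega>_pos[of x] by (metis F_def Re_complex_of_real)

lemma \<Omega>_translate:
  assumes "a \<in> Gamma l k P" "deck_derivative l a = (id :: ('n, 'm) cover \<Rightarrow> _)"
  shows "\<Omega> (a + x) vs = \<Omega> x vs"
  using \<Omega>_deck[OF assms(1), of x vs] by (simp add: semidirect_mult_eq assms(2))

text \<open>The factor is 1 / r^2 because the holonomy scales both Z and JZ by r.\<close>

lemma F_translate:
  fixes N :: int and t x y :: real
  defines "r \<equiv> exp (l * of_int N)"
  shows "F (of_int N *\<^sub>R X + (t *\<^sub>R J_N X + x *\<^sub>R Z + y *\<^sub>R J_N Z)) =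
    of_real (1 / r\<^sup>2) * F (t *\<^sub>R J_N X + (x / r) *\<^sub>R Z + (y / r) *\<^sub>R J_N Z)"
proof -
  define a :: "('n, 'm) cover" where "a = of_int N *\<^sub>R X"
  \<comment> \<open>The deck transformation of \<open>a\<close> multiplies the coordinates along
    \<open>Z\<close> and \<open>J_N Z\<close> by \<open>r\<close>; dividing by \<open>r\<close>
    beforehand makes \<open>q\<close> the preimage of the given point.\<close>
  define q where "q = t *\<^sub>R J_N X + (x / r) *\<^sub>R Z + (y / r) *\<^sub>R J_N Z"
  let ?L = "deck_derivative l a :: ('n, 'm) cover \<Rightarrow> _"
  have "fst a = (\<chi> i. of_int ((\<chi> i. if i = (undefined, False) then N else 0) $ i)
      + \<i> * of_real (mu l k $ i) * of_int ((0 :: int ^ ('n \<times> bool)) $ i))"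
    by (simp add: a_def coordinate_axis_def axis_def vec_eq_iff complex_eq_iff)
  then have "fst a \<in> lattice_w l k" unfolding lattice_w_def by blast
  moreover have "snd a = (\<chi> i. of_real ((P *v (\<chi> j. of_int ((0 :: int ^ ('m \<times> bool)) $ j))) $ i)
      + \<i> * of_real ((P *v (\<chi> j. of_int ((0 :: int ^ ('m \<times> bool)) $ j))) $ i))"
    by (simp add: a_def coordinate_axis_def vec_eq_iff matrix_vector_mult_def)
  then have "snd a \<in> lattice_z P" unfolding lattice_z_def by blast
  ultimately have a: "a \<in> Gamma l k P" by (simp add: Gamma_def mem_Times_iff)
  obtain r' where r': "r' > 0" "exp (holomorphic_phi l a) = of_real r'"
    "\<And>k v. coordinate k (?L v) = of_real (multiplier r' k) * coordinate k v"
    using Gamma_multiplier[OF l a] by blast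
  have "fst a $ i = (if i = (undefined, False) then of_int N else 0)" for i
    by (simp add: a_def coordinate_axis_def axis_def complex_eq_iff)
  then have "holomorphic_phi l a = of_real (l * of_int N)"
    by (simp add: holomorphic_phi_def)
  then have "of_real r' = complex_of_real r"
    using r'(2) by (simp only: exp_of_real r_def)
  then have r: "r' = r" by simp
  have L: "?L X = X" "?L (J_N X) = J_N X" "?L Z = r *\<^sub>R Z" "?L (J_N Z) = r *\<^sub>R J_N Z"
    by (rule cover_eqI, simp add: r'(3) r coordinate_J coordinate_axis multiplier_def omitted_def
        linear_scale[OF coordinate_linear] scaleR_conv_of_real split: sum.split)+
  have "?L q = t *\<^sub>R J_N X + x *\<^sub>R Z + y *\<^sub>R J_N Z"
    unfolding q_def by (simp add: linear_add[OF deck_derivative_linear]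
        linear_scale[OF deck_derivative_linear] L r_def)
  then have "\<Omega> q [Z, J_N Z] =
      \<Omega> (a + (t *\<^sub>R J_N X + x *\<^sub>R Z + y *\<^sub>R J_N Z)) ([] @ (r *\<^sub>R Z) # [r *\<^sub>R J_N Z])"
    using \<Omega>_deck[OF a, of q "[Z, J_N Z]"] by (simp add: semidirect_mult_eq L)
  also have "\<dots> = of_real (r\<^sup>2) * \<Omega> (a + (t *\<^sub>R J_N X + x *\<^sub>R Z + y *\<^sub>R J_N Z)) [Z, J_N Z]"
  proof -
    have alt: "\<Omega> p \<in> alternating_multicovectors" for p
      unfolding \<Omega>_def by (rule hodge_star_alternating[OF \<gamma>_alternating])
    let ?p = "a + (t *\<^sub>R J_N X + x *\<^sub>R Z + y *\<^sub>R J_N Z)"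
    have "\<Omega> ?p [Z, r *\<^sub>R J_N Z] = r *\<^sub>R \<Omega> ?p [Z, J_N Z]"
      using alternating_scaleR[OF alt[of ?p], of "[Z]" r "J_N Z" "[]"] by simp
    then show ?thesis
      unfolding alternating_scaleR[OF alt] by (simp add: scaleR_conv_of_real power2_eq_square)
  qed
  finally have "F q = of_real (r\<^sup>2) * F (a + (t *\<^sub>R J_N X + x *\<^sub>R Z + y *\<^sub>R J_N Z))"
    by (simp add: F_def)
  moreover have "r \<noteq> 0" by (simp add: r_def)
  ultimately show ?thesis by (simp add: a_def q_def)
qed

section \<open>The contradiction\<close>

lemma slab_coordinates:
  fixes s t x y :: real
  defines "p \<equiv> s *\<^sub>R X + t *\<^sub>R J_N X + x *\<^sub>R Z + y *\<^sub>R J_N Z"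
  shows "j \<noteq> (undefined, False) \<Longrightarrow> fst p $ j = 0" "Re (fst p $ (undefined, False)) = s"
  unfolding p_def by (simp_all add: coordinate_axis_def omitted_def axis_def J_N_def)

lemma not_geometrically_BC_formal: "\<not> geometrically_BC_formal J_N (deck_N l k P) g"
proof
  assume formal: "geometrically_BC_formal J_N (deck_N l k P) g"
  let ?i = "(undefined :: 'n, False)"
  have k_i: "k $ ?i \<noteq> 0" using k by blast
  define e where "e = (!) [X, J_N X, Z, J_N Z]"
  have e: "e 0 = X" "e 1 = J_N X" "e 2 = Z" "e 3 = J_N Z" by (simp_all add: e_def)
  obtain G :: "nat \<times> nat \<Rightarrow> ('n, 'm) cover \<Rightarrow> complex" where G:
    "\<And>k. k \<in> {..<4} \<times> {..<4} \<Longrightarrow> smooth (G k)"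
    "\<And>x. second_derivative (e 0) (e 0) (\<lambda>y. \<Omega> y [Z, J_N Z]) x =
      (\<Sum>k\<in>{..<4} \<times> {..<4} - {(0, 0)}. second_derivative (e (fst k)) (e (snd k)) (G k) x)"
    "\<And>k p C. k \<in> {..<4} \<times> {..<4} \<Longrightarrow> (\<And>i j. i < 4 \<Longrightarrow> j < 4 \<Longrightarrow> cmod (\<Omega> p [e i, e j]) \<le> C) \<Longrightarrow>
      cmod (G k p) \<le> 4 * C"
    using del_delbar_2form_plane[OF \<Omega>_smooth \<Omega>_del_delbar[OF formal], where X = X and Z = Z,
        folded e_def] by blast
  have smooth_F: "smooth F"
    unfolding F_def[abs_def] by (intro smooth_mult smooth_const \<Omega>_smooth)
  have cont_F: "continuous_on UNIV (\<lambda>x. Re (F x))"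
    by (intro continuous_on_Re smooth_continuous smooth_F)
  \<comment> \<open>Bounds at \<open>X\<close>-coordinate 0 suffice for \<open>F\<close>, since
    \<open>F_translate\<close> leads back there from all multiples of \<open>X\<close>.\<close>
  obtain p q where pq: "\<And>x. (\<And>j. j \<noteq> ?i \<Longrightarrow> fst x $ j = 0) \<Longrightarrow> \<bar>Re (fst x $ ?i)\<bar> \<le> 0 \<Longrightarrow>
      Re (F p) \<le> Re (F x) \<and> Re (F x) \<le> Re (F q)"
    by (rule bounded_on_slab[OF l P k_i cont_F, where h = 0]) (auto simp: F_def \<Omega>_translate)
  define c C where "c = Re (F p)" and "C = Re (F q)"
  have F0: "c \<le> Re (F (t *\<^sub>R J_N X + x *\<^sub>R Z + y *\<^sub>R J_N Z))"
    "Re (F (t *\<^sub>R J_N X + x *\<^sub>R Z + y *\<^sub>R J_N Z)) \<le> C" for t x y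
    using pq[OF slab_coordinates(1)[where s = 0]] slab_coordinates(2)[of 0 t x y]
    by (simp_all add: c_def C_def)
  have c: "c > 0" and C: "C > 0" unfolding c_def C_def by (rule F_pos)+
  \<comment> \<open>Large enough that, by exp(x) >= 1 + x, the growing translate of \<open>F\<close>
    exceeds twice its maximum at coordinate 0 by more than 1, the value later taken for
    \<open>\<delta>\<close>.\<close>
  obtain N :: nat where N: "(2 * C + 1) / (2 * \<bar>l\<bar> * c) < real N"
    using reals_Archimedean2 by blast
  then have "2 * C + 1 < 2 * \<bar>l\<bar> * real N * c"
    using l c by (simp add: field_simps)
  also have "\<dots> \<le> exp (2 * \<bar>l\<bar> * real N) * c"
    using exp_ge_add_one_self[of "2 * \<bar>l\<bar> * real N"] c by (intro mult_right_mono) linarith+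
  finally have large: "exp (2 * \<bar>l\<bar> * real N) * c > 2 * C + 1" .
  have "0 < (2 * C + 1) / (2 * \<bar>l\<bar> * c)" using l c C by simp
  then have N0: "real N > 0" using N by linarith
  \<comment> \<open>One invariant continuous function that dominates all coefficients in question,
    so that a single bound covers the slab of half-width \<open>N\<close>.\<close>
  define u where "u = (\<lambda>x. \<Sum>i<4. \<Sum>j<4. cmod (\<Omega> x [e i, e j]))"
  have cont_u: "continuous_on UNIV u"
    unfolding u_def by (intro continuous_intros smooth_continuous \<Omega>_smooth)
  obtain p' q' where q': "\<And>x. (\<And>j. j \<noteq> ?i \<Longrightarrow> fst x $ j = 0) \<Longrightarrow> \<bar>Re (fst x $ ?i)\<bar> \<le> real N \<Longrightarrow>
      u p' \<le> u x \<and> u x \<le> u q'"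
    by (rule bounded_on_slab[OF l P k_i cont_u, where h = "real N"]) (auto simp: u_def \<Omega>_translate)
  have bound: "cmod (\<Omega> x [e i, e j]) \<le> u x" if "i < 4" "j < 4" for i j x
  proof -
    have "cmod (\<Omega> x [e i, e j]) \<le> (\<Sum>j<4. cmod (\<Omega> x [e i, e j]))"
      using that by (intro member_le_sum) auto
    also have "\<dots> \<le> u x"
      unfolding u_def using that
      by (intro member_le_sum[of i _ "\<lambda>i. \<Sum>j<4. cmod (\<Omega> x [e i, e j])"]) (auto intro: sum_nonneg)
    finally show ?thesis .
  qed
  show False
  proof (rule averaged_second_difference_contradiction[where e = e and F = F and h = "real N" and
        K = "{..<4} \<times> {..<4} - {(0, 0)}" and f = "\<lambda>k x. \<kappa> * G k x" and u = fst and v = snd and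
        C = "cmod \<kappa> * (4 * u q')" and \<delta> = 1])
    show "smooth (\<lambda>x. \<kappa> * G k x)" if "k \<in> {..<4} \<times> {..<4} - {(0, 0)}" for k
      using that by (intro smooth_mult smooth_const G(1)) auto
    show "fst k < 4 \<and> snd k < 4 \<and> \<not> (fst k = 0 \<and> snd k = 0)"
      if "k \<in> {..<4} \<times> {..<4} - {(0, 0)}" for k :: "nat \<times> nat"
      using that by (auto simp: prod_eq_iff)
    show "frechet_derivative (\<lambda>y. frechet_derivative F (at y) (e 0)) (at x) (e 0) =
      (\<Sum>k\<in>{..<4} \<times> {..<4} - {(0, 0)}.
        frechet_derivative (\<lambda>y. frechet_derivative (\<lambda>x. \<kappa> * G k x) (at y) (e (snd k))) (at x) (e (fst k)))" for x
    proof -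
      have "second_derivative (e 0) (e 0) F x =
          \<kappa> * (\<Sum>k\<in>{..<4} \<times> {..<4} - {(0, 0)}. second_derivative (e (fst k)) (e (snd k)) (G k) x)"
        unfolding F_def[abs_def] second_derivative_algebra(3)[OF \<Omega>_smooth] G(2) ..
      also have "\<dots> = (\<Sum>k\<in>{..<4} \<times> {..<4} - {(0, 0)}.
          second_derivative (e (fst k)) (e (snd k)) (\<lambda>x. \<kappa> * G k x) x)"
        unfolding sum_distrib_left
        by (intro sum.cong refl second_derivative_algebra(3)[symmetric] G(1)) auto
      finally show ?thesis unfolding second_derivative_def .
    qed
    show "cmod (\<kappa> * G k (s *\<^sub>R e 0 + t *\<^sub>R e 1 + x *\<^sub>R e 2 + y *\<^sub>R e 3)) \<le> cmod \<kappa> * (4 * u q')"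
      if k: "k \<in> {..<4} \<times> {..<4} - {(0, 0)}" and s: "\<bar>s\<bar> \<le> real N" for k s t x y
    proof -
      let ?p = "s *\<^sub>R X + t *\<^sub>R J_N X + x *\<^sub>R Z + y *\<^sub>R J_N Z"
      have "u ?p \<le> u q'"
        using q'[OF slab_coordinates(1)] slab_coordinates(2)[of s t x y] s by simp
      then have "cmod (\<Omega> ?p [e i, e j]) \<le> u q'" if "i < 4" "j < 4" for i j
        using bound[OF that, of ?p] by linarith
      then have "cmod (G k ?p) \<le> 4 * u q'"
        using k by (intro G(3)) auto
      then show ?thesis unfolding e norm_mult by (intro mult_left_mono) auto
    qed
    show "let q = t *\<^sub>R e 1 + x *\<^sub>R e 2 + y *\<^sub>R e 3
      in 1 \<le> Re (F (real N *\<^sub>R e 0 + q) - 2 * F q + F (- real N *\<^sub>R e 0 + q))" for t x y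
    proof -
      let ?q = "t *\<^sub>R J_N X + x *\<^sub>R Z + y *\<^sub>R J_N Z"
      have F_ge: "Re (F (of_int M *\<^sub>R X + ?q)) \<ge> exp (- 2 * l * of_int M) * c" for M :: int
      proof -
        have "1 / (exp (l * of_int M))\<^sup>2 = exp (- 2 * l * of_int M)"
          by (simp add: exp_minus power2_eq_square field_simps flip: exp_add)
        then show ?thesis
          unfolding F_translate using F0(1) by (simp add: mult_left_mono)
      qed
      \<comment> \<open>The sign of \<open>l\<close> decides which of the two translates is the
        large one; the other merely has positive real part.\<close>
      have "exp (2 * \<bar>l\<bar> * real N) * c \<le> Re (F (real N *\<^sub>R X + ?q)) + Re (F (- real N *\<^sub>R X + ?q))"
      proof (cases "l > 0")
        case True
        then show ?thesis
          using F_ge[of "- int N"] F_pos[of "real N *\<^sub>R X + ?q"] by simp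
      next
        case False
        then show ?thesis
          using F_ge[of "int N"] F_pos[of "- real N *\<^sub>R X + ?q"] by simp
      qed
      then show ?thesis
        using large F0(2)[of t x y] unfolding Let_def e by simp
    qed
  qed (use N0 smooth_F in auto)
qed

end

theorem theorem5p1:
  fixes l :: real
    and M :: "int ^ ('m::finite \<times> bool) ^ ('m \<times> bool)"
    and P :: "real ^ ('m \<times> bool) ^ ('m \<times> bool)"
    and k :: "int ^ ('n::finite \<times> bool)"
  assumes "l \<noteq> 0"
    and "det M = 1"
    and "invertible P"
    and "P ** map_matrix of_int M ** matrix_inv P = hyperbolic_diag l"
    and "\<forall>i. k $ i \<noteq> 0"
  shows "\<not> (\<exists>g. hermitian_metric J_N (deck_N l k P) g \<and>
      geometrically_BC_formal J_N (deck_N l k P) g)"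
proof
  assume "\<exists>g. hermitian_metric J_N (deck_N l k P) g \<and> geometrically_BC_formal J_N (deck_N l k P) g"
  then obtain g where g: "hermitian_metric J_N (deck_N l k P) g"
    "geometrically_BC_formal J_N (deck_N l k P) g" by blast
  interpret hermitian_solvmanifold l k P g
    by (rule hermitian_solvmanifold.intro) (fact assms g)+
  show False using not_geometrically_BC_formal g(2) by contradiction
qed

end
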